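(* Let $F$ be a positive, increasing, locally integrable real function on $[1,\infty)$ satisfying $F(2x)\ll F(x)$. Suppose that either \[ \log x\ll F(x)\ll x^{\frac{1}{h-1}} \qquad\text{or}\qquad (\log x)^{2h^2}\ll F(x)\ll x^{h-1}. \] Then there exists $A\subseteq\mathbb{Z}_{\ge0}$ such that $|A\cap[1,x]|\asymp (xF(x))^{1/h}$ and $r_{A,h}(n)\asymp F(n)$.
   Context: Fix an integer $h\ge 2$ and positive integers $b_1,\dots,b_h$, not necessarily distinct, with $\gcd(b_1,\dots,b_h)=1$. For $A\subseteq\mathbb{Z}_{\ge 0}$, $1\le\ell\le h$ and an integer $n\ge 0$, let $r_{A,\ell}(n)$ be the number of $\ell$-tuples $(k_1,\dots,k_\ell)\in A^\ell$ with $b_1k_1+\cdots+b_\ell k_\ell=n$. Asymptotic notation: $X\ll Y$ means $|X|\le CY$ for some constant $C>0$ and all sufficiently large values of the variable. $X\asymp Y$ means $X\ll Y$ and $Y\ll X$. *)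

theory Defs
  imports "HOL-Analysis.Analysis" "HOL-Library.Landau_Symbols"
begin

text \<open>Representation count r_{A,l}(n): number of l-tuples (k_1,...,k_l) in A^l with
  b_1 k_1 + ... + b_l k_l = n. Tuples are functions on {1..l}, extended by 0 outside.\<close>
definition rep_count :: "(nat \<Rightarrow> nat) \<Rightarrow> nat set \<Rightarrow> nat \<Rightarrow> nat \<Rightarrow> nat" where
  "rep_count b A l n = card {k :: nat \<Rightarrow> nat. (\<forall>i\<in>{1..l}. k i \<in> A) \<and> (\<forall>i. i \<notin> {1..l} \<longrightarrow> k i = 0)
      \<and> (\<Sum>i=1..l. b i * k i) = n}"

definition count_upto :: "nat set \<Rightarrow> real \<Rightarrow> nat" where
  "count_upto A x = card {a\<in>A. 1 \<le> a \<and> real a \<le> x}"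

end

theory Submission
  imports Defs "HOL-Real_Asymp.Real_Asymp"
begin

text \<open>
  The set is random: \<open>v\<close> is chosen independently with probability
  \<open>min 1 (M * F v powr (1 / h) * v powr (1 / h - 1))\<close>, so that the expected number of representations of \<open>n\<close>
  is of order \<open>F n\<close>. Only finitely many \<open>v\<close> matter for a given \<open>n\<close>, so finite product measures and a
  compactness argument suffice.

  Lower bound: Janson's inequality, applied to the representations with all entries of order \<open>n\<close>. As
  \<open>F n\<close> is at least of order \<open>ln n\<close>, a large constant \<open>M\<close> makes the failure probability at most \<open>n\<^sup>-\<^sup>3\<close>.

  Upper bound: if \<open>F n\<close> exceeds a suitable power of \<open>ln n\<close>, bound the moment of order about \<open>4 ln n\<close> of the
  number of representations. Otherwise choose a scale at which no entry of a given representation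
      lies
  between \<open>t\<close> and a large power of \<open>t\<close>. There are boundedly many choices for the large entries, unless all
  entries are large; the small ones are counted by induction on the number of unknowns. If all
      entries
  are large, a maximal disjoint family has \<open>O(F n)\<close> members, and boundedly many representations share a
  given entry.

  The size of the set follows from the number of representations, because the tuples with entries
      up to
  \<open>x\<close> represent integers of order at most \<open>x\<close>, and all representations of the integers up to \<open>x\<close> are of this kind.
\<close>

text \<open>Both alternatives give ln x << F(x) << x^(h-1), and the locale \<open>growth\<close>
  records this range with uniform constants. The obstacle is that representations share entries, so
  their indicators are dependent. In the moment method about h q entries are already exposed, with q
  near 4 ln n; a further representation that reuses exposed entries has up to (h q)^h ways to do so,
  but it also loses at least one factor of order F(n)^(1/h). The method therefore works once
  F(n)^(1/h) exceeds (h q)^h, which is where the power of the logarithm comes from. For smaller F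
  the gain comes from equations in fewer than h unknowns: their expected number of solutions decays
  like a power of the smallest admissible entry, so a bounded number of disjoint solutions is
  already very unlikely. Small entries destroy this decay and must be split off. What they
  contribute is known only up to a short interval, so the large entries solve the equation only
  approximately, and the thresholds must grow fast enough for the decay to beat the length of that
  interval. The two parts of a split are sub-equations, hence all upper bounds are stated for every
  nonempty set of unknowns.\<close>

section \<open>Product Bernoulli measures on finite sets\<close>

text \<open>The expectation of \<open>f S\<close> when every \<open>v \<in> V\<close> is put into \<open>S\<close> independently with
  probability \<open>p v\<close>.\<close>

definition bexp :: "'a set \<Rightarrow> ('a \<Rightarrow> real) \<Rightarrow> ('a set \<Rightarrow> real) \<Rightarrow> real" where
  "bexp V p f = (\<Sum>S\<in>Pow V. (\<Prod>v\<in>S. p v) * (\<Prod>v\<in>V - S. 1 - p v) * f S)"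

lemma bexp_empty [simp]: "bexp {} p f = f {}"
  by (simp add: bexp_def)

lemma bexp_insert:
  assumes "finite V" "v \<notin> V"
  shows "bexp (insert v V) p f = (1 - p v) * bexp V p f + p v * bexp V p (\<lambda>S. f (insert v S))"
proof -
  let ?w = "\<lambda>V S. (\<Prod>v\<in>S. p v) * (\<Prod>v\<in>V - S. 1 - p v)"
  have inj: "inj_on (insert v) (Pow V)"
    using assms(2) by (auto simp: inj_on_def)
  have disj: "Pow V \<inter> insert v ` Pow V = {}"
    using assms(2) by auto
  have "bexp (insert v V) p f = (\<Sum>S\<in>Pow V. ?w (insert v V) S * f S)
      + (\<Sum>S\<in>insert v ` Pow V. ?w (insert v V) S * f S)"
    unfolding bexp_def Pow_insert
    by (subst sum.union_disjoint) (use assms disj in auto)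
  also have "(\<Sum>S\<in>Pow V. ?w (insert v V) S * f S) = (1 - p v) * bexp V p f"
    unfolding bexp_def sum_distrib_left
  proof (intro sum.cong refl)
    fix S assume S: "S \<in> Pow V"
    then have "insert v V - S = insert v (V - S)" "v \<notin> V - S" "finite (V - S)"
      using assms by auto
    then show "?w (insert v V) S * f S = (1 - p v) * (?w V S * f S)"
      by simp
  qed
  also have "(\<Sum>S\<in>insert v ` Pow V. ?w (insert v V) S * f S)
      = p v * bexp V p (\<lambda>S. f (insert v S))"
    unfolding bexp_def sum_distrib_left sum.reindex[OF inj] o_def
  proof (intro sum.cong refl)
    fix S assume S: "S \<in> Pow V"
    then have "insert v V - insert v S = V - S" "v \<notin> S" "finite S"
      using assms finite_subset by auto
    then show "?w (insert v V) (insert v S) * f (insert v S) = p v * (?w V S * f (insert v S))"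
      by simp
  qed
  finally show ?thesis .
qed

lemma bexp_cong: "(\<And>S. S \<subseteq> V \<Longrightarrow> f S = g S) \<Longrightarrow> bexp V p f = bexp V p g"
  unfolding bexp_def by (intro sum.cong) auto

lemma bexp_add: "bexp V p (\<lambda>S. f S + g S) = bexp V p f + bexp V p g"
  unfolding bexp_def by (simp add: algebra_simps sum.distrib)

lemma bexp_cmult: "bexp V p (\<lambda>S. c * f S) = c * bexp V p f"
  unfolding bexp_def by (simp add: algebra_simps sum_distrib_left)

lemma bexp_diff: "bexp V p (\<lambda>S. f S - g S) = bexp V p f - bexp V p g"
  unfolding bexp_def by (simp add: algebra_simps sum_subtractf)

lemma bexp_sum: "bexp V p (\<lambda>S. \<Sum>x\<in>X. f x S) = (\<Sum>x\<in>X. bexp V p (f x))"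
  unfolding bexp_def sum_distrib_left by (rule sum.swap)

lemma bexp_const:
  assumes "finite V"
  shows "bexp V p (\<lambda>S. c) = c"
  using assms by (induction V) (auto simp: bexp_insert algebra_simps)

lemma bexp_mono:
  assumes "finite V" "\<And>v. v \<in> V \<Longrightarrow> 0 \<le> p v \<and> p v \<le> 1" "\<And>S. S \<subseteq> V \<Longrightarrow> f S \<le> g S"
  shows "bexp V p f \<le> bexp V p g"
  unfolding bexp_def
proof (intro sum_mono mult_left_mono mult_nonneg_nonneg prod_nonneg)
qed (use assms in auto)

lemma bexp_nonneg:
  assumes "finite V" "\<And>v. v \<in> V \<Longrightarrow> 0 \<le> p v \<and> p v \<le> 1" "\<And>S. S \<subseteq> V \<Longrightarrow> 0 \<le> f S"
  shows "0 \<le> bexp V p f"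
  using bexp_mono[of V p "\<lambda>_. 0" f] assms by (simp add: bexp_const)

text \<open>Conditioning on \<open>R \<subseteq> S\<close> leaves the other elements independent, so
  the expectation factors into the probability of the condition and an expectation over
  \<open>V - R\<close>.\<close>

lemma bexp_indicator_times:
  assumes "finite V" "R \<subseteq> V"
  shows "bexp V p (\<lambda>S. of_bool (R \<subseteq> S) * g S) = (\<Prod>v\<in>R. p v) * bexp (V - R) p (\<lambda>S. g (R \<union> S))"
proof -
  have "finite R" using assms finite_subset by auto
  then show ?thesis using assms
  proof (induction R arbitrary: V g)
    case empty
    then show ?case by simp
  next
    case (insert r R)
    let ?V = "V - {r}"
    have V: "V = insert r ?V" "r \<notin> ?V" "finite ?V" "R \<subseteq> ?V" using insert by auto
    have "bexp V p (\<lambda>S. of_bool (insert r R \<subseteq> S) * g S)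
      = (1 - p r) * bexp ?V p (\<lambda>S. of_bool (insert r R \<subseteq> S) * g S)
       + p r * bexp ?V p (\<lambda>S. of_bool (insert r R \<subseteq> insert r S) * g (insert r S))"
      by (subst V(1), subst bexp_insert) (use V in auto)
    also have "bexp ?V p (\<lambda>S. of_bool (insert r R \<subseteq> S) * g S) = bexp ?V p (\<lambda>S. 0)"
      by (rule bexp_cong) auto
    also have "bexp ?V p (\<lambda>S. of_bool (insert r R \<subseteq> insert r S) * g (insert r S))
      = bexp ?V p (\<lambda>S. of_bool (R \<subseteq> S) * g (insert r S))"
      using insert.hyps by (intro bexp_cong) auto
    also have "\<dots> = (\<Prod>v\<in>R. p v) * bexp (?V - R) p (\<lambda>S. g (insert r (R \<union> S)))"
      using insert.IH[OF V(3,4), of "\<lambda>S. g (insert r S)"] by simp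
    also have "?V - R = V - insert r R" by auto
    finally show ?case using insert.hyps V(3) by (simp add: bexp_const)
  qed
qed

lemma bexp_indicator:
  assumes "finite V" "R \<subseteq> V"
  shows "bexp V p (\<lambda>S. of_bool (R \<subseteq> S)) = (\<Prod>v\<in>R. p v)"
  using bexp_indicator_times[OF assms, of p "\<lambda>_. 1"] assms by (simp add: bexp_const)

text \<open>Deleting \<open>R\<close> from the ground set forces its elements out of the random set,
  which can only raise a decreasing function.\<close>

lemma bexp_antimono_subset:
  assumes "finite V" "\<And>v. v \<in> V \<Longrightarrow> 0 \<le> p v \<and> p v \<le> 1" "antimono f"
  shows "bexp V p f \<le> bexp (V - R) p f"
proof -
  have *: "bexp V p f \<le> bexp (V - R) p f"
    if "finite R" "R \<subseteq> V" "finite V" "\<And>v. v \<in> V \<Longrightarrow> 0 \<le> p v \<and> p v \<le> 1" for R V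
    using that
  proof (induction R arbitrary: V)
    case empty
    then show ?case by simp
  next
    case (insert r R)
    let ?V = "V - {r}"
    have V: "V = insert r ?V" "r \<notin> ?V" "finite ?V" "R \<subseteq> ?V" using insert by auto
    have "bexp V p f = (1 - p r) * bexp ?V p f + p r * bexp ?V p (\<lambda>S. f (insert r S))"
      by (subst V(1), subst bexp_insert) (use V in auto)
    also have "bexp ?V p (\<lambda>S. f (insert r S)) \<le> bexp ?V p f"
      using insert.prems by (intro bexp_mono antimonoD[OF assms(3)]) auto
    then have "p r * bexp ?V p (\<lambda>S. f (insert r S)) \<le> p r * bexp ?V p f"
      using insert.prems by (intro mult_left_mono) auto
    then have "(1 - p r) * bexp ?V p f + p r * bexp ?V p (\<lambda>S. f (insert r S)) \<le> bexp ?V p f"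
      by (simp add: algebra_simps)
    also have "bexp ?V p f \<le> bexp (?V - R) p f"
      using insert V by (intro insert.IH) auto
    also have "?V - R = V - insert r R" by auto
    finally show ?case .
  qed
  have "V - R = V - (R \<inter> V)" by auto
  then show ?thesis using *[of "R \<inter> V" V] assms by auto
qed

text \<open>One element at a time: given the inequality for both states of the new element, what is
  left is Chebyshev's inequality on two points, whose surplus is a nonnegative multiple of
  \<open>(f0 - f1) * (g0 - g1)\<close>; both differences are nonnegative since the functions
  decrease.\<close>

lemma harris_inequality:
  assumes "finite V" "\<And>v. v \<in> V \<Longrightarrow> 0 \<le> p v \<and> p v \<le> 1" "antimono f" "antimono g"
  shows "bexp V p f * bexp V p g \<le> bexp V p (\<lambda>S. f S * g S)"
  using assms
proof (induction V arbitrary: f g)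
  case empty
  then show ?case by simp
next
  case (insert v V)
  let ?f = "\<lambda>S. f (insert v S)" and ?g = "\<lambda>S. g (insert v S)"
  have anti: "antimono ?f" "antimono ?g"
    using insert.prems unfolding antimono_def by (meson insert_mono)+
  define f0 f1 g0 g1 where "f0 = bexp V p f" and "f1 = bexp V p ?f"
    and "g0 = bexp V p g" and "g1 = bexp V p ?g"
  have le: "f1 \<le> f0" "g1 \<le> g0"
    unfolding f0_def f1_def g0_def g1_def
    by (intro bexp_mono antimonoD[OF insert.prems(2)] antimonoD[OF insert.prems(3)];
        use insert.prems(1) insert.hyps in auto)+
  have p: "0 \<le> p v" "p v \<le> 1" using insert.prems by auto
  have IH: "f0 * g0 \<le> bexp V p (\<lambda>S. f S * g S)" "f1 * g1 \<le> bexp V p (\<lambda>S. ?f S * ?g S)"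
    unfolding f0_def f1_def g0_def g1_def
    using insert.IH[of f g] insert.IH[OF _ anti] insert.prems by auto
  have "((1 - p v) * f0 + p v * f1) * ((1 - p v) * g0 + p v * g1)
      = (1 - p v) * (f0 * g0) + p v * (f1 * g1) - p v * (1 - p v) * ((f0 - f1) * (g0 - g1))"
    by (simp add: algebra_simps)
  also have "\<dots> \<le> (1 - p v) * (f0 * g0) + p v * (f1 * g1)"
    using p le by auto
  also have "\<dots> \<le> (1 - p v) * bexp V p (\<lambda>S. f S * g S) + p v * bexp V p (\<lambda>S. ?f S * ?g S)"
    using p IH by (intro add_mono mult_left_mono) auto
  finally show ?case
    using insert.hyps by (simp add: bexp_insert f0_def f1_def g0_def g1_def)
qed

section \<open>Probabilities of events and the first moment method\<close>

definition bprob :: "'a set \<Rightarrow> ('a \<Rightarrow> real) \<Rightarrow> ('a set \<Rightarrow> bool) \<Rightarrow> real" where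
  "bprob V p E = bexp V p (\<lambda>S. of_bool (E S))"

lemma bprob_mono:
  assumes "finite V" "\<And>v. v \<in> V \<Longrightarrow> 0 \<le> p v \<and> p v \<le> 1"
    and "\<And>S. S \<subseteq> V \<Longrightarrow> E S \<Longrightarrow> E' S"
  shows "bprob V p E \<le> bprob V p E'"
  unfolding bprob_def using assms by (intro bexp_mono) auto

lemma bprob_union_bound:
  assumes "finite V" "\<And>v. v \<in> V \<Longrightarrow> 0 \<le> p v \<and> p v \<le> 1" "finite X"
  shows "bprob V p (\<lambda>S. \<exists>x\<in>X. E x S) \<le> (\<Sum>x\<in>X. bprob V p (E x))"
  unfolding bprob_def bexp_sum[symmetric]
proof (rule bexp_mono)
  fix S
  show "of_bool (\<exists>x\<in>X. E x S) \<le> (\<Sum>x\<in>X. of_bool (E x S) :: real)"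
  proof (cases "\<exists>x\<in>X. E x S")
    case True
    then obtain x where x: "x \<in> X" "E x S" by auto
    have "of_bool (E x S) \<le> (\<Sum>x\<in>X. of_bool (E x S) :: real)"
      using x assms(3) by (intro member_le_sum) auto
    then show ?thesis using x True by simp
  qed (auto intro: sum_nonneg)
qed (use assms in auto)

lemma bprob_union_bound_uniform:
  assumes V: "finite V" "\<And>v. v \<in> V \<Longrightarrow> 0 \<le> p v \<and> p v \<le> 1" and X: "finite X"
    and e: "\<And>x. x \<in> X \<Longrightarrow> bprob V p (E x) \<le> e" "0 \<le> e" and r: "real (card X) \<le> r"
  shows "bprob V p (\<lambda>S. \<exists>x\<in>X. E x S) \<le> r * e"
proof -
  have "bprob V p (\<lambda>S. \<exists>x\<in>X. E x S) \<le> (\<Sum>x\<in>X. bprob V p (E x))"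
    by (rule bprob_union_bound[OF V X])
  also have "\<dots> \<le> (\<Sum>x\<in>X. e)" by (intro sum_mono e)
  also have "\<dots> \<le> r * e" using r e(2) by (simp add: mult_right_mono)
  finally show ?thesis .
qed

lemma bprob_markov:
  assumes "finite V" "\<And>v. v \<in> V \<Longrightarrow> 0 \<le> p v \<and> p v \<le> 1" "a > 0"
    and "\<And>S. S \<subseteq> V \<Longrightarrow> 0 \<le> f S" "\<And>S. S \<subseteq> V \<Longrightarrow> E S \<Longrightarrow> a \<le> f S"
  shows "bprob V p E \<le> bexp V p f / a"
proof -
  have "bprob V p E \<le> bexp V p (\<lambda>S. (1 / a) * f S)"
    unfolding bprob_def
    using assms by (intro bexp_mono) (auto simp: field_simps of_bool_def)
  then show ?thesis unfolding bexp_cmult by simp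
qed

lemma bprob_less_one_imp_ex:
  assumes "finite V" "bprob V p E < 1"
  shows "\<exists>S\<subseteq>V. \<not> E S"
proof (rule ccontr)
  assume "\<not> ?thesis"
  then have "bprob V p E = bexp V p (\<lambda>_. 1)"
    unfolding bprob_def by (intro bexp_cong) auto
  then show False using assms by (simp add: bexp_const)
qed

section \<open>Tail bounds for counts of contained sets\<close>

definition hits :: "'k set \<Rightarrow> ('k \<Rightarrow> 'a set) \<Rightarrow> 'a set \<Rightarrow> 'k set" where
  "hits K R S = {k\<in>K. R k \<subseteq> S}"

lemma finite_hits [simp]: "finite K \<Longrightarrow> finite (hits K R S)"
  by (simp add: hits_def)

lemma card_hits: "finite K \<Longrightarrow> real (card (hits K R S)) = (\<Sum>k\<in>K. of_bool (R k \<subseteq> S))"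
  unfolding hits_def by (subst sum_of_bool_eq) (auto simp: Int_def)

text \<open>A differential inequality for the Laplace transform \<open>\<psi>\<close> of the count.
  Conditioning on one \<open>R k\<close>, the Harris inequality and \<open>exp x \<ge> 1 + x\<close>
  give \<open>(\<mu> - s * \<Delta>) * \<psi> s \<le> \<psi>' s\<close>, where
  \<open>- \<psi>'\<close> is the derivative of \<open>\<psi>\<close>; this is integrated and
  followed by Markov's inequality. The sum bounded by \<open>\<Delta>\<close> includes the diagonal
  pairs \<open>k = l\<close> with \<open>R k\<close> nonempty.\<close>

lemma janson_inequality:
  fixes p :: "'a \<Rightarrow> real"
  assumes V: "finite V" "\<And>v. v \<in> V \<Longrightarrow> 0 \<le> p v \<and> p v \<le> 1"
    and K: "finite K" "\<And>k. k \<in> K \<Longrightarrow> R k \<subseteq> V"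
    and \<mu>: "\<mu> = (\<Sum>k\<in>K. \<Prod>v\<in>R k. p v)"
    and \<Delta>: "(\<Sum>k\<in>K. \<Sum>l\<in>{l\<in>K. R k \<inter> R l \<noteq> {}}. \<Prod>v\<in>R k \<union> R l. p v) \<le> \<Delta>" "\<Delta> > 0"
  shows "bprob V p (\<lambda>S. real (card (hits K R S)) \<le> \<mu> / 2) \<le> exp (- (\<mu>\<^sup>2 / (8 * \<Delta>)))"
proof -
  define X where "X S = real (card (hits K R S))" for S
  have X: "X S = (\<Sum>k\<in>K. of_bool (R k \<subseteq> S))" for S
    using K by (simp add: X_def card_hits)
  define \<psi> where "\<psi> s = bexp V p (\<lambda>S. exp (- s * X S))" for s
  define \<psi>' where "\<psi>' s = bexp V p (\<lambda>S. X S * exp (- s * X S))" for s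
  have \<mu>0: "0 \<le> \<mu>"
    unfolding \<mu> using K V by (intro sum_nonneg prod_nonneg) auto
  have pos: "\<psi> s > 0" for s
  proof -
    have X_le: "X S \<le> card K" for S
      unfolding X_def hits_def using K by (auto intro!: card_mono)
    have X_ge: "0 \<le> X S" for S by (simp add: X_def)
    have "bexp V p (\<lambda>S. exp (- \<bar>s\<bar> * card K)) \<le> \<psi> s"
      unfolding \<psi>_def
    proof (intro bexp_mono V)
      fix S
      have "s * X S \<le> \<bar>s\<bar> * card K"
        using X_le[of S] X_ge[of S] by (intro mult_mono) auto
      then show "exp (- \<bar>s\<bar> * card K) \<le> exp (- s * X S)" by simp
    qed
    then show ?thesis using V by (simp add: bexp_const less_le_trans[OF exp_gt_zero])
  qed
  have deriv: "(\<psi> has_real_derivative - \<psi>' s) (at s)" for s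
    unfolding \<psi>_def \<psi>'_def bexp_def sum_negf[symmetric]
    by (rule derivative_eq_intros refl | simp add: mult_ac)+
  have anti: "antimono (\<lambda>S. exp (- s * (\<Sum>k\<in>L. of_bool (R k \<subseteq> S \<union> Q))))" if "s \<ge> 0" for s :: real
      and L Q
  proof (rule antimonoI)
    fix S T :: "'a set" assume "S \<subseteq> T"
    then have "(\<Sum>k\<in>L. of_bool (R k \<subseteq> S \<union> Q)) \<le> (\<Sum>k\<in>L. of_bool (R k \<subseteq> T \<union> Q) :: real)"
      by (intro sum_mono) auto
    then show "exp (- s * (\<Sum>k\<in>L. of_bool (R k \<subseteq> T \<union> Q))) \<le> exp (- s * (\<Sum>k\<in>L. of_bool (R k \<subseteq> S \<union>
        Q)))"
      using that by (simp add: mult_left_mono)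
  qed
  have main: "(\<mu> - s * \<Delta>) * \<psi> s \<le> \<psi>' s" if s: "s \<ge> 0" for s
  proof -
    define Y where "Y k S = (\<Sum>l\<in>{l\<in>K. R k \<inter> R l \<noteq> {}}. of_bool (R l \<subseteq> S \<union> R k) :: real)" for k S
    define E where "E k = (\<Sum>l\<in>{l\<in>K. R k \<inter> R l \<noteq> {}}. \<Prod>v\<in>R k \<union> R l. p v)" for k
    have step: "((\<Prod>v\<in>R k. p v) - s * E k) * \<psi> s
        \<le> bexp V p (\<lambda>S. of_bool (R k \<subseteq> S) * exp (- s * X S))" if k: "k \<in> K" for k
    proof -
      let ?P = "\<Prod>v\<in>R k. p v" and ?V = "V - R k"
      have P: "?P \<ge> 0" using K V k by (intro prod_nonneg) auto
      have V': "finite ?V" "\<And>v. v \<in> ?V \<Longrightarrow> 0 \<le> p v \<and> p v \<le> 1" using V by auto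
      \<comment> \<open>A set that meets \<open>R k\<close> cannot lie inside
        \<open>S \<subseteq> V - R k\<close>, so such sets contribute nothing to
        \<open>X S\<close>.\<close>
      have split: "X (R k \<union> S) = Y k S + X S" if S: "S \<subseteq> ?V" for S
      proof -
        define M D where "M = {l\<in>K. R k \<inter> R l \<noteq> {}}" and "D = {l\<in>K. R k \<inter> R l = {}}"
        have MD: "K = M \<union> D" "M \<inter> D = {}" "finite M" "finite D"
          using K(1) by (auto simp: M_def D_def)
        have sumK: "sum f K = sum f M + sum f D" for f :: "_ \<Rightarrow> real"
          unfolding MD(1) using MD by (intro sum.union_disjoint) auto
        have "X (R k \<union> S) = (\<Sum>l\<in>M. of_bool (R l \<subseteq> R k \<union> S)) + (\<Sum>l\<in>D. of_bool (R l \<subseteq> R k \<union> S))"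
          unfolding X by (rule sumK)
        also have "(\<Sum>l\<in>D. of_bool (R l \<subseteq> R k \<union> S)) = (\<Sum>l\<in>D. of_bool (R l \<subseteq> S) :: real)"
          unfolding D_def by (intro sum.cong refl arg_cong[where f = of_bool]) auto
        also have "\<dots> = X S"
        proof -
          have "(\<Sum>l\<in>M. of_bool (R l \<subseteq> S) :: real) = 0"
            using S unfolding M_def by (intro sum.neutral) auto
          then show ?thesis unfolding X by (simp only: sumK)
        qed
        finally show ?thesis unfolding Y_def M_def by (simp only: Un_commute)
      qed
      have antiX: "antimono (\<lambda>S. exp (- s * X S))"
        using anti[OF s, where L = K and Q = "{}"] unfolding X by (simp only: Un_empty_right)
      have antiY: "antimono (\<lambda>S. exp (- s * Y k S))"
        unfolding Y_def by (rule anti[OF s])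
      have EY: "?P * bexp ?V p (Y k) = E k"
      proof -
        have "?P * bexp ?V p (Y k) = bexp V p (\<lambda>S. of_bool (R k \<subseteq> S) * Y k (S - R k))"
        proof (subst bexp_indicator_times)
          have "bexp ?V p (Y k) = bexp ?V p (\<lambda>S. Y k (R k \<union> S - R k))"
            by (intro bexp_cong arg_cong[where f = "Y k"]) auto
          then show "?P * bexp ?V p (Y k) = ?P * bexp ?V p (\<lambda>S. Y k (R k \<union> S - R k))" by simp
        qed (use K k V in auto)
        also have "\<dots> = bexp V p (\<lambda>S. \<Sum>l\<in>{l\<in>K. R k \<inter> R l \<noteq> {}}. of_bool (R k \<union> R l \<subseteq> S))"
        proof (rule bexp_cong)
          fix S
          show "of_bool (R k \<subseteq> S) * Y k (S - R k)
             = (\<Sum>l\<in>{l\<in>K. R k \<inter> R l \<noteq> {}}. of_bool (R k \<union> R l \<subseteq> S))"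
          proof (cases "R k \<subseteq> S")
            case True
            then have "S - R k \<union> R k = S" by auto
            then show ?thesis using True by (simp add: Y_def)
          qed auto
        qed
        also have "\<dots> = E k"
          unfolding bexp_sum E_def using K k V by (intro sum.cong bexp_indicator refl) auto
        finally show ?thesis .
      qed
      have e: "bexp V p (\<lambda>S. of_bool (R k \<subseteq> S) * exp (- s * X S))
          = ?P * bexp ?V p (\<lambda>S. exp (- s * Y k S) * exp (- s * X S))"
      proof (subst bexp_indicator_times)
        have "bexp ?V p (\<lambda>S. exp (- s * X (R k \<union> S))) = bexp ?V p (\<lambda>S. exp (- s * Y k S) * exp (- s
            * X S))"
          by (intro bexp_cong) (simp only: split mult_exp_exp distrib_left)
        then show "?P * bexp ?V p (\<lambda>S. exp (- s * X (R k \<union> S)))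
          = ?P * bexp ?V p (\<lambda>S. exp (- s * Y k S) * exp (- s * X S))" by simp
      qed (use K k V in auto)
      have h: "bexp ?V p (\<lambda>S. exp (- s * Y k S)) * bexp ?V p (\<lambda>S. exp (- s * X S))
          \<le> bexp ?V p (\<lambda>S. exp (- s * Y k S) * exp (- s * X S))"
        by (intro harris_inequality V' antiX antiY)
      have "1 - s * bexp ?V p (Y k) = bexp ?V p (\<lambda>S. 1 - s * Y k S)"
        using V' by (simp add: bexp_diff bexp_cmult bexp_const)
      also have "\<dots> \<le> bexp ?V p (\<lambda>S. exp (- s * Y k S))"
      proof (intro bexp_mono V')
        fix S show "1 - s * Y k S \<le> exp (- s * Y k S)"
          using exp_ge_add_one_self[of "- s * Y k S"] by simp
      qed
      finally have lin: "1 - s * bexp ?V p (Y k) \<le> bexp ?V p (\<lambda>S. exp (- s * Y k S))" .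
      have "(?P - s * E k) * \<psi> s = ?P * ((1 - s * bexp ?V p (Y k)) * \<psi> s)"
        by (simp add: EY[symmetric] algebra_simps)
      also have "\<dots> \<le> ?P * (bexp ?V p (\<lambda>S. exp (- s * Y k S)) * \<psi> s)"
        using lin pos[of s] P by (intro mult_left_mono mult_right_mono) auto
      also have "\<dots> \<le> ?P * (bexp ?V p (\<lambda>S. exp (- s * Y k S)) * bexp ?V p (\<lambda>S. exp (- s * X S)))"
        unfolding \<psi>_def using V V' antiX P
        by (intro mult_left_mono bexp_antimono_subset bexp_nonneg) auto
      also have "\<dots> \<le> ?P * bexp ?V p (\<lambda>S. exp (- s * Y k S) * exp (- s * X S))"
        using h P by (intro mult_left_mono) auto
      finally show ?thesis unfolding e .
    qed
    have "\<Delta> \<ge> (\<Sum>k\<in>K. E k)" using \<Delta>(1) by (simp add: E_def)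
    then have "(\<mu> - s * \<Delta>) * \<psi> s \<le> (\<mu> - s * (\<Sum>k\<in>K. E k)) * \<psi> s"
      using s pos[of s] by (intro mult_right_mono) (auto simp: mult_left_mono)
    also have "\<dots> = (\<Sum>k\<in>K. ((\<Prod>v\<in>R k. p v) - s * E k) * \<psi> s)"
      unfolding \<mu> sum_distrib_left sum_subtractf[symmetric] by (rule sum_distrib_right)
    also have "\<dots> \<le> (\<Sum>k\<in>K. bexp V p (\<lambda>S. of_bool (R k \<subseteq> S) * exp (- s * X S)))"
      by (intro sum_mono step)
    also have "\<dots> = \<psi>' s"
      unfolding \<psi>'_def bexp_sum[symmetric] by (simp add: X sum_distrib_right)
    finally show ?thesis .
  qed
  \<comment> \<open>Minimises \<open>\<Delta> * s\<^sup>2 / 2 - \<mu> * s / 2\<close>, the exponent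
    that remains after Markov's inequality at level \<open>\<mu> / 2\<close>.\<close>
  define s where "s = \<mu> / (2 * \<Delta>)"
  have s0: "s \<ge> 0" using \<mu>0 \<Delta> by (simp add: s_def)
  \<comment> \<open>That \<open>G\<close> decreases on \<open>[0, s]\<close> is the integrated form
    of \<open>main\<close>.\<close>
  define G where "G u = ln (\<psi> u) + \<mu> * u - \<Delta> * u\<^sup>2 / 2" for u
  have "G s \<le> G 0"
  proof (rule DERIV_nonpos_imp_nonincreasing[OF s0])
    fix u :: real assume u: "0 \<le> u" "u \<le> s"
    have "(G has_real_derivative (- \<psi>' u / \<psi> u + \<mu> - \<Delta> * u)) (at u)"
      unfolding G_def
      by (rule derivative_eq_intros deriv refl | simp add: pos)+
    moreover have "- \<psi>' u / \<psi> u + \<mu> - \<Delta> * u \<le> 0"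
      using main[OF u(1)] pos[of u] by (simp add: field_simps)
    ultimately show "\<exists>y. (G has_real_derivative y) (at u) \<and> y \<le> 0" by blast
  qed
  moreover have "G 0 = 0" using V by (simp add: G_def \<psi>_def bexp_const)
  ultimately have "ln (\<psi> s) \<le> \<Delta> * s\<^sup>2 / 2 - \<mu> * s" by (simp add: G_def)
  then have \<psi>s: "\<psi> s \<le> exp (\<Delta> * s\<^sup>2 / 2 - \<mu> * s)"
    using pos[of s] by (metis exp_le_cancel_iff exp_ln)
  have "bprob V p (\<lambda>S. X S \<le> \<mu> / 2) \<le> \<psi> s / exp (- s * (\<mu> / 2))"
    unfolding \<psi>_def
  proof (rule bprob_markov[OF V])
    fix S assume "X S \<le> \<mu> / 2"
    then show "exp (- s * (\<mu> / 2)) \<le> exp (- s * X S)"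
      using mult_left_mono[OF \<open>X S \<le> \<mu> / 2\<close> s0] by simp
  qed auto
  also have "\<dots> \<le> exp (\<Delta> * s\<^sup>2 / 2 - \<mu> * s) / exp (- s * (\<mu> / 2))"
    using \<psi>s by (intro divide_right_mono) auto
  also have "\<dots> = exp (\<Delta> * s\<^sup>2 / 2 - \<mu> * s + s * (\<mu> / 2))"
    by (simp add: exp_diff[symmetric])
  also have "\<Delta> * s\<^sup>2 / 2 - \<mu> * s + s * (\<mu> / 2) = - (\<mu>\<^sup>2 / (8 * \<Delta>))"
    using \<Delta>(2) by (simp add: s_def field_simps power2_eq_square)
  finally show ?thesis by (simp add: X_def)
qed

text \<open>Expand one factor of the power: the new set \<open>R k\<close> costs only the factor \<open>\<Prod>v\<in>R k - U. p v\<close> once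
  \<open>U\<close> is known to lie in \<open>S\<close>, and \<open>U\<close> grows by at most \<open>h\<close> elements per step.\<close>

lemma moment_bound:
  fixes p :: "'a \<Rightarrow> real"
  assumes V: "finite V" "\<And>v. v \<in> V \<Longrightarrow> 0 \<le> p v \<and> p v \<le> 1"
    and K: "finite K" "\<And>k. k \<in> K \<Longrightarrow> R k \<subseteq> V" "\<And>k. k \<in> K \<Longrightarrow> card (R k) \<le> h"
    and \<Lambda>: "\<And>U. U \<subseteq> V \<Longrightarrow> card U \<le> N \<Longrightarrow> (\<Sum>k\<in>K. \<Prod>v\<in>R k - U. p v) \<le> \<Lambda>" "0 \<le> \<Lambda>"
    and U: "U \<subseteq> V" "card U + h * q \<le> N"
  shows "bexp V p (\<lambda>S. of_bool (U \<subseteq> S) * real (card (hits K R S)) ^ q) \<le> \<Lambda> ^ q * (\<Prod>v\<in>U. p v)"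
  using U
proof (induction q arbitrary: U)
  case 0
  then show ?case using V by (simp add: bexp_indicator)
next
  case (Suc q)
  have U0: "0 \<le> (\<Prod>v\<in>U. p v)" using Suc.prems V by (intro prod_nonneg) auto
  have "bexp V p (\<lambda>S. of_bool (U \<subseteq> S) * real (card (hits K R S)) ^ Suc q)
      = bexp V p (\<lambda>S. \<Sum>k\<in>K. of_bool (U \<union> R k \<subseteq> S) * real (card (hits K R S)) ^ q)"
  proof (rule bexp_cong)
    fix S
    have "of_bool (U \<subseteq> S) * real (card (hits K R S)) ^ Suc q
      = (\<Sum>k\<in>K. of_bool (U \<subseteq> S) * of_bool (R k \<subseteq> S)) * real (card (hits K R S)) ^ q"
      using K by (simp add: card_hits[of K R S] sum_distrib_left)
    also have "\<dots> = (\<Sum>k\<in>K. of_bool (U \<union> R k \<subseteq> S) * real (card (hits K R S)) ^ q)"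
      unfolding sum_distrib_right by (intro sum.cong) auto
    finally show "of_bool (U \<subseteq> S) * real (card (hits K R S)) ^ Suc q
      = (\<Sum>k\<in>K. of_bool (U \<union> R k \<subseteq> S) * real (card (hits K R S)) ^ q)" .
  qed
  also have "\<dots> = (\<Sum>k\<in>K. bexp V p (\<lambda>S. of_bool (U \<union> R k \<subseteq> S) * real (card (hits K R S)) ^ q))"
    by (rule bexp_sum)
  also have "\<dots> \<le> (\<Sum>k\<in>K. \<Lambda> ^ q * (\<Prod>v\<in>U \<union> R k. p v))"
  proof (intro sum_mono Suc.IH)
    fix k assume k: "k \<in> K"
    show "U \<union> R k \<subseteq> V" using Suc.prems K k by auto
    have "card (U \<union> R k) \<le> card U + h"
      using card_Un_le[of U "R k"] K(3)[OF k] by linarith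
    then show "card (U \<union> R k) + h * q \<le> N" using Suc.prems by simp
  qed
  also have "\<dots> = \<Lambda> ^ q * (\<Prod>v\<in>U. p v) * (\<Sum>k\<in>K. \<Prod>v\<in>R k - U. p v)"
    unfolding sum_distrib_left
  proof (intro sum.cong refl)
    fix k assume k: "k \<in> K"
    have fin: "finite U" "finite (R k)" using Suc.prems K(2)[OF k] V finite_subset by blast+
    have "(\<Prod>v\<in>U \<union> R k. p v) = (\<Prod>v\<in>U \<union> (R k - U). p v)" by (intro prod.cong) auto
    also have "\<dots> = (\<Prod>v\<in>U. p v) * (\<Prod>v\<in>R k - U. p v)"
      using fin by (intro prod.union_disjoint) auto
    finally show "\<Lambda> ^ q * (\<Prod>v\<in>U \<union> R k. p v) = \<Lambda> ^ q * (\<Prod>v\<in>U. p v) * (\<Prod>v\<in>R k - U. p v)"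
      by simp
  qed
  also have "\<dots> \<le> \<Lambda> ^ q * (\<Prod>v\<in>U. p v) * \<Lambda>"
    using Suc.prems \<Lambda> U0 by (intro mult_left_mono \<Lambda>) auto
  finally show ?case by (simp add: mult_ac)
qed

text \<open>Markov's inequality for the \<open>q\<close>-th power. Starting from no exposed
  elements, the \<open>q\<close> expansions expose at most \<open>h * q\<close> of them, hence the
  range of \<open>U\<close>.\<close>

lemma moment_upper_tail:
  fixes p :: "'a \<Rightarrow> real"
  assumes V: "finite V" "\<And>v. v \<in> V \<Longrightarrow> 0 \<le> p v \<and> p v \<le> 1"
    and K: "finite K" "\<And>k. k \<in> K \<Longrightarrow> R k \<subseteq> V" "\<And>k. k \<in> K \<Longrightarrow> card (R k) \<le> h"
    and \<Lambda>: "\<And>U. U \<subseteq> V \<Longrightarrow> card U \<le> h * q \<Longrightarrow> (\<Sum>k\<in>K. \<Prod>v\<in>R k - U. p v) \<le> \<Lambda>" "0 < \<Lambda>"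
  shows "bprob V p (\<lambda>S. real (card (hits K R S)) \<ge> exp 1 * \<Lambda>) \<le> exp (- real q)"
proof -
  have "bexp V p (\<lambda>S. of_bool ({} \<subseteq> S) * real (card (hits K R S)) ^ q) \<le> \<Lambda> ^ q * (\<Prod>v\<in>{}. p v)"
    by (rule moment_bound[OF V K \<Lambda>(1)]) (use \<Lambda>(2) in auto)
  then have mom: "bexp V p (\<lambda>S. real (card (hits K R S)) ^ q) \<le> \<Lambda> ^ q" by simp
  have "bprob V p (\<lambda>S. real (card (hits K R S)) \<ge> exp 1 * \<Lambda>)
      \<le> bexp V p (\<lambda>S. real (card (hits K R S)) ^ q) / (exp 1 * \<Lambda>) ^ q"
    by (rule bprob_markov[OF V]) (use \<Lambda>(2) in \<open>auto intro!: power_mono\<close>)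
  also have "\<dots> \<le> \<Lambda> ^ q / (exp 1 * \<Lambda>) ^ q"
    using mom \<Lambda>(2) by (intro divide_right_mono) auto
  also have "\<dots> = exp (- real q)"
    using \<Lambda>(2) by (simp add: power_mult_distrib exp_minus exp_of_nat_mult[symmetric]
        inverse_eq_divide)
  finally show ?thesis .
qed

section \<open>Disjoint families of hits\<close>

definition disj_hits :: "'k set \<Rightarrow> ('k \<Rightarrow> 'a set) \<Rightarrow> 'a set \<Rightarrow> 'k set \<Rightarrow> bool" where
  "disj_hits K R S L \<longleftrightarrow> L \<subseteq> hits K R S \<and> (\<forall>k\<in>L. \<forall>l\<in>L. k \<noteq> l \<longrightarrow> R k \<inter> R l = {})"

lemma disj_hits_subset:
  assumes "disj_hits K R S L" "L' \<subseteq> L"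
  shows "disj_hits K R S L'"
  using assms unfolding disj_hits_def by (meson order_trans subsetD)

text \<open>A disjoint family of \<open>d\<close> hits contributes \<open>(1 + t) ^ d\<close> to the sum of \<open>t ^ card L\<close> over all disjoint
  families \<open>L\<close> of hits, and the expectation of this sum is at most \<open>\<Prod>k\<in>K. 1 + t * (\<Prod>v\<in>R k. p v)\<close>.\<close>

lemma disjoint_upper_tail:
  fixes p :: "'a \<Rightarrow> real"
  assumes V: "finite V" "\<And>v. v \<in> V \<Longrightarrow> 0 \<le> p v \<and> p v \<le> 1"
    and K: "finite K" "\<And>k. k \<in> K \<Longrightarrow> R k \<subseteq> V"
    and \<Lambda>: "(\<Sum>k\<in>K. \<Prod>v\<in>R k. p v) \<le> \<Lambda>" and t: "t \<ge> 0"
  shows "bprob V p (\<lambda>S. \<exists>L. disj_hits K R S L \<and> card L = d) \<le> exp (t * \<Lambda>) / (1 + t) ^ d"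
proof -
  define \<D> where "\<D> = {L. L \<subseteq> K \<and> (\<forall>k\<in>L. \<forall>l\<in>L. k \<noteq> l \<longrightarrow> R k \<inter> R l = {})}"
  have fin: "finite \<D>" unfolding \<D>_def using K(1) by (auto intro: finite_subset[of _ "Pow K"])
  have "bprob V p (\<lambda>S. \<exists>L. disj_hits K R S L \<and> card L = d)
      \<le> bexp V p (\<lambda>S. \<Sum>L\<in>\<D>. t ^ card L * of_bool ((\<Union>k\<in>L. R k) \<subseteq> S)) / (1 + t) ^ d"
  proof (rule bprob_markov[OF V])
    fix S assume "\<exists>L. disj_hits K R S L \<and> card L = d"
    then obtain L where L: "disj_hits K R S L" "card L = d" by auto
    have LK: "L \<subseteq> K" using L(1) by (auto simp: disj_hits_def hits_def)
    then have finL: "finite L" using K(1) finite_subset by auto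
    have "(1 + t) ^ d = (\<Prod>k\<in>L. t + 1)" using L(2) by (simp add: add.commute)
    also have "\<dots> = (\<Sum>L'\<in>Pow L. t ^ card L')" using finL by (subst prod_add) auto
    also have "\<dots> = (\<Sum>L'\<in>Pow L. t ^ card L' * of_bool ((\<Union>k\<in>L'. R k) \<subseteq> S))"
      using L(1) by (intro sum.cong) (auto simp: disj_hits_def hits_def)
    also have "\<dots> \<le> (\<Sum>L\<in>\<D>. t ^ card L * of_bool ((\<Union>k\<in>L. R k) \<subseteq> S))"
    proof (intro sum_mono2 fin subsetI)
      fix L' assume "L' \<in> Pow L"
      then show "L' \<in> \<D>"
        using disj_hits_subset[OF L(1), of L'] LK by (auto simp: disj_hits_def \<D>_def)
    qed (use t in auto)
    finally show "(1 + t) ^ d \<le> \<dots>" .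
  qed (use t in \<open>auto intro!: sum_nonneg\<close>)
  also have "bexp V p (\<lambda>S. \<Sum>L\<in>\<D>. t ^ card L * of_bool ((\<Union>k\<in>L. R k) \<subseteq> S))
      = (\<Sum>L\<in>\<D>. t ^ card L * (\<Prod>v\<in>(\<Union>k\<in>L. R k). p v))"
    unfolding bexp_sum bexp_cmult using K(2) V(1)
    by (intro sum.cong refl arg_cong2[where f = "(*)"] bexp_indicator) (auto simp: \<D>_def)
  also have "\<dots> = (\<Sum>L\<in>\<D>. \<Prod>k\<in>L. t * (\<Prod>v\<in>R k. p v))"
  proof (intro sum.cong refl)
    fix L assume L: "L \<in> \<D>"
    have "finite L" using L K(1) finite_subset by (auto simp: \<D>_def)
    moreover have "\<forall>k\<in>L. finite (R k)"
      using L by (auto simp: \<D>_def intro!: finite_subset[OF K(2) V(1)])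
    ultimately have "(\<Prod>v\<in>(\<Union>k\<in>L. R k). p v) = (\<Prod>k\<in>L. \<Prod>v\<in>R k. p v)"
      using L by (intro prod.UNION_disjoint) (auto simp: \<D>_def)
    then show "t ^ card L * (\<Prod>v\<in>(\<Union>k\<in>L. R k). p v) = (\<Prod>k\<in>L. t * (\<Prod>v\<in>R k. p v))"
      by (simp add: prod.distrib)
  qed
  also have "\<dots> \<le> (\<Sum>L\<in>Pow K. \<Prod>k\<in>L. t * (\<Prod>v\<in>R k. p v))"
    using K V t by (intro sum_mono2) (auto simp: \<D>_def intro!: prod_nonneg mult_nonneg_nonneg)
  also have "\<dots> = (\<Prod>k\<in>K. t * (\<Prod>v\<in>R k. p v) + 1)"
    using K(1) by (subst prod_add) auto
  also have "\<dots> \<le> (\<Prod>k\<in>K. exp (t * (\<Prod>v\<in>R k. p v)))"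
  proof (intro prod_mono conjI)
    fix k assume k: "k \<in> K"
    have "0 \<le> (\<Prod>v\<in>R k. p v)" using K(2)[OF k] V by (intro prod_nonneg) auto
    then show "0 \<le> t * (\<Prod>v\<in>R k. p v) + 1" using t by simp
    show "t * (\<Prod>v\<in>R k. p v) + 1 \<le> exp (t * (\<Prod>v\<in>R k. p v))"
      using exp_ge_add_one_self[of "t * (\<Prod>v\<in>R k. p v)"] by linarith
  qed
  also have "\<dots> = exp (t * (\<Sum>k\<in>K. \<Prod>v\<in>R k. p v))"
    using K(1) by (simp add: exp_sum sum_distrib_left)
  also have "\<dots> \<le> exp (t * \<Lambda>)" using \<Lambda> t by (simp add: mult_left_mono)
  finally show ?thesis using t by (simp add: divide_right_mono)
qed

text \<open>The union of a largest disjoint family works: a hit that avoids it could be added to the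
  family. Forbidding the exact size \<open>d\<close> excludes all larger sizes, because subfamilies
  of disjoint families are disjoint.\<close>

lemma disj_hits_cover:
  assumes K: "finite K" "\<And>k. k \<in> K \<Longrightarrow> finite (R k) \<and> card (R k) \<le> h \<and> R k \<noteq> {}"
    and no: "\<nexists>L. disj_hits K R S L \<and> card L = d"
  shows "\<exists>W. finite W \<and> card W \<le> d * h \<and> (\<forall>k\<in>hits K R S. R k \<inter> W \<noteq> {})"
proof -
  have bd: "card L < d" if L: "disj_hits K R S L" for L
  proof (rule ccontr)
    assume "\<not> card L < d"
    then obtain L' where "L' \<subseteq> L" "card L' = d"
      by (meson not_less obtain_subset_with_card_n)
    then have "disj_hits K R S L'" using L disj_hits_subset by blast
    then show False using no \<open>card L' = d\<close> by auto
  qed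
  have "\<exists>L. disj_hits K R S L \<and> (\<forall>L'. disj_hits K R S L' \<longrightarrow> card L' \<le> card L)"
  proof (rule ex_has_greatest_nat[rule_format])
    show "disj_hits K R S {}" by (simp add: disj_hits_def)
    show "card L < d" if "disj_hits K R S L" for L by (rule bd[OF that])
  qed
  then obtain L where L: "disj_hits K R S L" "\<And>L'. disj_hits K R S L' \<Longrightarrow> card L' \<le> card L"
    by auto
  have LK: "L \<subseteq> K" using L(1) by (auto simp: disj_hits_def hits_def)
  then have finL: "finite L" using K finite_subset by auto
  let ?W = "\<Union>k\<in>L. R k"
  have "card ?W \<le> (\<Sum>k\<in>L. card (R k))" by (rule card_UN_le[OF finL])
  also have "\<dots> \<le> (\<Sum>k\<in>L. h)" using K LK by (intro sum_mono) auto
  also have "\<dots> \<le> d * h" using bd[OF L(1)] by simp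
  finally have "card ?W \<le> d * h" .
  moreover have "finite ?W" using finL K LK by auto
  moreover have "R k \<inter> ?W \<noteq> {}" if k: "k \<in> hits K R S" for k
  proof
    assume emp: "R k \<inter> ?W = {}"
    have kK: "k \<in> K" using k by (auto simp: hits_def)
    then have "k \<notin> L" using emp K(2)[of k] by auto
    moreover have "disj_hits K R S (insert k L)"
      unfolding disj_hits_def
    proof (intro conjI ballI impI)
      show "insert k L \<subseteq> hits K R S" using L(1) k by (simp add: disj_hits_def)
    next
      fix x y assume "x \<in> insert k L" "y \<in> insert k L" "x \<noteq> y"
      then consider "x \<in> L" "y \<in> L" | "x = k" "y \<in> L" | "x \<in> L" "y = k" by blast
      then show "R x \<inter> R y = {}"
      proof cases
        case 1
        then show ?thesis using L(1) \<open>x \<noteq> y\<close> by (simp add: disj_hits_def)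
      qed (use emp in blast)+
    qed
    ultimately show False using L(2)[of "insert k L"] finL by simp
  qed
  ultimately show ?thesis by blast
qed

section \<open>Weighted counts of solutions of linear equations\<close>

text \<open>The index set is arbitrary and the functions are extensional, so that dropping unknowns
  or merging two of them gives a set of the same form.\<close>

definition sol :: "'i set \<Rightarrow> ('i \<Rightarrow> nat) \<Rightarrow> nat set \<Rightarrow> nat \<Rightarrow> ('i \<Rightarrow> nat) set" where
  "sol I c V m = {k \<in> I \<rightarrow>\<^sub>E V. (\<Sum>i\<in>I. c i * k i) = m}"

lemma finite_sol [simp]: "finite I \<Longrightarrow> finite V \<Longrightarrow> finite (sol I c V m)"
  unfolding sol_def by (rule finite_subset[of _ "I \<rightarrow>\<^sub>E V"]) (auto intro: finite_PiE)

lemma sol_image: "k \<in> sol I c V m \<Longrightarrow> k ` I \<subseteq> V"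
  by (auto simp: sol_def PiE_def)

lemma sol_empty: "sol {} c V m = (if m = 0 then {\<lambda>_. undefined} else {})"
  by (auto simp: sol_def)

lemma sol_le:
  assumes "k \<in> sol I c V m" "finite I" "i \<in> I" "c i \<ge> 1"
  shows "k i \<le> m"
proof -
  have "k i \<le> c i * k i" using assms by simp
  also have "\<dots> \<le> (\<Sum>i\<in>I. c i * k i)" using assms by (intro member_le_sum) auto
  finally show ?thesis using assms by (simp add: sol_def)
qed

lemma sol_zero:
  assumes "finite I" "I \<noteq> {}" "\<And>i. i \<in> I \<Longrightarrow> c i \<ge> 1" "0 \<notin> V"
  shows "sol I c V 0 = {}"
proof -
  obtain i where i: "i \<in> I" using assms by auto
  have False if k: "k \<in> sol I c V 0" for k
  proof -
    have "k i = 0" using sol_le[OF k assms(1) i assms(3)[OF i]] by simp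
    then show False using sol_image[OF k] i assms(4) by (metis image_subset_iff)
  qed
  then show ?thesis by auto
qed

lemma sol_restrict:
  assumes "k \<in> sol I c V m" "J \<subseteq> I" "finite I"
  shows "restrict k J \<in> sol J c V (m - (\<Sum>i\<in>I - J. c i * k i))"
proof -
  have "(\<Sum>i\<in>I. c i * k i) = (\<Sum>i\<in>J. c i * k i) + (\<Sum>i\<in>I - J. c i * k i)"
    using assms by (metis sum.subset_diff add.commute)
  then show ?thesis using assms by (auto simp: sol_def PiE_def)
qed

lemma inj_on_sol_restrict:
  assumes "finite I" "i \<in> I" "c i \<ge> 1"
  shows "inj_on (\<lambda>k. restrict k (I - {i})) (sol I c V m)"
proof (rule inj_onI)
  fix k l assume k: "k \<in> sol I c V m" and l: "l \<in> sol I c V m"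
    and eq: "restrict k (I - {i}) = restrict l (I - {i})"
  have off: "k j = l j" if "j \<in> I - {i}" for j
    using fun_cong[OF eq, of j] that by simp
  have "(\<Sum>j\<in>I. c j * k j) = c i * k i + (\<Sum>j\<in>I - {i}. c j * k j)"
       "(\<Sum>j\<in>I. c j * l j) = c i * l i + (\<Sum>j\<in>I - {i}. c j * l j)"
    using assms by (auto intro: sum.remove)
  moreover have "(\<Sum>j\<in>I - {i}. c j * k j) = (\<Sum>j\<in>I - {i}. c j * l j)"
    using off by (intro sum.cong) auto
  moreover have "(\<Sum>j\<in>I. c j * k j) = m" "(\<Sum>j\<in>I. c j * l j) = m" using k l by (auto simp: sol_def)
  ultimately have "c i * k i = c i * l i" by linarith
  then have "k i = l i" using assms by simp
  then show "k = l" using off k l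
    by (intro PiE_ext[of k I "\<lambda>_. V" l]) (auto simp: sol_def)
qed

lemma card_sol_le:
  assumes "finite I" "I \<noteq> {}" "\<And>i. i \<in> I \<Longrightarrow> c i \<ge> 1" "finite V"
  shows "card (sol I c V m) \<le> card V ^ (card I - 1)"
proof -
  obtain i where i: "i \<in> I" using assms by auto
  have "card (sol I c V m) \<le> card ((I - {i}) \<rightarrow>\<^sub>E V)"
    using i assms
    by (intro card_inj_on_le[OF inj_on_sol_restrict[of I i c V m]]) (auto simp: sol_def intro!:
        finite_PiE)
  also have "\<dots> = card V ^ (card I - 1)" using assms i by (simp add: card_PiE)
  finally show ?thesis .
qed

text \<open>By the mean value theorem each term is at most \<open>h\<close> times an increment of
  x^(1/h), and the increments telescope. The first term is treated apart, as the derivative is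
  singular at 0.\<close>

lemma sum_powr_le:
  assumes "h \<ge> 1"
  shows "(\<Sum>v=1..n. real v powr (1 / real h - 1)) \<le> real h * real n powr (1 / real h)"
proof (induction n)
  case 0
  then show ?case by simp
next
  case (Suc n)
  let ?a = "1 / real h"
  have a: "0 < ?a" "?a \<le> 1" using assms by auto
  have "real (Suc n) powr (?a - 1) \<le> h * (real (Suc n) powr ?a - real n powr ?a)"
  proof (cases "n = 0")
    case True
    then show ?thesis using assms by simp
  next
    case False
    have "\<exists>z::real. real n < z \<and> z < real (Suc n) \<and>
      real (Suc n) powr ?a - real n powr ?a = (real (Suc n) - real n) * (?a * z powr (?a - 1))"
      by (intro MVT2 has_real_derivative_powr) (use False in auto)
    then obtain z where z: "real n < z" "z < real (Suc n)"
      "real (Suc n) powr ?a - real n powr ?a = ?a * z powr (?a - 1)" by auto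
    have "real (Suc n) powr (?a - 1) \<le> z powr (?a - 1)"
      using a z by (intro powr_mono2') auto
    also have "\<dots> = h * (real (Suc n) powr ?a - real n powr ?a)" using z(3) assms by simp
    finally show ?thesis .
  qed
  then show ?case using Suc by (simp add: algebra_simps)
qed

text \<open>The factors come from the choice of a large entry, from the ratio of \<open>m\<close> to
  that entry, and from the sums over the remaining entries.\<close>

definition wconst :: "nat \<Rightarrow> nat \<Rightarrow> real" where
  "wconst h B = real h * (real h * real B) * real h ^ h"

lemma wconst_ge_1: "h \<ge> 1 \<Longrightarrow> B \<ge> 1 \<Longrightarrow> wconst h B \<ge> 1"
  unfolding wconst_def by (intro mult_ge1_I one_le_power) auto

text \<open>Some entry of a solution is at least \<open>m / (h * B)\<close>, so its weight is of
  order \<open>m powr (1 / h - 1)\<close>. The equation determines it from the other entries, and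
  these may be summed independently over \<open>{1..m}\<close>, each sum being at most
  \<open>h * m powr (1 / h)\<close>.\<close>

lemma weight_sum_le:
  assumes I: "finite I" "I \<noteq> {}" "card I \<le> h" and c: "\<And>i. i \<in> I \<Longrightarrow> 1 \<le> c i \<and> c i \<le> B"
    and V: "finite V" "0 \<notin> V" and m: "m \<ge> 1"
  shows "(\<Sum>k\<in>sol I c V m. \<Prod>i\<in>I. real (k i) powr (1 / real h - 1))
      \<le> wconst h B * real m powr (real (card I) / real h - 1)"
proof -
  let ?a = "1 / real h" and ?l = "card I"
  define g where "g v = real v powr (?a - 1)" for v :: nat
  have l1: "?l \<ge> 1" using I by (metis card_0_eq less_one not_less)
  then have h1: "h \<ge> 1" using I by simp
  obtain i0 where "i0 \<in> I" using I by auto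
  then have B1: "B \<ge> 1" using c by fastforce
  have g0: "g v \<ge> 0" for v by (simp add: g_def)
  define Ki where "Ki i = {k \<in> sol I c V m. m \<le> h * B * k i}" for i
  have cover: "\<exists>i\<in>I. k \<in> Ki i" if k: "k \<in> sol I c V m" for k
  proof (rule ccontr)
    assume "\<not> ?thesis"
    then have lt: "h * B * k i < m" if "i \<in> I" for i using that k by (auto simp: Ki_def)
    have "h * m = (\<Sum>i\<in>I. h * (c i * k i))" using k by (auto simp: sol_def
        sum_distrib_left[symmetric])
    also have "\<dots> \<le> (\<Sum>i\<in>I. h * B * k i)" using c by (intro sum_mono) (simp add: mult.assoc)
    also have "\<dots> < (\<Sum>i\<in>I. m)" using I lt by (intro sum_strict_mono) auto
    also have "\<dots> \<le> h * m" using I by simp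
    finally show False by simp
  qed
  have one: "(\<Sum>k\<in>Ki i. \<Prod>j\<in>I. g (k j))
      \<le> real h * real B * real h ^ h * real m powr (real ?l / real h - 1)" if i: "i \<in> I" for i
  proof -
    let ?G = "\<lambda>k. \<Prod>j\<in>I - {i}. g (k j)"
    let ?A = "(real h * real B) * real m powr (?a - 1)"
    have fin: "finite (Ki i)" using I V by (simp add: Ki_def)
    have "(\<Sum>k\<in>Ki i. \<Prod>j\<in>I. g (k j)) \<le> (\<Sum>k\<in>Ki i. ?A * ?G (restrict k (I - {i})))"
    proof (intro sum_mono)
      fix k assume k: "k \<in> Ki i"
      have "real m / (real h * real B) \<le> real (k i)"
        using k h1 B1 of_nat_mono[of m "h * B * k i", where 'a = real]
        by (simp add: Ki_def field_simps)
      then have "g (k i) \<le> (real m / (real h * real B)) powr (?a - 1)"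
        unfolding g_def using m h1 B1 by (intro powr_mono2') auto
      also have "\<dots> = (real h * real B) powr (1 - ?a) * real m powr (?a - 1)"
        using powr_minus_divide[of "real h * real B" "?a - 1"] by (simp only: minus_diff_eq) (simp
            add: powr_divide)
      also have "(real h * real B) powr (1 - ?a) \<le> (real h * real B) powr 1"
        using h1 B1 by (intro powr_mono) (auto simp flip: of_nat_mult)
      finally have "g (k i) \<le> ?A" using h1 B1 by (simp add: mult_right_mono)
      then have "g (k i) * ?G k \<le> ?A * ?G k"
        by (intro mult_right_mono prod_nonneg) (auto simp: g0)
      moreover have "(\<Prod>j\<in>I. g (k j)) = g (k i) * ?G k"
        using I i by (simp add: prod.remove)
      ultimately show "(\<Prod>j\<in>I. g (k j)) \<le> ?A * ?G (restrict k (I - {i}))" by simp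
    qed
    also have "\<dots> = ?A * (\<Sum>k\<in>(\<lambda>k. restrict k (I - {i})) ` Ki i. ?G k)"
    proof -
      have "inj_on (\<lambda>k. restrict k (I - {i})) (Ki i)"
        by (rule inj_on_subset[OF inj_on_sol_restrict[of I i c V m]]) (use I i c in \<open>auto simp: Ki_def\<close>)
      then show ?thesis by (subst sum.reindex) (auto simp: sum_distrib_left)
    qed
    also have "\<dots> \<le> ?A * (\<Sum>k\<in>(I - {i}) \<rightarrow>\<^sub>E {1..m}. ?G k)"
    proof (intro mult_left_mono sum_mono2 image_subsetI)
      fix k assume "k \<in> Ki i"
      then have k: "k \<in> sol I c V m" by (simp add: Ki_def)
      have "k j \<in> {1..m}" if "j \<in> I" for j
        using sol_le[OF k I(1) that] c[OF that] sol_image[OF k] that V(2)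
        by (metis atLeastAtMost_iff image_subset_iff less_one not_less)
      then show "restrict k (I - {i}) \<in> (I - {i}) \<rightarrow>\<^sub>E {1..m}" by auto
    qed (use I in \<open>auto intro!: finite_PiE prod_nonneg simp: g0\<close>)
    also have "(\<Sum>k\<in>(I - {i}) \<rightarrow>\<^sub>E {1..m}. ?G k) = (\<Sum>v=1..m. g v) ^ (?l - 1)"
      using I i by (subst prod_sum_PiE[symmetric]) auto
    also have "?A * (\<Sum>v=1..m. g v) ^ (?l - 1) \<le> ?A * (real h * real m powr ?a) ^ (?l - 1)"
      using sum_powr_le[OF h1, of m] g0
      by (intro mult_left_mono power_mono sum_nonneg) (auto simp: g_def)
    also have "\<dots> = real h * real B * real h ^ (?l - 1) * (real m powr (?a - 1) * (real m powr ?a) ^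
        (?l - 1))"
      by (simp add: power_mult_distrib)
    also have "real m powr (?a - 1) * (real m powr ?a) ^ (?l - 1) = real m powr (real ?l / real h -
        1)"
    proof -
      have e: "?a - 1 + ?a * real (?l - 1) = real ?l / real h - 1"
        using l1 by (simp add: of_nat_diff diff_divide_distrib)
      have "real m powr (?a - 1) * (real m powr ?a) ^ (?l - 1) = real m powr (?a - 1 + ?a * real
          (?l - 1))"
        using m by (simp add: powr_realpow[symmetric] powr_powr powr_add)
      then show ?thesis by (simp only: e)
    qed
    also have "real h * real B * real h ^ (?l - 1) * real m powr (real ?l / real h - 1)
       \<le> real h * real B * real h ^ h * real m powr (real ?l / real h - 1)"
      using h1 I by (intro mult_right_mono mult_left_mono power_increasing) auto
    finally show ?thesis .
  qed
  have "(\<Sum>k\<in>sol I c V m. \<Prod>j\<in>I. g (k j)) \<le> (\<Sum>k\<in>(\<Union>i\<in>I. Ki i). \<Prod>j\<in>I. g (k j))"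
    using cover I V by (intro sum_mono2) (auto simp: Ki_def intro!: prod_nonneg g0)
  also have "\<dots> \<le> (\<Sum>i\<in>I. \<Sum>k\<in>Ki i. \<Prod>j\<in>I. g (k j))"
  proof -
    have "(\<Sum>k\<in>(\<Union>i\<in>I. Ki i). \<Prod>j\<in>I. g (k j)) \<le> (\<Sum>(i, k)\<in>Sigma I Ki. \<Prod>j\<in>I. g (k j))"
      using I V by (intro sum_le_included[where i = snd]) (auto simp: Ki_def intro!: prod_nonneg g0)
    then show ?thesis using I V by (subst (asm) sum.Sigma[symmetric]) (auto simp: Ki_def)
  qed
  also have "\<dots> \<le> (\<Sum>i\<in>I. real h * real B * real h ^ h * real m powr (real ?l / real h - 1))"
    by (intro sum_mono one)
  also have "\<dots> \<le> real h * (real h * real B * real h ^ h * real m powr (real ?l / real h - 1))"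
    using I by (auto intro!: mult_right_mono)
  finally show ?thesis by (simp add: wconst_def g_def mult_ac)
qed

text \<open>The entries at the positions of \<open>I - J\<close> are chosen from \<open>U\<close>,
  and each choice leaves an equation in the unknowns of \<open>J\<close>. Its target may be a
  truncated difference, which is harmless because \<open>\<beta>\<close> bounds the sum for every
  target.\<close>

lemma sum_pattern_le:
  fixes p :: "nat \<Rightarrow> real"
  assumes I: "finite I" "J \<subseteq> I" and V: "finite V" "\<And>v. v \<in> V \<Longrightarrow> 0 \<le> p v" and U: "finite U"
    and \<beta>: "\<And>m'. (\<Sum>k\<in>sol J c V m'. \<Prod>i\<in>J. p (k i)) \<le> \<beta>"
  shows "(\<Sum>k\<in>{k \<in> sol I c V m. {i\<in>I. k i \<notin> U} = J}. \<Prod>i\<in>J. p (k i))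
      \<le> real (card U) ^ card (I - J) * \<beta>"
proof -
  let ?T = "Sigma ((I - J) \<rightarrow>\<^sub>E U) (\<lambda>u. sol J c V (m - (\<Sum>i\<in>I - J. c i * u i)))"
  let ?merge = "\<lambda>(u, k) j. if j \<in> J then k j else u j"
  have fJ: "finite J" using I finite_subset by auto
  have "(\<Sum>k\<in>{k \<in> sol I c V m. {i\<in>I. k i \<notin> U} = J}. \<Prod>i\<in>J. p (k i))
      \<le> (\<Sum>(u, k)\<in>?T. \<Prod>i\<in>J. p (k i))"
  proof (rule sum_le_included[where i = ?merge])
    show "finite {k \<in> sol I c V m. {i\<in>I. k i \<notin> U} = J}" using I V by simp
    show "finite ?T" using I U V fJ by (intro finite_SigmaI finite_PiE) auto
    show "\<forall>y\<in>?T. 0 \<le> (case y of (u, k) \<Rightarrow> \<Prod>i\<in>J. p (k i))"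
    proof
      fix y assume "y \<in> ?T"
      then obtain u k where y: "y = (u, k)" "k \<in> sol J c V (m - (\<Sum>i\<in>I - J. c i * u i))" by auto
      then show "0 \<le> (case y of (u, k) \<Rightarrow> \<Prod>i\<in>J. p (k i))"
        using sol_image[OF y(2)] by (auto intro!: prod_nonneg V(2))
    qed
    show "\<forall>k\<in>{k \<in> sol I c V m. {i\<in>I. k i \<notin> U} = J}. \<exists>y\<in>?T. ?merge y = k \<and>
       (\<Prod>i\<in>J. p (k i)) \<le> (case y of (u, k) \<Rightarrow> \<Prod>i\<in>J. p (k i))"
    proof (intro ballI)
      fix k assume k: "k \<in> {k \<in> sol I c V m. {i\<in>I. k i \<notin> U} = J}"
      let ?y = "(restrict k (I - J), restrict k J)"
      have u: "restrict k (I - J) \<in> (I - J) \<rightarrow>\<^sub>E U" using k by auto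
      have r: "restrict k J \<in> sol J c V (m - (\<Sum>i\<in>I - J. c i * k i))"
        using k I by (intro sol_restrict) auto
      have eq: "(\<Sum>i\<in>I - J. c i * restrict k (I - J) i) = (\<Sum>i\<in>I - J. c i * k i)"
        by (intro sum.cong) auto
      have "?y \<in> ?T" by (rule SigmaI[OF u]) (subst eq, rule r)
      moreover have "?merge ?y = k"
      proof
        fix j
        have "k j = undefined" if "j \<notin> I" using k that by (auto simp: sol_def PiE_def
            extensional_def)
        then show "?merge ?y j = k j" using I by auto
      qed
      ultimately show "\<exists>y\<in>?T. ?merge y = k \<and>
       (\<Prod>i\<in>J. p (k i)) \<le> (case y of (u, k) \<Rightarrow> \<Prod>i\<in>J. p (k i))"
        by (intro bexI[of _ ?y]) auto
    qed
  qed
  also have "\<dots> = (\<Sum>u\<in>(I - J) \<rightarrow>\<^sub>E U. \<Sum>k\<in>sol J c V (m - (\<Sum>i\<in>I - J. c i * u i)). \<Prod>i\<in>J. p (k i))"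
    using I U V fJ by (subst sum.Sigma) (auto intro!: finite_PiE)
  also have "\<dots> \<le> (\<Sum>u\<in>(I - J) \<rightarrow>\<^sub>E U. \<beta>)" by (intro sum_mono \<beta>)
  also have "\<dots> = real (card U) ^ card (I - J) * \<beta>" using I by (simp add: card_PiE)
  finally show ?thesis .
qed

lemma prod_image_diff_inj:
  assumes "inj_on k I"
  shows "(\<Prod>v\<in>k ` I - U. p v) = (\<Prod>i\<in>{i\<in>I. k i \<notin> U}. p (k i))"
proof -
  have "k ` I - U = k ` {i\<in>I. k i \<notin> U}" by auto
  moreover have "inj_on k {i\<in>I. k i \<notin> U}" using assms by (rule inj_on_subset) auto
  ultimately show ?thesis by (simp add: prod.reindex)
qed

text \<open>For an injective \<open>k\<close> the product over entries outside \<open>U\<close> is a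
  product over positions, so solutions can be sorted by the set \<open>J\<close> of positions
  outside \<open>U\<close>. The family \<open>\<J>\<close> is kept general: the moment method needs
  all \<open>J\<close>, while Janson's inequality only meets solutions that share an entry with
  \<open>U\<close>, that is, \<open>J \<noteq> I\<close>.\<close>

lemma sum_inj_le:
  fixes p :: "nat \<Rightarrow> real"
  assumes I: "finite I" and V: "finite V" "\<And>v. v \<in> V \<Longrightarrow> 0 \<le> p v" and U: "finite U"
    and \<beta>: "\<And>J m'. J \<in> \<J> \<Longrightarrow> (\<Sum>k\<in>sol J c V m'. \<Prod>i\<in>J. p (k i)) \<le> \<beta> J"
    and \<J>: "\<J> \<subseteq> Pow I"
    and K: "K \<subseteq> {k \<in> sol I c V m. inj_on k I}" "\<And>k. k \<in> K \<Longrightarrow> {i\<in>I. k i \<notin> U} \<in> \<J>"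
  shows "(\<Sum>k\<in>K. \<Prod>v\<in>k ` I - U. p v) \<le> (\<Sum>J\<in>\<J>. real (card U) ^ card (I - J) * \<beta> J)"
proof -
  have fin: "finite K" using K(1) I V finite_subset[OF _ finite_sol[of I V c m]] by blast
  have fJ: "finite \<J>" using \<J> I finite_subset by auto
  have "(\<Sum>k\<in>K. \<Prod>v\<in>k ` I - U. p v) = (\<Sum>k\<in>K. \<Prod>i\<in>{i\<in>I. k i \<notin> U}. p (k i))"
    using K by (intro sum.cong refl prod_image_diff_inj) auto
  also have "\<dots> = (\<Sum>J\<in>\<J>. \<Sum>k\<in>{k\<in>K. {i\<in>I. k i \<notin> U} = J}. \<Prod>i\<in>{i\<in>I. k i \<notin> U}. p (k i))"
    using fin fJ K(2) by (subst sum.group) auto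
  also have "\<dots> \<le> (\<Sum>J\<in>\<J>. real (card U) ^ card (I - J) * \<beta> J)"
  proof (intro sum_mono)
    fix J assume J: "J \<in> \<J>"
    then have JI: "J \<subseteq> I" using \<J> by auto
    have "(\<Sum>k\<in>{k\<in>K. {i\<in>I. k i \<notin> U} = J}. \<Prod>i\<in>{i\<in>I. k i \<notin> U}. p (k i))
       = (\<Sum>k\<in>{k\<in>K. {i\<in>I. k i \<notin> U} = J}. \<Prod>i\<in>J. p (k i))"
      by (intro sum.cong) auto
    also have "\<dots> \<le> (\<Sum>k\<in>{k \<in> sol I c V m. {i\<in>I. k i \<notin> U} = J}. \<Prod>i\<in>J. p (k i))"
    proof (intro sum_mono2 prod_nonneg V(2))
      show "finite {k \<in> sol I c V m. {i \<in> I. k i \<notin> U} = J}" using I V by simp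
      show "{k \<in> K. {i \<in> I. k i \<notin> U} = J} \<subseteq> {k \<in> sol I c V m. {i \<in> I. k i \<notin> U} = J}" using K(1) by
          auto
    next
      fix k i
      assume "k \<in> {k \<in> sol I c V m. {i \<in> I. k i \<notin> U} = J} - {k \<in> K. {i \<in> I. k i \<notin> U} = J}" "i \<in> J"
      then show "k i \<in> V" using sol_image JI by fastforce
    qed
    also have "\<dots> \<le> real (card U) ^ card (I - J) * \<beta> J"
      by (rule sum_pattern_le) (use I V U JI \<beta>[OF J] in auto)
    finally show "(\<Sum>k\<in>{k\<in>K. {i\<in>I. k i \<notin> U} = J}. \<Prod>i\<in>{i\<in>I. k i \<notin> U}. p (k i))
       \<le> real (card U) ^ card (I - J) * \<beta> J" .
  qed
  finally show ?thesis .
qed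

section \<open>Solutions with repeated entries\<close>

lemma sol_merge:
  assumes "k \<in> sol I c V m" "finite I" "i \<in> I" "j \<in> I" "i \<noteq> j" "k i = k j"
  shows "restrict k (I - {j}) \<in> sol (I - {j}) (c(i := c i + c j)) V m"
    and "restrict k (I - {j}) ` (I - {j}) = k ` I"
proof -
  let ?c = "c(i := c i + c j)"
  have "(\<Sum>x\<in>I. c x * k x) = c j * k j + (\<Sum>x\<in>I - {j}. c x * k x)"
    using assms by (intro sum.remove) auto
  also have "(\<Sum>x\<in>I - {j}. c x * k x) = c i * k i + (\<Sum>x\<in>I - {j} - {i}. c x * k x)"
    using assms by (intro sum.remove) auto
  also have "(\<Sum>x\<in>I - {j} - {i}. c x * k x) = (\<Sum>x\<in>I - {j} - {i}. ?c x * restrict k (I - {j}) x)"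
    by (intro sum.cong) auto
  also have "c j * k j + (c i * k i + \<dots>) = (\<Sum>x\<in>I - {j}. ?c x * restrict k (I - {j}) x)"
    using assms by (subst sum.remove[of "I - {j}" i]) (auto simp: algebra_simps)
  finally show "restrict k (I - {j}) \<in> sol (I - {j}) ?c V m"
    using assms by (auto simp: sol_def PiE_def)
  have "k ` (I - {j}) = k ` I" using assms by (auto simp: image_iff) (metis DiffI singletonD)
  then show "restrict k (I - {j}) ` (I - {j}) = k ` I" by simp
qed

lemma inj_on_merge:
  assumes "i \<in> I" "j \<in> I" "i \<noteq> j"
  shows "inj_on (\<lambda>k. restrict k (I - {j})) {k \<in> sol I c V m. k i = k j}"
proof (rule inj_onI)
  fix k l assume k: "k \<in> {k \<in> sol I c V m. k i = k j}" and l: "l \<in> {k \<in> sol I c V m. k i = k j}"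
    and eq: "restrict k (I - {j}) = restrict l (I - {j})"
  have off: "k x = l x" if "x \<in> I - {j}" for x
    using fun_cong[OF eq, of x] that by simp
  have "k j = l j" using off[of i] assms k l by simp
  then show "k = l" using off k l
    by (intro PiE_ext[of k I "\<lambda>_. V" l]) (auto simp: sol_def)
qed

text \<open>A solution with \<open>k i = k j\<close> is a solution in fewer unknowns, where \<open>c i\<close> is replaced by \<open>c i + c j\<close>.\<close>

lemma sum_merge_le:
  fixes f :: "nat set \<Rightarrow> real"
  assumes I: "finite I" and V: "finite V" and f: "\<And>S. S \<subseteq> V \<Longrightarrow> 0 \<le> f S"
  shows "(\<Sum>k\<in>sol I c V m. f (k ` I)) \<le> (\<Sum>k\<in>{k \<in> sol I c V m. inj_on k I}. f (k ` I))
    + (\<Sum>(i, j)\<in>{(i, j). i \<in> I \<and> j \<in> I \<and> i \<noteq> j}.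
        \<Sum>k\<in>sol (I - {j}) (c(i := c i + c j)) V m. f (k ` (I - {j})))"
proof -
  let ?P = "{(i, j). i \<in> I \<and> j \<in> I \<and> i \<noteq> j}"
  let ?E = "\<lambda>(i, j). {k \<in> sol I c V m. k i = k j}"
  have fP: "finite ?P" using I by (rule_tac finite_subset[of _ "I \<times> I"]) auto
  have fs: "finite (sol I c V m)" using I V by simp
  have f0: "0 \<le> f (k ` I)" if "k \<in> sol I c V m" for k using f sol_image that by blast
  have "sol I c V m = {k \<in> sol I c V m. inj_on k I} \<union> {k \<in> sol I c V m. \<not> inj_on k I}" by auto
  then have "(\<Sum>k\<in>sol I c V m. f (k ` I)) = (\<Sum>k\<in>{k \<in> sol I c V m. inj_on k I}. f (k ` I))
     + (\<Sum>k\<in>{k \<in> sol I c V m. \<not> inj_on k I}. f (k ` I))"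
    using fs by (subst sum.union_disjoint[symmetric]) auto
  also have "(\<Sum>k\<in>{k \<in> sol I c V m. \<not> inj_on k I}. f (k ` I)) \<le> (\<Sum>(x, k)\<in>Sigma ?P ?E. f (k ` I))"
  proof (rule sum_le_included[where i = snd])
    show "finite (Sigma ?P ?E)" using fP fs by (intro finite_SigmaI) auto
    show "\<forall>k\<in>{k \<in> sol I c V m. \<not> inj_on k I}. \<exists>y\<in>Sigma ?P ?E. snd y = k \<and>
      f (k ` I) \<le> (case y of (x, k) \<Rightarrow> f (k ` I))"
    proof
      fix k assume k: "k \<in> {k \<in> sol I c V m. \<not> inj_on k I}"
      then obtain i j where "i \<in> I" "j \<in> I" "i \<noteq> j" "k i = k j" by (auto simp: inj_on_def)
      then show "\<exists>y\<in>Sigma ?P ?E. snd y = k \<and> f (k ` I) \<le> (case y of (x, k) \<Rightarrow> f (k ` I))"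
        using k by (intro bexI[of _ "((i, j), k)"]) auto
    qed
  qed (use fs f0 in auto)
  also have "\<dots> = (\<Sum>x\<in>?P. \<Sum>k\<in>?E x. f (k ` I))"
    using fP fs by (subst sum.Sigma) auto
  also have "\<dots> \<le> (\<Sum>(i, j)\<in>?P. \<Sum>k\<in>sol (I - {j}) (c(i := c i + c j)) V m. f (k ` (I - {j})))"
  proof (intro sum_mono, clarify)
    fix i j assume ij: "i \<in> I" "j \<in> I" "i \<noteq> j"
    let ?r = "\<lambda>k. restrict k (I - {j})"
    have "(\<Sum>k\<in>{k \<in> sol I c V m. k i = k j}. f (k ` I)) = (\<Sum>k\<in>{k \<in> sol I c V m. k i = k j}. f (?r k
        ` (I - {j})))"
      by (intro sum.cong refl) (use sol_merge(2)[OF _ I ij] in force)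
    also have "\<dots> = (\<Sum>k\<in>?r ` {k \<in> sol I c V m. k i = k j}. f (k ` (I - {j})))"
      by (subst sum.reindex[OF inj_on_merge[OF ij]]) simp
    also have "\<dots> \<le> (\<Sum>k\<in>sol (I - {j}) (c(i := c i + c j)) V m. f (k ` (I - {j})))"
    proof (rule sum_mono2)
      show "finite (sol (I - {j}) (c(i := c i + c j)) V m)" using I V by simp
      show "?r ` {k \<in> sol I c V m. k i = k j} \<subseteq> sol (I - {j}) (c(i := c i + c j)) V m"
        using sol_merge(1)[OF _ I ij] by force
      fix k assume "k \<in> sol (I - {j}) (c(i := c i + c j)) V m - ?r ` {k \<in> sol I c V m. k i = k j}"
      then show "0 \<le> f (k ` (I - {j}))" using f sol_image by blast
    qed
    finally show "(\<Sum>k\<in>{k \<in> sol I c V m. k i = k j}. f (k ` I))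
      \<le> (\<Sum>k\<in>sol (I - {j}) (c(i := c i + c j)) V m. f (k ` (I - {j})))" .
  qed
  finally show ?thesis by simp
qed

text \<open>Repeated entries are merged until the solution is injective. Merging preserves the sum
  of the coefficients, which is why \<open>B\<close> bounds \<open>sum c I\<close> and not each
  coefficient. At every stage there are at most \<open>l\<^sup>2\<close> pairs to merge, which costs
  a factor \<open>1 + l\<^sup>2\<close> per unknown.\<close>

lemma sum_sol_le_of_inj:
  fixes f :: "nat set \<Rightarrow> real" and I :: "'i set"
  assumes V: "finite V" and f: "\<And>S. S \<subseteq> V \<Longrightarrow> 0 \<le> f S" and Q: "0 \<le> Q"
    and inj: "\<And>(I :: 'i set) c. finite I \<Longrightarrow> I \<noteq> {} \<Longrightarrow> card I \<le> l \<Longrightarrow> (\<And>i. i \<in> I \<Longrightarrow> 1 \<le> c i) \<Longrightarrow> sum c I \<le>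
        B \<Longrightarrow>
        (\<Sum>k\<in>{k \<in> sol I c V m. inj_on k I}. f (k ` I)) \<le> Q"
    and I: "finite I" "I \<noteq> {}" "card I \<le> l" "\<And>i. i \<in> I \<Longrightarrow> 1 \<le> c i" "sum c I \<le> B"
  shows "(\<Sum>k\<in>sol I c V m. f (k ` I)) \<le> real (1 + l\<^sup>2) ^ card I * Q"
  using I
proof (induction "card I" arbitrary: I c)
  case 0
  then show ?case by auto
next
  case (Suc n)
  let ?P = "{(i, j). i \<in> I \<and> j \<in> I \<and> i \<noteq> j}"
  let ?D = "real (1 + l\<^sup>2)"
  have cP: "card ?P \<le> l\<^sup>2"
  proof -
    have "card ?P \<le> card (I \<times> I)" using Suc.prems by (intro card_mono) auto
    also have "\<dots> \<le> l\<^sup>2" using Suc.prems by (simp add: card_cartesian_product power2_eq_square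
        mult_le_mono)
    finally show ?thesis .
  qed
  have "(\<Sum>k\<in>sol I c V m. f (k ` I)) \<le> (\<Sum>k\<in>{k \<in> sol I c V m. inj_on k I}. f (k ` I))
    + (\<Sum>(i, j)\<in>?P. \<Sum>k\<in>sol (I - {j}) (c(i := c i + c j)) V m. f (k ` (I - {j})))"
    by (rule sum_merge_le[OF Suc.prems(1) V f])
  also have "\<dots> \<le> Q + (\<Sum>(i, j)\<in>?P. ?D ^ n * Q)"
  proof (intro add_mono sum_mono)
    show "(\<Sum>k\<in>{k \<in> sol I c V m. inj_on k I}. f (k ` I)) \<le> Q"
      using Suc.prems by (intro inj) auto
  next
    fix x assume "x \<in> ?P"
    then obtain i j where x: "x = (i, j)" and ij: "i \<in> I" "j \<in> I" "i \<noteq> j" by auto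
    have card: "card (I - {j}) = n" using Suc.hyps(2) ij Suc.prems by simp
    let ?c = "c(i := c i + c j)"
    have "(\<Sum>k\<in>sol (I - {j}) ?c V m. f (k ` (I - {j}))) \<le> ?D ^ card (I - {j}) * Q"
    proof (rule Suc.hyps(1))
      have "sum ?c (I - {j}) = (c i + c j) + sum c (I - {j} - {i})"
        using ij Suc.prems by (subst sum.remove[of _ i]) (auto intro!: sum.cong)
      also have "\<dots> = sum c I"
        using ij Suc.prems by (simp add: sum.remove[of I j] sum.remove[of "I - {j}" i])
      finally show "sum ?c (I - {j}) \<le> B" using Suc.prems by simp
      show "I - {j} \<noteq> {}" using ij by auto
      show "1 \<le> ?c x" if "x \<in> I - {j}" for x
        using that Suc.prems(4)[of x] by auto
    qed (use card Suc.hyps(2) Suc.prems ij in auto)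
    then show "(case x of (i, j) \<Rightarrow> \<Sum>k\<in>sol (I - {j}) (c(i := c i + c j)) V m. f (k ` (I - {j})))
      \<le> (case x of (i, j) \<Rightarrow> ?D ^ n * Q)" by (simp add: x card)
  qed
  also have "\<dots> = Q + card ?P * (?D ^ n * Q)" by (simp add: case_prod_unfold)
  also have "\<dots> \<le> ?D ^ n * Q + real (l\<^sup>2) * (?D ^ n * Q)"
  proof (intro add_mono mult_right_mono)
    show "Q \<le> ?D ^ n * Q" using Q by (simp add: mult_le_cancel_right1)
  qed (use cP Q in auto)
  also have "\<dots> = ?D ^ card I * Q" using Suc.hyps(2)[symmetric] by (simp add: algebra_simps)
  finally show ?case .
qed

lemma mu_le:
  fixes p :: "nat \<Rightarrow> real"
  assumes J: "finite J" "J \<noteq> {}" "card J \<le> h" and c: "\<And>i. i \<in> J \<Longrightarrow> 1 \<le> c i \<and> c i \<le> B"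
    and V: "finite V" "0 \<notin> V" and p: "\<And>v. v \<in> V \<Longrightarrow> 0 \<le> p v \<and> p v \<le> q * real v powr (1 / real h - 1)"
    and m: "m \<ge> 1" and q: "q \<ge> 1"
  shows "(\<Sum>k\<in>sol J c V m. \<Prod>i\<in>J. p (k i)) \<le> wconst h B * q ^ card J * real m powr (real (card J) /
      real h - 1)"
proof -
  have "(\<Sum>k\<in>sol J c V m. \<Prod>i\<in>J. p (k i))
      \<le> (\<Sum>k\<in>sol J c V m. \<Prod>i\<in>J. q * real (k i) powr (1 / real h - 1))"
  proof (intro sum_mono prod_mono)
    fix k i assume "k \<in> sol J c V m" "i \<in> J"
    then have "k i \<in> V" using sol_image by blast
    then show "0 \<le> p (k i) \<and> p (k i) \<le> q * real (k i) powr (1 / real h - 1)" by (rule p)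
  qed
  also have "\<dots> = q ^ card J * (\<Sum>k\<in>sol J c V m. \<Prod>i\<in>J. real (k i) powr (1 / real h - 1))"
    by (simp add: prod.distrib sum_distrib_left)
  also have "\<dots> \<le> q ^ card J * (wconst h B * real m powr (real (card J) / real h - 1))"
    using q by (intro mult_left_mono weight_sum_le assms) auto
  finally show ?thesis by (simp add: mult_ac)
qed

lemma powr_nonpos_le_one:
  fixes x :: real
  assumes "x \<ge> 1" "a \<le> 0"
  shows "x powr a \<le> 1"
  using powr_mono[OF assms(2,1)] assms(1) by simp

lemma mu_le_uniform:
  fixes p :: "nat \<Rightarrow> real"
  assumes J: "finite J" "card J \<le> h" and c: "\<And>i. i \<in> J \<Longrightarrow> 1 \<le> c i \<and> c i \<le> B"
    and V: "finite V" "0 \<notin> V" and p: "\<And>v. v \<in> V \<Longrightarrow> 0 \<le> p v \<and> p v \<le> q * real v powr (1 / real h - 1)"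
    and q: "q \<ge> 1" and hB: "h \<ge> 1" "B \<ge> 1"
  shows "(\<Sum>k\<in>sol J c V m. \<Prod>i\<in>J. p (k i)) \<le> wconst h B * q ^ card J"
proof -
  have w: "wconst h B \<ge> 1" using hB by (rule wconst_ge_1)
  consider "J = {}" | "J \<noteq> {}" "m = 0" | "J \<noteq> {}" "m \<ge> 1" by fastforce
  then show ?thesis
  proof cases
    case 1
    then show ?thesis using w by (simp add: sol_empty)
  next
    case 2
    then have "sol J c V m = {}" using sol_zero[of J c V] J c V by auto
    then show ?thesis using w q by simp
  next
    case 3
    have "(\<Sum>k\<in>sol J c V m. \<Prod>i\<in>J. p (k i)) \<le> wconst h B * q ^ card J * real m powr (real (card J) /
        real h - 1)"
      by (rule mu_le) (use assms 3 in auto)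
    also have "\<dots> \<le> wconst h B * q ^ card J * 1"
      using 3 J hB w q by (intro mult_left_mono powr_nonpos_le_one mult_nonneg_nonneg) auto
    finally show ?thesis by simp
  qed
qed

text \<open>The first factor pays for merging repeated entries, \<open>2 ^ h\<close> for the sets of
  positions outside \<open>U\<close>, and \<open>wconst\<close> for the weights.\<close>

definition sconst :: "nat \<Rightarrow> nat \<Rightarrow> real" where
  "sconst h B = real (1 + h\<^sup>2) ^ h * (2 ^ h * wconst h B)"

lemma sconst_ge_1: "h \<ge> 1 \<Longrightarrow> B \<ge> 1 \<Longrightarrow> sconst h B \<ge> 1"
  unfolding sconst_def by (intro mult_ge1_I one_le_power wconst_ge_1) auto

text \<open>A solution with an entry in \<open>U\<close> has at most \<open>N ^ h\<close> choices
  for its entries there, but at least one factor \<open>q\<close> disappears from its weight. Under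
  \<open>N ^ h \<le> q\<close> this is no worse than a solution disjoint from
  \<open>U\<close>.\<close>

lemma sum_relative_weights_le:
  fixes p :: "nat \<Rightarrow> real"
  assumes I: "finite I" "I \<noteq> {}" "card I \<le> h" "\<And>i. i \<in> I \<Longrightarrow> 1 \<le> c i" "sum c I \<le> B"
    and V: "finite V" "0 \<notin> V" and p: "\<And>v. v \<in> V \<Longrightarrow> 0 \<le> p v \<and> p v \<le> q * real v powr (1 / real h - 1)"
    and q: "q \<ge> 1" and U: "finite U" "card U \<le> N" "N \<ge> 1" "real N ^ h \<le> q" and hB: "h \<ge> 1" "B \<ge> 1"
  shows "(\<Sum>k\<in>sol I c V m. \<Prod>v\<in>k ` I - U. p v) \<le> sconst h B * q ^ h"
proof -
  let ?Q = "2 ^ h * wconst h B * q ^ h"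
  have w: "wconst h B \<ge> 1" using hB by (rule wconst_ge_1)
  have "(\<Sum>k\<in>sol I c V m. \<Prod>v\<in>k ` I - U. p v) \<le> real (1 + h\<^sup>2) ^ card I * ?Q"
  proof (rule sum_sol_le_of_inj[where f = "\<lambda>S. \<Prod>v\<in>S - U. p v" and B = B])
    show "0 \<le> (\<Prod>v\<in>S - U. p v)" if "S \<subseteq> V" for S using that p by (intro prod_nonneg) auto
    fix I :: "'a set" and c :: "'a \<Rightarrow> nat"
    assume I: "finite I" "I \<noteq> {}" "card I \<le> h" "\<And>i. i \<in> I \<Longrightarrow> 1 \<le> c i" "sum c I \<le> B"
    have cB: "c i \<le> B" if "i \<in> I" for i
      using member_le_sum[of i I c] I that by auto
    have "(\<Sum>k\<in>{k \<in> sol I c V m. inj_on k I}. \<Prod>v\<in>k ` I - U. p v)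
      \<le> (\<Sum>J\<in>Pow I. real (card U) ^ card (I - J) * (wconst h B * q ^ card J))"
    proof (rule sum_inj_le)
      fix J m' assume J: "J \<in> Pow I"
      then have cJ: "card J \<le> h" using I card_mono[of I J] by auto
      show "(\<Sum>k\<in>sol J c V m'. \<Prod>i\<in>J. p (k i)) \<le> wconst h B * q ^ card J"
        using J cJ I cB V p q hB by (intro mu_le_uniform) (auto intro: finite_subset)
    qed (use I V p U in auto)
    also have "\<dots> \<le> (\<Sum>J\<in>Pow I. wconst h B * q ^ h)"
    proof (intro sum_mono)
      fix J assume J: "J \<in> Pow I"
      have le: "card J \<le> card I" using J I by (auto intro: card_mono)
      have "real (card U) ^ card (I - J) * q ^ card J \<le> q ^ h"
      proof (cases "J = I")
        case True
        then show ?thesis using I q by (auto intro: power_increasing)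
      next
        case False
        then have lt: "card J < card I" using J I by (intro psubset_card_mono) auto
        have "real (card U) ^ card (I - J) \<le> real N ^ card (I - J)" using U by (intro power_mono)
            auto
        also have "\<dots> \<le> real N ^ h" using U I card_mono[of I "I - J"] by (intro power_increasing)
            auto
        also have "\<dots> \<le> q" by (rule U)
        finally have "real (card U) ^ card (I - J) * q ^ card J \<le> q * q ^ card J"
          using q by (intro mult_right_mono) auto
        also have "\<dots> = q ^ Suc (card J)" by simp
        also have "\<dots> \<le> q ^ h" using lt I q by (intro power_increasing) auto
        finally show ?thesis .
      qed
      then show "real (card U) ^ card (I - J) * (wconst h B * q ^ card J) \<le> wconst h B * q ^ h"
        using w mult_left_mono[of "real (card U) ^ card (I - J) * q ^ card J" "q ^ h" "wconst h B"]
        by (simp add: mult_ac)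
    qed
    also have "\<dots> = 2 ^ card I * (wconst h B * q ^ h)" using I by (simp add: card_Pow)
    also have "\<dots> \<le> 2 ^ h * (wconst h B * q ^ h)"
      using I w q by (intro mult_right_mono power_increasing) auto
    finally show "(\<Sum>k\<in>{k \<in> sol I c V m. inj_on k I}. \<Prod>v\<in>k ` I - U. p v) \<le> ?Q" by (simp add: mult_ac)
  qed (use I V w q in auto)
  also have "\<dots> \<le> real (1 + h\<^sup>2) ^ h * ?Q"
    using I w q by (intro mult_right_mono power_increasing mult_nonneg_nonneg) auto
  finally show ?thesis by (simp add: sconst_def mult_ac)
qed

text \<open>The counterpart with nothing exposed, which keeps the decay in \<open>m\<close>. The
  exponent contains an upper bound \<open>l\<close> for \<open>card I\<close>, since merging reduces
  the number of unknowns.\<close>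

lemma sum_weights_le:
  fixes p :: "nat \<Rightarrow> real"
  assumes I: "finite I" "I \<noteq> {}" "card I \<le> l" "\<And>i. i \<in> I \<Longrightarrow> 1 \<le> c i" "sum c I \<le> B" and l: "l \<le> h"
    and V: "finite V" "0 \<notin> V" and p: "\<And>v. v \<in> V \<Longrightarrow> 0 \<le> p v \<and> p v \<le> q * real v powr (1 / real h - 1)"
    and q: "q \<ge> 1" and m: "m \<ge> 1" and hB: "h \<ge> 1" "B \<ge> 1"
  shows "(\<Sum>k\<in>sol I c V m. \<Prod>v\<in>k ` I. p v) \<le> sconst h B * q ^ h * real m powr (real l / real h - 1)"
proof -
  let ?M = "real m powr (real l / real h - 1)"
  let ?Q = "wconst h B * q ^ h * ?M"
  have w: "wconst h B \<ge> 1" using hB by (rule wconst_ge_1)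
  have Q0: "0 \<le> ?Q" using w q by simp
  have "(\<Sum>k\<in>sol I c V m. \<Prod>v\<in>k ` I. p v) \<le> real (1 + l\<^sup>2) ^ card I * ?Q"
  proof (rule sum_sol_le_of_inj[where f = "\<lambda>S. \<Prod>v\<in>S. p v" and B = B])
    show "0 \<le> (\<Prod>v\<in>S. p v)" if "S \<subseteq> V" for S using that p by (intro prod_nonneg) auto
    fix I :: "'a set" and c :: "'a \<Rightarrow> nat"
    assume I: "finite I" "I \<noteq> {}" "card I \<le> l" "\<And>i. i \<in> I \<Longrightarrow> 1 \<le> c i" "sum c I \<le> B"
    have cB: "c i \<le> B" if "i \<in> I" for i
      using member_le_sum[of i I c] I that by auto
    have "(\<Sum>k\<in>{k \<in> sol I c V m. inj_on k I}. \<Prod>v\<in>k ` I. p v)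
      = (\<Sum>k\<in>{k \<in> sol I c V m. inj_on k I}. \<Prod>i\<in>I. p (k i))"
      by (intro sum.cong) (auto simp: prod.reindex)
    also have "\<dots> \<le> (\<Sum>k\<in>sol I c V m. \<Prod>i\<in>I. p (k i))"
    proof (intro sum_mono2 prod_nonneg)
      fix k i assume "k \<in> sol I c V m - {k \<in> sol I c V m. inj_on k I}" "i \<in> I"
      then have "k i \<in> V" using sol_image by blast
      then show "0 \<le> p (k i)" using p by auto
    qed (use I V in auto)
    also have "\<dots> \<le> wconst h B * q ^ card I * real m powr (real (card I) / real h - 1)"
      by (rule mu_le) (use I l cB V p m q in auto)
    also have "\<dots> \<le> ?Q"
      using I l w q m hB by (intro mult_mono power_increasing powr_mono mult_nonneg_nonneg) (auto
          simp: divide_right_mono)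
    finally show "(\<Sum>k\<in>{k \<in> sol I c V m. inj_on k I}. \<Prod>v\<in>k ` I. p v) \<le> ?Q" .
  qed (use I V Q0 in auto)
  also have "\<dots> \<le> real (1 + h\<^sup>2) ^ h * ?Q"
  proof (intro mult_right_mono Q0)
    have "real (1 + l\<^sup>2) ^ card I \<le> real (1 + h\<^sup>2) ^ card I" using l by (intro power_mono) (auto
        simp: power_mono)
    also have "\<dots> \<le> real (1 + h\<^sup>2) ^ h" using I l by (intro power_increasing) auto
    finally show "real (1 + l\<^sup>2) ^ card I \<le> real (1 + h\<^sup>2) ^ h" .
  qed
  also have "\<dots> \<le> real (1 + h\<^sup>2) ^ h * (2 ^ h * ?Q)"
    using Q0 by (intro mult_left_mono) (auto simp: mult_le_cancel_right1)
  finally show ?thesis by (simp add: sconst_def mult_ac)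
qed

text \<open>The slack \<open>w\<close> stands for the contribution of small entries that were
  removed from the equation; it is one-sided because this contribution is nonnegative.\<close>

definition win :: "'i set \<Rightarrow> ('i \<Rightarrow> nat) \<Rightarrow> nat set \<Rightarrow> nat \<Rightarrow> nat \<Rightarrow> ('i \<Rightarrow> nat) set" where
  "win I c V w m = {k \<in> I \<rightarrow>\<^sub>E V. (\<Sum>i\<in>I. c i * k i) \<le> m \<and> m \<le> (\<Sum>i\<in>I. c i * k i) + w}"

lemma win_zero: "win I c V 0 m = sol I c V m"
  by (auto simp: win_def sol_def)

lemma win_eq_UN: "win I c V w m = (\<Union>m'\<in>{m - w..m}. sol I c V m')"
  by (auto simp: win_def sol_def)

lemma win_image: "k \<in> win I c V w m \<Longrightarrow> k ` I \<subseteq> V"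
  by (auto simp: win_def PiE_def)

lemma finite_win [simp]: "finite I \<Longrightarrow> finite V \<Longrightarrow> finite (win I c V w m)"
  unfolding win_eq_UN by auto

lemma win_mono: "V \<subseteq> V' \<Longrightarrow> w \<le> w' \<Longrightarrow> win I c V w m \<subseteq> win I c V' w' m"
  unfolding win_def by (auto simp: PiE_iff)

text \<open>With fewer than \<open>h\<close> unknowns the weight of a target \<open>m'\<close> is at
  most of order \<open>m' powr (- 1 / h)\<close>, up to \<open>q ^ h\<close>. Entries of size at
  least \<open>T\<close> force \<open>m' \<ge> T\<close>, and there are at most \<open>w + 1\<close>
  targets.\<close>

lemma sum_window_weights_le:
  fixes p :: "nat \<Rightarrow> real"
  assumes I: "finite I" "I \<noteq> {}" "card I < h" "\<And>i. i \<in> I \<Longrightarrow> 1 \<le> c i" "sum c I \<le> B"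
    and V: "finite V" "\<And>v. v \<in> V \<Longrightarrow> v \<ge> T" "T \<ge> 1"
    and p: "\<And>v. v \<in> V \<Longrightarrow> 0 \<le> p v \<and> p v \<le> q * real v powr (1 / real h - 1)"
    and q: "q \<ge> 1" and hB: "h \<ge> 1" "B \<ge> 1"
  shows "(\<Sum>k\<in>win I c V w m. \<Prod>v\<in>k ` I. p v) \<le> real (w + 1) * (sconst h B * q ^ h * real T powr (- 1
      / real h))"
proof -
  have s: "sconst h B \<ge> 1" using hB by (rule sconst_ge_1)
  let ?X = "sconst h B * q ^ h * real T powr (- 1 / real h)"
  have X0: "?X \<ge> 0" using s q by simp
  have "(\<Sum>k\<in>win I c V w m. \<Prod>v\<in>k ` I. p v) = (\<Sum>m'\<in>{m - w..m}. \<Sum>k\<in>sol I c V m'. \<Prod>v\<in>k ` I. p v)"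
    unfolding win_eq_UN
  proof (intro sum.UNION_disjoint)
    show "\<forall>m'\<in>{m - w..m}. finite (sol I c V m')" using I V by simp
  qed (auto simp: sol_def)
  also have "\<dots> \<le> (\<Sum>m'\<in>{m - w..m}. ?X)"
  proof (intro sum_mono)
    fix m'
    show "(\<Sum>k\<in>sol I c V m'. \<Prod>v\<in>k ` I. p v) \<le> ?X"
    proof (cases "sol I c V m' = {}")
      case True
      then show ?thesis using X0 by simp
    next
      case False
      then obtain k where k: "k \<in> sol I c V m'" by auto
      obtain i where i: "i \<in> I" using I by auto
      have Tm: "T \<le> m'" using sol_le[OF k I(1) i I(4)[OF i]] sol_image[OF k] V(2) i
        by (meson image_subset_iff le_trans)
      have "(\<Sum>k\<in>sol I c V m'. \<Prod>v\<in>k ` I. p v) \<le> sconst h B * q ^ h * real m' powr (real (h - 1) /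
          real h - 1)"
        by (rule sum_weights_le) (use I V p q hB Tm in auto)
      also have "real (h - 1) / real h - 1 = - 1 / real h" using hB by (simp add: of_nat_diff
          field_simps)
      also have "real m' powr (- 1 / real h) \<le> real T powr (- 1 / real h)"
        using Tm V(3) hB by (intro powr_mono2') auto
      finally show ?thesis using s q by (simp add: mult_left_mono)
    qed
  qed
  also have "\<dots> = real (card {m - w..m}) * ?X" by simp
  also have "\<dots> \<le> real (w + 1) * ?X" using X0 by (intro mult_right_mono) auto
  finally show ?thesis .
qed

lemma card_hits_fixed_le:
  assumes I: "finite I" "i \<in> I" and V: "finite V"
  shows "card {k \<in> hits (win I c V w m) (\<lambda>k. k ` I) A. k i = v}
    \<le> card (hits (win (I - {i}) c V w (m - c i * v)) (\<lambda>k. k ` (I - {i})) A)"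
proof (rule card_inj_on_le[where f = "\<lambda>k. restrict k (I - {i})"])
  show "inj_on (\<lambda>k. restrict k (I - {i})) {k \<in> hits (win I c V w m) (\<lambda>k. k ` I) A. k i = v}"
  proof (rule inj_onI)
    fix k l assume k: "k \<in> {k \<in> hits (win I c V w m) (\<lambda>k. k ` I) A. k i = v}"
      and l: "l \<in> {k \<in> hits (win I c V w m) (\<lambda>k. k ` I) A. k i = v}"
      and eq: "restrict k (I - {i}) = restrict l (I - {i})"
    have "k j = l j" if "j \<in> I" for j
      using fun_cong[OF eq, of j] that k l by (cases "j = i") auto
    then show "k = l" using k l by (intro PiE_ext[of k I "\<lambda>_. V" l]) (auto simp: hits_def win_def)
  qed
  show "(\<lambda>k. restrict k (I - {i})) ` {k \<in> hits (win I c V w m) (\<lambda>k. k ` I) A. k i = v}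
    \<subseteq> hits (win (I - {i}) c V w (m - c i * v)) (\<lambda>k. k ` (I - {i})) A"
  proof (rule image_subsetI)
    fix k assume k: "k \<in> {k \<in> hits (win I c V w m) (\<lambda>k. k ` I) A. k i = v}"
    have "(\<Sum>j\<in>I. c j * k j) = c i * v + (\<Sum>j\<in>I - {i}. c j * k j)"
      using k I by (subst sum.remove[of I i]) auto
    then have "restrict k (I - {i}) \<in> win (I - {i}) c V w (m - c i * v)"
      using k by (auto simp: hits_def win_def PiE_def)
    then show "restrict k (I - {i}) \<in> hits (win (I - {i}) c V w (m - c i * v)) (\<lambda>k. k ` (I - {i}))
        A"
      using k by (auto simp: hits_def)
  qed
qed (use I V in auto)

text \<open>Without \<open>d\<close> disjoint solutions, some set of at most \<open>d * h\<close>
  values meets every solution. Fixing which position takes which of these values removes one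
  unknown.\<close>

lemma card_hits_step:
  assumes I: "finite I" "I \<noteq> {}" "card I \<le> h" and V: "finite V"
    and no: "\<nexists>L. disj_hits (win I c V w m) (\<lambda>k. k ` I) A L \<and> card L = d"
    and X: "\<And>i v. i \<in> I \<Longrightarrow> card (hits (win (I - {i}) c V w (m - c i * v)) (\<lambda>k. k ` (I - {i})) A) \<le> X"
  shows "card (hits (win I c V w m) (\<lambda>k. k ` I) A) \<le> d * h * h * X"
proof -
  let ?H = "hits (win I c V w m) (\<lambda>k. k ` I) A"
  have "\<exists>W. finite W \<and> card W \<le> d * h \<and> (\<forall>k\<in>?H. k ` I \<inter> W \<noteq> {})"
  proof (rule disj_hits_cover[OF _ _ no])
    fix k assume "k \<in> win I c V w m"
    show "finite (k ` I) \<and> card (k ` I) \<le> h \<and> k ` I \<noteq> {}"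
      using I card_image_le[OF I(1), of k] by auto
  qed (use I V in auto)
  then obtain W where W: "finite W" "card W \<le> d * h" "\<And>k. k \<in> ?H \<Longrightarrow> k ` I \<inter> W \<noteq> {}" by auto
  have "?H \<subseteq> (\<Union>(v, i)\<in>W \<times> I. {k \<in> ?H. k i = v})"
    using W(3) by fastforce
  then have "card ?H \<le> card (\<Union>(v, i)\<in>W \<times> I. {k \<in> ?H. k i = v})"
    using W(1) I V by (intro card_mono) auto
  also have "\<dots> \<le> (\<Sum>(v, i)\<in>W \<times> I. card {k \<in> ?H. k i = v})"
    using W(1) I by (intro order_trans[OF card_UN_le]) (auto simp: case_prod_unfold)
  also have "\<dots> \<le> (\<Sum>(v, i)\<in>W \<times> I. X)"
  proof (intro sum_mono, clarify)
    fix v i assume i: "i \<in> I"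
    show "card {k \<in> ?H. k i = v} \<le> X"
      using card_hits_fixed_le[OF I(1) i V] X[OF i] le_trans by blast
  qed
  also have "\<dots> = card W * card I * X" using W(1) I by (simp add: case_prod_unfold
      card_cartesian_product)
  also have "\<dots> \<le> (d * h) * h * X" using W(2) I by (intro mult_le_mono) auto
  finally show ?thesis by simp
qed

text \<open>The previous step is iterated until no unknown is left, so disjoint families must be
  excluded for all nonempty subsets of the unknowns and all smaller targets.\<close>

lemma card_hits_window_le:
  assumes V: "finite V"
    and no: "\<And>J m'. J \<subseteq> I \<Longrightarrow> J \<noteq> {} \<Longrightarrow> m' \<le> m \<Longrightarrow>
      \<nexists>L. disj_hits (win J c V w m') (\<lambda>k. k ` J) A L \<and> card L = d"
    and I: "finite I" "card I \<le> h"
  shows "card (hits (win I c V w m) (\<lambda>k. k ` I) A) \<le> (d * h * h) ^ card I"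
proof -
  have "card (hits (win J c V w m') (\<lambda>k. k ` J) A) \<le> (d * h * h) ^ card J"
    if "J \<subseteq> I" "m' \<le> m" for J m'
    using that
  proof (induction "card J" arbitrary: J m')
    case 0
    then have J: "J = {}" using I finite_subset by fastforce
    have "hits (win J c V w m') (\<lambda>k. k ` J) A \<subseteq> {\<lambda>_. undefined}"
      by (auto simp: J hits_def win_def)
    then have "card (hits (win J c V w m') (\<lambda>k. k ` J) A) \<le> card {\<lambda>_::'a. undefined :: nat}"
      by (intro card_mono) auto
    then show ?case by (simp add: J)
  next
    case (Suc n)
    have J: "finite J" "J \<noteq> {}" "card J \<le> h"
      using Suc I finite_subset card_mono[of I J] by auto
    have "card (hits (win J c V w m') (\<lambda>k. k ` J) A) \<le> d * h * h * (d * h * h) ^ n"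
    proof (rule card_hits_step[OF J V no])
      fix i v assume i: "i \<in> J"
      have n: "n = card (J - {i})" using Suc.hyps(2) i J by simp
      show "card (hits (win (J - {i}) c V w (m' - c i * v)) (\<lambda>k. k ` (J - {i})) A) \<le> (d * h * h) ^
          n"
        using Suc.hyps(1)[OF n] Suc.prems by (simp add: n[symmetric] le_diff_conv subset_insertI2
            Diff_subset_conv)
    qed (use Suc.prems J in auto)
    then show ?case by (simp add: Suc.hyps(2)[symmetric])
  qed
  then show ?thesis by simp
qed

section \<open>Lower bounds for the number of solutions\<close>

lemma bezout_Gcd:
  fixes b :: "'i \<Rightarrow> nat"
  assumes "finite I"
  shows "\<exists>z :: 'i \<Rightarrow> int. (\<Sum>i\<in>I. int (b i) * z i) = int (Gcd (b ` I))"
  using assms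
proof (induction I)
  case empty
  then show ?case by simp
next
  case (insert x I)
  then obtain z where z: "(\<Sum>i\<in>I. int (b i) * z i) = int (Gcd (b ` I))" by auto
  obtain u v where uv: "u * int (b x) + v * int (Gcd (b ` I)) = gcd (int (b x)) (int (Gcd (b ` I)))"
    using bezout_int by blast
  let ?z = "\<lambda>i. if i = x then u else v * z i"
  have "(\<Sum>i\<in>insert x I. int (b i) * ?z i) = int (b x) * u + (\<Sum>i\<in>I. int (b i) * (v * z i))"
    using insert by (auto intro!: arg_cong2[where f = "(+)"] sum.cong)
  also have "(\<Sum>i\<in>I. int (b i) * (v * z i)) = v * (\<Sum>i\<in>I. int (b i) * z i)"
    by (simp add: sum_distrib_left mult_ac)
  finally have "(\<Sum>i\<in>insert x I. int (b i) * ?z i) = gcd (int (b x)) (int (Gcd (b ` I)))"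
    using uv z by (simp add: mult_ac)
  then show ?case by (intro exI[of _ ?z]) simp
qed

text \<open>Values between \<open>n / R\<close> and \<open>n\<close>, written without
  division.\<close>

definition upper_range :: "nat \<Rightarrow> nat \<Rightarrow> nat set" where
  "upper_range R n = {v. n \<le> R * v \<and> v \<le> n}"

lemma finite_upper_range [simp]: "finite (upper_range R n)"
  by (rule finite_subset[of _ "{..n}"]) (auto simp: upper_range_def)

lemma upper_range_subset:
  assumes "n \<ge> 1"
  shows "upper_range R n \<subseteq> {1..n}"
proof
  fix v assume "v \<in> upper_range R n"
  then show "v \<in> {1..n}" using assms by (cases "v = 0") (auto simp: upper_range_def)
qed

lemma card_upper_range: "n \<ge> 1 \<Longrightarrow> card (upper_range R n) \<le> n"
  using card_mono[OF _ upper_range_subset[of n R]] by simp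

text \<open>A solution with all entries close to \<open>n / B\<close> comes from division by
  \<open>B\<close> and a Bezout identity. It is then shifted along the lattice of solutions of the
  homogeneous equation, with \<open>card I - 1\<close> free parameters below
  \<open>n div R\<close>.\<close>

lemma many_solutions:
  fixes b :: "'i \<Rightarrow> nat"
  assumes I: "finite I" "I \<noteq> {}" and b: "\<And>i. i \<in> I \<Longrightarrow> b i \<ge> 1" and gcd: "Gcd (b ` I) = 1"
  shows "\<exists>R n0. R \<ge> 1 \<and> (\<forall>n\<ge>n0. (n div R) ^ (card I - 1) \<le> card (sol I b (upper_range R n) n))"
proof -
  obtain z where z: "(\<Sum>i\<in>I. int (b i) * z i) = 1"
    using bezout_Gcd[OF I(1), of b] gcd by auto
  obtain i0 where i0: "i0 \<in> I" using I by auto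
  define B where "B = sum b I"
  have bB: "b i \<le> B" if "i \<in> I" for i
    unfolding B_def using member_le_sum[of i I b] I that by auto
  have B1: "B \<ge> 1" using b[OF i0] bB[OF i0] by simp
  define Z where "Z = (\<Sum>i\<in>I. \<bar>z i\<bar>)"
  have zZ: "\<bar>z i\<bar> \<le> Z" if "i \<in> I" for i
    unfolding Z_def using member_le_sum[of i I "\<lambda>i. \<bar>z i\<bar>"] I that by auto
  have Z0: "Z \<ge> 0" unfolding Z_def by (intro sum_nonneg) auto
  \<comment> \<open>Starting from about \<open>n / B\<close>, the shifts cost an entry at most
    \<open>n / (4 * B)\<close>, and the Bezout correction with the rounding costs as much again once
    \<open>n \<ge> n0\<close>; what remains is at least \<open>n / (2 * B)\<close>.\<close>
  define R where "R = 4 * B * B"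
  have R1: "R \<ge> 1" using B1 by (simp add: R_def)
  define n0 where "n0 = nat (4 * int B * (1 + int B * Z))"
  have "(n div R) ^ (card I - 1) \<le> card (sol I b (upper_range R n) n)" if n: "n \<ge> n0" for n
  proof -
    define L where "L = n div R"
    define qq s where "qq = n div B" and "s = n mod B"
    have s: "int s < int B" "0 \<le> int s" using B1 by (auto simp: s_def)
    have nqs: "int n = int B * int qq + int s" by (simp add: qq_def s_def flip: of_nat_mult
        of_nat_add)
    have RL: "int R * int L \<le> int n" unfolding L_def by (simp flip: of_nat_mult)
    have n0': "4 * int B * (1 + int B * Z) \<le> int n" using n Z0 by (simp add: n0_def)
    \<comment> \<open>Raising entry \<open>i\<close> by \<open>b i0 * u i\<close> is compensated by
      lowering entry \<open>i0\<close> by \<open>b i * u i\<close>.\<close>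
    define kk where "kk u i = (if i = i0 then int qq + int s * z i0 - (\<Sum>j\<in>I - {i0}. int (b j) * int
        (u j))
        else int qq + int s * z i + int (b i0) * int (u i))" for u :: "'i \<Rightarrow> nat" and i
    have lower: "int n \<le> int R * kk u i" if u: "u \<in> (I - {i0}) \<rightarrow>\<^sub>E {..<L}" and i: "i \<in> I" for u i
    proof -
      have "\<bar>int s * z i\<bar> \<le> int B * Z"
        unfolding abs_mult using s zZ[OF i] by (intro mult_mono) auto
      then have sz: "- (int B * Z) \<le> int s * z i" by linarith
      have "(\<Sum>j\<in>I - {i0}. int (b j) * int (u j)) \<le> (\<Sum>j\<in>I - {i0}. int (b j) * int L)"
        using PiE_mem[OF u] by (intro sum_mono mult_left_mono) (auto intro: less_imp_le)
      also have "\<dots> \<le> (\<Sum>j\<in>I. int (b j) * int L)" using I by (intro sum_mono2) auto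
      also have "\<dots> = int B * int L" by (simp add: B_def sum_distrib_right)
      finally have su: "(\<Sum>j\<in>I - {i0}. int (b j) * int (u j)) \<le> int B * int L" .
      have "kk u i \<ge> int qq - int B * Z - int B * int L"
      proof (cases "i = i0")
        case True
        then show ?thesis using su sz by (simp add: kk_def)
      next
        case False
        have "0 \<le> int (b i0) * int (u i)" "0 \<le> int B * int L" by simp_all
        moreover have "kk u i = int qq + int s * z i + int (b i0) * int (u i)" using False by (simp
            add: kk_def)
        ultimately show ?thesis using sz by linarith
      qed
      then have "int R * kk u i \<ge> int R * (int qq - int B * Z - int B * int L)"
        by (intro mult_left_mono) auto
      moreover have "int R * (int qq - int B * Z - int B * int L)
          = 4 * int B * (int B * int qq) - int B * (4 * int B * (int B * Z)) - int B * (int R * int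
              L)"
        by (simp add: R_def algebra_simps)
      moreover have "int B * int qq > int n - int B" using nqs s by linarith
      then have "4 * int B * (int B * int qq) \<ge> 4 * int B * (int n - int B)"
        by (intro mult_left_mono) auto
      moreover have "int B * (int R * int L) \<le> int B * int n" using RL by (intro mult_left_mono)
          auto
      moreover have "4 * int B * (int B * Z) \<le> int n - 4 * int B" using n0' by (simp add:
          algebra_simps)
      then have "int B * (4 * int B * (int B * Z)) \<le> int B * (int n - 4 * int B)"
        by (intro mult_left_mono) auto
      ultimately have "int R * kk u i \<ge> 4 * int B * (int n - int B) - int B * (int n - 4 * int B) -
          int B * int n"
        by linarith
      then have "int R * kk u i \<ge> 2 * (int B * int n)" by (simp add: algebra_simps)
      moreover have "int n \<le> int B * int n" using B1 mult_right_mono[of 1 "int B" "int n"] by simp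
      ultimately show ?thesis by linarith
    qed
    have kk0: "kk u i \<ge> 0" if u: "u \<in> (I - {i0}) \<rightarrow>\<^sub>E {..<L}" and i: "i \<in> I" for u i
    proof -
      have "0 \<le> int R * kk u i" using lower[OF that] by linarith
      then show ?thesis using R1 by (simp add: zero_le_mult_iff)
    qed
    have total: "(\<Sum>i\<in>I. int (b i) * kk u i) = int n" for u
    proof -
      have "(\<Sum>i\<in>I. int (b i) * kk u i) = int (b i0) * kk u i0 + (\<Sum>i\<in>I - {i0}. int (b i) * kk u i)"
        using I i0 by (intro sum.remove) auto
      also have "(\<Sum>i\<in>I - {i0}. int (b i) * kk u i)
         = (\<Sum>i\<in>I - {i0}. int (b i) * (int qq + int s * z i)) + int (b i0) * (\<Sum>i\<in>I - {i0}. int (b i)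
             * int (u i))"
        unfolding sum_distrib_left sum.distrib[symmetric]
        by (intro sum.cong) (auto simp: kk_def algebra_simps)
      also have "int (b i0) * kk u i0 + \<dots> = int (b i0) * (int qq + int s * z i0) + (\<Sum>i\<in>I - {i0}.
          int (b i) * (int qq + int s * z i))"
        by (simp add: kk_def algebra_simps)
      also have "\<dots> = (\<Sum>i\<in>I. int (b i) * (int qq + int s * z i))"
        using I i0 by (intro sum.remove[symmetric]) auto
      also have "\<dots> = int qq * (\<Sum>i\<in>I. int (b i)) + int s * (\<Sum>i\<in>I. int (b i) * z i)"
        unfolding sum_distrib_left sum.distrib[symmetric] by (intro sum.cong) (auto simp:
            algebra_simps)
      also have "\<dots> = int n" using z nqs by (simp add: B_def mult.commute)
      finally show ?thesis .
    qed
    define \<phi> where "\<phi> u = restrict (\<lambda>i. nat (kk u i)) I" for u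
    have "card ((I - {i0}) \<rightarrow>\<^sub>E {..<L}) \<le> card (sol I b (upper_range R n) n)"
    proof (rule card_inj_on_le[where f = \<phi>])
      show "inj_on \<phi> ((I - {i0}) \<rightarrow>\<^sub>E {..<L})"
      proof (rule inj_onI)
        fix u v assume u: "u \<in> (I - {i0}) \<rightarrow>\<^sub>E {..<L}" and v: "v \<in> (I - {i0}) \<rightarrow>\<^sub>E {..<L}" and eq: "\<phi>
            u = \<phi> v"
        have "u i = v i" if i: "i \<in> I - {i0}" for i
        proof -
          have "nat (kk u i) = nat (kk v i)" using fun_cong[OF eq, of i] i by (simp add: \<phi>_def)
          then have "kk u i = kk v i" using kk0[OF u] kk0[OF v] i by (simp add: eq_nat_nat_iff)
          then show ?thesis using i b[OF i0] by (auto simp: kk_def)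
        qed
        then show "u = v" by (intro PiE_ext[OF u v]) auto
      qed
      show "\<phi> ` ((I - {i0}) \<rightarrow>\<^sub>E {..<L}) \<subseteq> sol I b (upper_range R n) n"
      proof (rule image_subsetI)
        fix u assume u: "u \<in> (I - {i0}) \<rightarrow>\<^sub>E {..<L}"
        have "int (\<Sum>i\<in>I. b i * \<phi> u i) = (\<Sum>i\<in>I. int (b i) * kk u i)"
          using kk0[OF u] by (auto simp: \<phi>_def intro!: sum.cong)
        then have sumn: "(\<Sum>i\<in>I. b i * \<phi> u i) = n" using total[of u] by linarith
        have "\<phi> u i \<in> upper_range R n" if i: "i \<in> I" for i
        proof -
          have "int n \<le> int (R * \<phi> u i)" using lower[OF u i] kk0[OF u i] i by (simp add: \<phi>_def)
          then have "n \<le> R * \<phi> u i" by linarith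
          moreover have "\<phi> u i \<le> b i * \<phi> u i" using b[OF i] by simp
          moreover have "b i * \<phi> u i \<le> (\<Sum>i\<in>I. b i * \<phi> u i)"
            using I i by (intro member_le_sum) auto
          ultimately have "n \<le> R * \<phi> u i" "\<phi> u i \<le> n" using sumn by linarith+
          then show ?thesis by (simp add: upper_range_def)
        qed
        then show "\<phi> u \<in> sol I b (upper_range R n) n"
          using sumn by (auto simp: sol_def \<phi>_def)
      qed
    qed (use I in auto)
    also have "card ((I - {i0}) \<rightarrow>\<^sub>E {..<L}) = L ^ (card I - 1)" using I i0 by (simp add: card_PiE)
    finally show ?thesis by (simp add: L_def)
  qed
  then show ?thesis using R1 by blast
qed

text \<open>A solution with a repeated entry solves an equation in one unknown fewer, so there are
  only O(n^(h-2)) of these.\<close>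

lemma many_injective_solutions:
  fixes b :: "'i \<Rightarrow> nat"
  assumes I: "finite I" "card I \<ge> 2" and b: "\<And>i. i \<in> I \<Longrightarrow> b i \<ge> 1" and gcd: "Gcd (b ` I) = 1"
  shows "\<exists>R c n0. R \<ge> 1 \<and> c > 0 \<and>
    (\<forall>n\<ge>n0. c * real n ^ (card I - 1) \<le> real (card {k \<in> sol I b (upper_range R n) n. inj_on k I}))"
proof -
  define h where "h = card I"
  have I0: "I \<noteq> {}" using I by auto
  obtain R n0 where R: "R \<ge> 1" and n0: "\<And>n. n \<ge> n0 \<Longrightarrow> (n div R) ^ (h - 1) \<le> card (sol I b
      (upper_range R n) n)"
    using many_solutions[OF I(1) I0 b gcd] unfolding h_def by auto
  \<comment> \<open>For \<open>n \<ge> 2 * R\<close> one has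
    \<open>n div R \<ge> n / (2 * R)\<close>. The additional factor 2 leaves half of the solutions
    to pay for the non-injective ones.\<close>
  define c where "c = 1 / (2 * (2 * real R) ^ (h - 1))"
  have c: "c > 0" using R by (simp add: c_def)
  define n1 where "n1 = max (max n0 (2 * R)) (2 * h\<^sup>2 * (2 * R) ^ (h - 1))"
  have "c * real n ^ (h - 1) \<le> real (card {k \<in> sol I b (upper_range R n) n. inj_on k I})" if n: "n
      \<ge> n1" for n
  proof -
    let ?V = "upper_range R n" and ?P = "{(i, j). i \<in> I \<and> j \<in> I \<and> i \<noteq> j}"
    have nn: "n \<ge> n0" "n \<ge> 2 * R" "n \<ge> 2 * h\<^sup>2 * (2 * R) ^ (h - 1)" using n by (auto simp: n1_def)
    have n1: "n \<ge> 1" using nn(2) R by simp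
    have cV: "card ?V \<le> n" using n1 by (rule card_upper_range)
    have cP: "card ?P \<le> h\<^sup>2"
    proof -
      have "card ?P \<le> card (I \<times> I)" using I by (intro card_mono) auto
      then show ?thesis by (simp add: card_cartesian_product power2_eq_square h_def)
    qed
    have "real (card (sol I b ?V n)) = (\<Sum>k\<in>sol I b ?V n. 1)" by simp
    also have "\<dots> \<le> (\<Sum>k\<in>{k \<in> sol I b ?V n. inj_on k I}. 1)
      + (\<Sum>(i, j)\<in>?P. \<Sum>k\<in>sol (I - {j}) (b(i := b i + b j)) ?V n. 1)"
      using I by (intro sum_merge_le[where f = "\<lambda>_. 1"]) auto
    also have "(\<Sum>(i, j)\<in>?P. \<Sum>k\<in>sol (I - {j}) (b(i := b i + b j)) ?V n. 1 :: real) \<le> (\<Sum>(i, j)\<in>?P.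
        real n ^ (h - 2))"
    proof (intro sum_mono, clarify)
      fix i j assume ij: "i \<in> I" "j \<in> I" "i \<noteq> j"
      have "1 \<le> (b(i := b i + b j)) x" if "x \<in> I - {j}" for x using b[of x] that by auto
      then have "card (sol (I - {j}) (b(i := b i + b j)) ?V n) \<le> card ?V ^ (card (I - {j}) - 1)"
        using I ij by (intro card_sol_le) auto
      also have "\<dots> \<le> n ^ (card (I - {j}) - 1)" using cV by (rule power_mono) auto
      also have "card (I - {j}) - 1 = h - 2" using I ij by (simp add: h_def)
      finally have "real (card (sol (I - {j}) (b(i := b i + b j)) ?V n)) \<le> real (n ^ (h - 2))"
        by (simp only: of_nat_le_iff)
      then show "(\<Sum>k\<in>sol (I - {j}) (b(i := b i + b j)) ?V n. 1 :: real) \<le> real n ^ (h - 2)" by simp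
    qed
    also have "\<dots> = real (card ?P) * real n ^ (h - 2)" by (simp add: case_prod_unfold)
    also have "\<dots> \<le> real (h\<^sup>2) * real n ^ (h - 2)" using cP by (intro mult_right_mono) (simp_all
        only: of_nat_le_iff zero_le_power of_nat_0_le_iff)
    finally have *: "real (card (sol I b ?V n)) \<le> real (card {k \<in> sol I b ?V n. inj_on k I}) + real
        (h\<^sup>2) * real n ^ (h - 2)"
      by simp
    have "real n / (2 * real R) \<le> real (n div R)"
    proof -
      have "real (n div R) = of_int \<lfloor>real n / real R\<rfloor>" by (simp add: floor_divide_of_nat_eq)
      then have "real n / real R - 1 \<le> real (n div R)" by linarith
      moreover have "1 \<le> real n / (2 * real R)" using nn(2) R by (simp add: field_simps flip:
          of_nat_mult)
      moreover have "real n / real R = real n / (2 * real R) + real n / (2 * real R)" by (simp add: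
          field_simps)
      ultimately show ?thesis by linarith
    qed
    then have "(real n / (2 * real R)) ^ (h - 1) \<le> real (n div R) ^ (h - 1)" by (intro power_mono)
        auto
    also have "\<dots> \<le> real (card (sol I b ?V n))" using n0[OF nn(1)] by (metis of_nat_le_iff
        of_nat_power)
    finally have 1: "2 * (c * real n ^ (h - 1)) \<le> real (card (sol I b ?V n))"
      by (simp add: c_def power_divide)
    have hh: "h - 1 = Suc (h - 2)" using I by (simp add: h_def)
    have "real (h\<^sup>2) * real n ^ (h - 2) \<le> c * real n ^ (h - 1)"
    proof -
      have "real (2 * h\<^sup>2 * (2 * R) ^ (h - 1)) \<le> real n" using nn(3) by (simp only: of_nat_le_iff)
      then have "real (h\<^sup>2) \<le> c * real n" using R by (simp add: c_def field_simps)
      then have "real (h\<^sup>2) * real n ^ (h - 2) \<le> c * real n * real n ^ (h - 2)" by (intro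
          mult_right_mono) auto
      also have "\<dots> = c * real n ^ (h - 1)" unfolding hh by simp
      finally show ?thesis .
    qed
    with 1 * show ?thesis by linarith
  qed
  then show ?thesis using R c unfolding h_def by blast
qed

text \<open>Janson's inequality where all relevant probabilities are comparable to \<open>P\<close>,
  so that the mean has order Y = n^(h-1) P^h. Solutions sharing an entry with a given one have total
  conditional weight O(Y / G): if j >= 1 entries are new, with j < h, the weight is of order n^(j-1)
  P^j <= Y / (n P), and if none is new it is bounded, which explains both terms of the minimum
  \<open>G\<close>. The exponent is then of order \<open>G\<close>.\<close>

lemma solution_lower_tail:
  fixes b :: "'i \<Rightarrow> nat" and p :: "nat \<Rightarrow> real"
  assumes I: "finite I" "card I = h" "h \<ge> 2" and b: "\<And>i. i \<in> I \<Longrightarrow> b i \<ge> 1"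
    and V: "finite V" "upper_range R n \<subseteq> V" "\<And>v. v \<in> V \<Longrightarrow> 0 \<le> p v \<and> p v \<le> 1"
    and n: "n \<ge> 1" and P: "0 < P" "1 \<le> real n * P"
    and pP: "\<And>v. v \<in> upper_range R n \<Longrightarrow> c1 * P \<le> p v \<and> p v \<le> c2 * P"
    and c: "0 < c" "0 < c1" "1 \<le> c2"
    and many: "c * real n ^ (h - 1) \<le> real (card {k \<in> sol I b (upper_range R n) n. inj_on k I})"
    and G: "G = min (real n * P) (real n ^ (h - 1) * P ^ h)"
  shows "bprob V p (\<lambda>S. real (card (hits {k \<in> sol I b (upper_range R n) n. inj_on k I} (\<lambda>k. k ` I)
      S))
      \<le> c * c1 ^ h / 2 * (real n ^ (h - 1) * P ^ h))
    \<le> exp (- (c * c1 ^ h / (8 * ((2 * real h * c2) ^ h)) * G))"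
proof -
  let ?W = "upper_range R n" and ?R = "\<lambda>k. k ` I"
  define K where "K = {k \<in> sol I b ?W n. inj_on k I}"
  define Y where "Y = real n ^ (h - 1) * P ^ h"
  define \<mu> where "\<mu> = (\<Sum>k\<in>K. \<Prod>v\<in>?R k. p v)"
  define C where "C = (2 * real h * c2) ^ h"
  have Y0: "Y > 0" using n P by (simp add: Y_def)
  have G0: "G > 0" "G \<le> real n * P" "G \<le> Y" using G n P Y0 by (auto simp: Y_def)
  have C0: "C > 0" using c I by (simp add: C_def)
  have fK: "finite K" using I by (simp add: K_def)
  have KV: "?R k \<subseteq> ?W" if "k \<in> K" for k using that sol_image[of k I b ?W n] by (simp add: K_def)
  have \<mu>Y: "c * c1 ^ h * Y \<le> \<mu>"
  proof -
    have "c * c1 ^ h * Y = c * real n ^ (h - 1) * (c1 * P) ^ h" by (simp add: Y_def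
        power_mult_distrib)
    also have "\<dots> \<le> real (card K) * (c1 * P) ^ h"
      using many c P by (intro mult_right_mono) (auto simp: K_def)
    also have "\<dots> = (\<Sum>k\<in>K. (c1 * P) ^ h)" by simp
    also have "\<dots> \<le> \<mu>"
      unfolding \<mu>_def
    proof (intro sum_mono)
      fix k assume k: "k \<in> K"
      have "(c1 * P) ^ h = (\<Prod>v\<in>?R k. c1 * P)" using k I by (simp add: K_def card_image)
      also have "\<dots> \<le> (\<Prod>v\<in>?R k. p v)" using KV[OF k] pP c P by (intro prod_mono) auto
      finally show "(c1 * P) ^ h \<le> (\<Prod>v\<in>?R k. p v)" .
    qed
    finally show ?thesis .
  qed
  have \<mu>0: "\<mu> > 0"
  proof -
    have "0 < c * c1 ^ h * Y" using c Y0 by simp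
    then show ?thesis using \<mu>Y by linarith
  qed
  have E: "(\<Sum>l\<in>{l\<in>K. ?R k \<inter> ?R l \<noteq> {}}. \<Prod>v\<in>?R l - ?R k. p v) \<le> C * Y / G" if k: "k \<in> K" for k
  proof -
    let ?U = "?R k" and ?\<J> = "Pow I - {I}"
    have cU: "card ?U = h" using k I by (simp add: K_def card_image)
    have "(\<Sum>l\<in>{l\<in>K. ?R k \<inter> ?R l \<noteq> {}}. \<Prod>v\<in>?R l - ?U. p v)
      \<le> (\<Sum>J\<in>?\<J>. real (card ?U) ^ card (I - J) * (c2 ^ h * (Y / G)))"
    proof (rule sum_inj_le)
      fix J m' assume J: "J \<in> ?\<J>"
      then have fJ: "finite J" "card J < h" "J \<subseteq> I"
        using I finite_subset psubset_card_mono[of I J] by auto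
      show "(\<Sum>l\<in>sol J b ?W m'. \<Prod>i\<in>J. p (l i)) \<le> c2 ^ h * (Y / G)"
      proof (cases "J = {}")
        case True
        have "1 \<le> c2 ^ h" "1 \<le> Y / G" using c G0 by (auto intro: one_le_power)
        then have "1 \<le> c2 ^ h * (Y / G)" by (rule mult_ge1_I)
        then show ?thesis using True by (simp add: sol_empty)
      next
        case False
        have j1: "card J \<ge> 1" using False fJ by (simp add: Suc_le_eq card_gt_0_iff)
        have cW: "card ?W \<le> n" using n by (rule card_upper_range)
        have "card (sol J b ?W m') \<le> card ?W ^ (card J - 1)"
          using False fJ b by (intro card_sol_le) auto
        also have "\<dots> \<le> n ^ (card J - 1)" using cW by (intro power_mono) auto
        finally have cs: "real (card (sol J b ?W m')) \<le> real n ^ (card J - 1)"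
          by (metis of_nat_le_iff of_nat_power)
        have "(\<Sum>l\<in>sol J b ?W m'. \<Prod>i\<in>J. p (l i)) \<le> (\<Sum>l\<in>sol J b ?W m'. \<Prod>i\<in>J. c2 * P)"
        proof (intro sum_mono prod_mono)
          fix l i assume "l \<in> sol J b ?W m'" "i \<in> J"
          then have "l i \<in> ?W" using sol_image by blast
          then show "0 \<le> p (l i) \<and> p (l i) \<le> c2 * P" using pP V by blast
        qed
        also have "\<dots> = real (card (sol J b ?W m')) * (c2 * P) ^ card J" by simp
        also have "\<dots> \<le> real n ^ (card J - 1) * (c2 * P) ^ card J"
          using cs c P by (intro mult_right_mono) auto
        also have "\<dots> = c2 ^ card J * (real n ^ (card J - 1) * P ^ card J)"
          by (simp add: power_mult_distrib)
        also have "\<dots> \<le> c2 ^ h * (Y / G)"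
        proof (intro mult_mono power_increasing)
          \<comment> \<open>\<open>Suc e\<close> is the number of shared positions: one factor
            \<open>n * P\<close> pays for \<open>G\<close>, and the remaining \<open>e\<close> are
            at least 1.\<close>
          obtain e where e: "h = Suc (card J + e)" using fJ(2) less_iff_Suc_add by auto
          have "real n ^ (card J - 1) * P ^ card J * G \<le> real n ^ (card J - 1) * P ^ card J * (real
              n * P)"
            using G0 P by (intro mult_left_mono) auto
          also have "\<dots> \<le> real n ^ (card J - 1) * P ^ card J * (real n * P) * (real n * P) ^ e"
            using P mult_left_mono[OF one_le_power[OF P(2), of e], of "real n ^ (card J - 1) * P ^
                card J * (real n * P)"]
            by simp
          also have "\<dots> = Y"
          proof -
            have "h - 1 = (card J - 1) + 1 + e" using e j1 by simp
            then have 1: "real n ^ (h - 1) = real n ^ (card J - 1) * real n * real n ^ e" by (simp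
                only: power_add power_one_right)
            have 2: "P ^ h = P ^ card J * P * P ^ e" by (simp add: e power_add)
            show ?thesis unfolding Y_def 1 2 by (simp add: power_mult_distrib)
          qed
          finally show "real n ^ (card J - 1) * P ^ card J \<le> Y / G" using G0 by (simp add:
              field_simps)
        qed (use c P fJ in auto)
        finally show ?thesis .
      qed
    next
      fix l assume "l \<in> {l\<in>K. ?R k \<inter> ?R l \<noteq> {}}"
      then obtain y where "y \<in> ?U" "y \<in> ?R l" by auto
      then obtain x where x: "x \<in> I" "l x \<in> ?U" by (metis imageE)
      then have "x \<notin> {i\<in>I. l i \<notin> ?U}" by simp
      then have "{i\<in>I. l i \<notin> ?U} \<noteq> I" using x(1) by metis
      then show "{i\<in>I. l i \<notin> ?U} \<in> ?\<J>" by simp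
    qed (use I V pP k in \<open>auto simp: K_def\<close>)
    also have "\<dots> \<le> (\<Sum>J\<in>?\<J>. real h ^ h * (c2 ^ h * (Y / G)))"
    proof (intro sum_mono mult_right_mono)
      fix J
      have "card (I - J) \<le> h" using I card_mono[of I "I - J"] by auto
      then show "real (card ?U) ^ card (I - J) \<le> real h ^ h" using I by (simp add: cU
          power_increasing)
    qed (use c Y0 G0 in auto)
    also have "\<dots> \<le> (\<Sum>J\<in>Pow I. real h ^ h * (c2 ^ h * (Y / G)))"
      using I c Y0 G0 by (intro sum_mono2) auto
    also have "\<dots> = C * Y / G" using I by (simp add: C_def card_Pow power_mult_distrib)
    finally show ?thesis .
  qed
  have "(\<Sum>k\<in>K. \<Sum>l\<in>{l\<in>K. ?R k \<inter> ?R l \<noteq> {}}. \<Prod>v\<in>?R k \<union> ?R l. p v)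
      = (\<Sum>k\<in>K. (\<Prod>v\<in>?R k. p v) * (\<Sum>l\<in>{l\<in>K. ?R k \<inter> ?R l \<noteq> {}}. \<Prod>v\<in>?R l - ?R k. p v))"
  proof (intro sum.cong refl)
    fix k
    show "(\<Sum>l\<in>{l\<in>K. ?R k \<inter> ?R l \<noteq> {}}. \<Prod>v\<in>?R k \<union> ?R l. p v)
      = (\<Prod>v\<in>?R k. p v) * (\<Sum>l\<in>{l\<in>K. ?R k \<inter> ?R l \<noteq> {}}. \<Prod>v\<in>?R l - ?R k. p v)"
      unfolding sum_distrib_left
    proof (intro sum.cong refl)
      fix l
      have "(\<Prod>v\<in>?R k \<union> (?R l - ?R k). p v) = (\<Prod>v\<in>?R k. p v) * (\<Prod>v\<in>?R l - ?R k. p v)"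
        using I by (intro prod.union_disjoint) auto
      then show "(\<Prod>v\<in>?R k \<union> ?R l. p v) = (\<Prod>v\<in>?R k. p v) * (\<Prod>v\<in>?R l - ?R k. p v)"
        by (simp only: Un_Diff_cancel)
    qed
  qed
  also have "\<dots> \<le> (\<Sum>k\<in>K. (\<Prod>v\<in>?R k. p v) * (C * Y / G))"
  proof (intro sum_mono mult_left_mono E prod_nonneg)
    fix k v assume "k \<in> K" "v \<in> ?R k"
    then show "0 \<le> p v" using KV V by blast
  qed
  also have "\<dots> = \<mu> * (C * Y / G)" unfolding \<mu>_def by (rule sum_distrib_right[symmetric])
  finally have \<Delta>: "(\<Sum>k\<in>K. \<Sum>l\<in>{l\<in>K. ?R k \<inter> ?R l \<noteq> {}}. \<Prod>v\<in>?R k \<union> ?R l. p v) \<le> \<mu> * (C * Y / G)" .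
  have jan: "bprob V p (\<lambda>S. real (card (hits K ?R S)) \<le> \<mu> / 2) \<le> exp (- (\<mu>\<^sup>2 / (8 * (\<mu> * (C * Y /
      G)))))"
  proof (rule janson_inequality[OF V(1) V(3) fK _ \<mu>_def \<Delta>])
    show "?R k \<subseteq> V" if "k \<in> K" for k using KV[OF that] V(2) by blast
    show "0 < \<mu> * (C * Y / G)" using \<mu>0 C0 Y0 G0 by simp
  qed
  have "bprob V p (\<lambda>S. real (card (hits K ?R S)) \<le> c * c1 ^ h / 2 * Y)
     \<le> bprob V p (\<lambda>S. real (card (hits K ?R S)) \<le> \<mu> / 2)"
    using \<mu>Y by (intro bprob_mono V) auto
  also note jan
  also have "exp (- (\<mu>\<^sup>2 / (8 * (\<mu> * (C * Y / G))))) \<le> exp (- (c * c1 ^ h / (8 * C) * G))"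
  proof -
    have "\<mu>\<^sup>2 / (8 * (\<mu> * (C * Y / G))) = \<mu> * G / (8 * C * Y)"
      using \<mu>0 C0 Y0 G0 by (simp add: power2_eq_square field_simps)
    moreover have "c * c1 ^ h * Y * G / (8 * C * Y) \<le> \<mu> * G / (8 * C * Y)"
      using \<mu>Y C0 Y0 G0 by (intro divide_right_mono mult_right_mono) auto
    moreover have "c * c1 ^ h * Y * G / (8 * C * Y) = c * c1 ^ h / (8 * C) * G"
      using Y0 by simp
    ultimately show ?thesis by simp
  qed
  finally show ?thesis by (simp add: K_def Y_def C_def)
qed

section \<open>The random set\<close>

lemma eventually_polylog_le:
  fixes C e :: real
  assumes "e > 0"
  shows "eventually (\<lambda>n::nat. C * ln (real n) ^ k \<le> real n powr e) sequentially"
proof -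
  have "((\<lambda>x::real. C * ln x ^ k / x powr e) \<longlongrightarrow> 0) at_top"
    using assms by real_asymp
  then have "((\<lambda>n. C * ln (real n) ^ k / real n powr e) \<longlongrightarrow> 0) sequentially"
    by (rule filterlim_compose[OF _ filterlim_real_sequentially])
  then have "eventually (\<lambda>n. C * ln (real n) ^ k / real n powr e < 1) sequentially"
    by (rule order_tendstoD) simp
  then show ?thesis using eventually_gt_at_top[of 0]
    by eventually_elim (simp add: field_simps)
qed

text \<open>The growth conditions on \<open>F\<close> as inequalities valid for every
  \<open>x \<ge> 1\<close>, which spares each argument its own threshold.\<close>

locale growth =
  fixes h :: nat and b :: "nat \<Rightarrow> nat" and F :: "real \<Rightarrow> real" and D cL CU :: real
  assumes h2: "h \<ge> 2" and bpos: "\<And>i. i \<in> {1..h} \<Longrightarrow> b i \<ge> 1" and bgcd: "Gcd (b ` {1..h}) = 1"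
    and Fpos: "\<And>x. x \<ge> 1 \<Longrightarrow> F x > 0" and Fmono: "\<And>x y. 1 \<le> x \<Longrightarrow> x \<le> y \<Longrightarrow> F x \<le> F y"
    and Fdoub: "\<And>x. x \<ge> 1 \<Longrightarrow> F (2 * x) \<le> D * F x" and D1: "D \<ge> 1"
    and Flow: "\<And>x. x \<ge> 1 \<Longrightarrow> cL * ln x \<le> F x" and cL: "cL > 0"
    and Fup: "\<And>x. x \<ge> 1 \<Longrightarrow> F x \<le> CU * x ^ (h - 1)" and CU: "CU \<ge> 1"
begin

definition prb :: "real \<Rightarrow> nat \<Rightarrow> real" where
  "prb M v = min 1 (M * F v powr (1 / real h) * real v powr (1 / real h - 1))"

text \<open>The scale with \<open>prb M v \<le> Q M n * v powr (1 / h - 1)\<close> for all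
  \<open>v\<close> from 1 to \<open>n\<close>; its \<open>h\<close>-th power is
  \<open>M ^ h * F n\<close>, the order of the expected number of representations.\<close>

definition Q :: "real \<Rightarrow> nat \<Rightarrow> real" where
  "Q M n = M * F n powr (1 / real h)"

definition B :: nat where "B = sum b {1..h}"

definition reps :: "nat set \<Rightarrow> nat \<Rightarrow> nat set \<Rightarrow> (nat \<Rightarrow> nat) set" where
  "reps I n A = hits (sol I b {1..n} n) (\<lambda>k. k ` I) A"

lemma B1: "B \<ge> 1"
proof -
  have "b 1 \<le> B" unfolding B_def using h2 by (intro member_le_sum) auto
  then show ?thesis using bpos[of 1] h2 by simp
qed

lemma sum_le_B: "I \<subseteq> {1..h} \<Longrightarrow> sum b I \<le> B"
  unfolding B_def by (intro sum_mono2) auto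

lemma prb_range: "M \<ge> 0 \<Longrightarrow> 0 \<le> prb M v \<and> prb M v \<le> 1"
  by (simp add: prb_def)

lemma prb_le_Q:
  assumes "M \<ge> 0" "1 \<le> v" "v \<le> n"
  shows "prb M v \<le> Q M n * real v powr (1 / real h - 1)"
proof -
  have "F v powr (1 / real h) \<le> F n powr (1 / real h)"
    using assms Fpos[of "real v"] by (intro powr_mono2 Fmono) auto
  then have "M * F v powr (1 / real h) * real v powr (1 / real h - 1) \<le> Q M n * real v powr (1 /
      real h - 1)"
    unfolding Q_def using assms by (intro mult_right_mono mult_left_mono) auto
  then show ?thesis by (simp add: prb_def)
qed

lemma prb_weight:
  "M \<ge> 0 \<Longrightarrow> v \<in> {1..n} \<Longrightarrow> 0 \<le> prb M v \<and> prb M v \<le> Q M n * real v powr (1 / real h - 1)"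
  using prb_range[of M v] prb_le_Q[of M v n] by simp

lemma sconst1: "sconst h B \<ge> 1"
  using h2 B1 by (intro sconst_ge_1) auto

lemma Q_power: "n \<ge> 1 \<Longrightarrow> Q M n ^ h = M ^ h * F n"
  using Fpos[of "real n"] h2 by (simp add: Q_def power_mult_distrib powr_realpow[symmetric]
      powr_powr)

lemma Q_ge_1: "M \<ge> 1 \<Longrightarrow> F n \<ge> 1 \<Longrightarrow> Q M n \<ge> 1"
  unfolding Q_def by (intro mult_ge1_I ge_one_powr_ge_zero) auto

lemma eventually_F_ge: "eventually (\<lambda>n::nat. F n \<ge> C) sequentially"
proof -
  have "filterlim (\<lambda>n::nat. cL * ln (real n)) at_top sequentially"
    using cL by real_asymp
  then have "eventually (\<lambda>n::nat. C \<le> cL * ln (real n)) sequentially"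
    by (simp add: filterlim_at_top)
  then show ?thesis using eventually_ge_at_top[of 1]
  proof eventually_elim
    case (elim n)
    then show ?case using Flow[of "real n"] by simp
  qed
qed

lemma F_doubling_power: "x \<ge> 1 \<Longrightarrow> F (2 ^ j * x) \<le> D ^ j * F x"
proof (induction j)
  case 0
  then show ?case by simp
next
  case (Suc j)
  have "2 ^ j * x \<ge> 1" using Suc.prems by (intro mult_ge1_I) auto
  then have "F (2 * (2 ^ j * x)) \<le> D * F (2 ^ j * x)" by (rule Fdoub)
  also have "\<dots> \<le> D * (D ^ j * F x)" using Suc D1 by (intro mult_left_mono) auto
  finally show ?case by (simp add: mult_ac)
qed

text \<open>The estimate holds for all ground sets \<open>{1..N}\<close> with
  \<open>N \<ge> n\<close>, so that all large \<open>n \<le> N\<close> can be handled inside one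
  finite measure.\<close>

lemma lower_tail:
  "\<exists>M\<ge>1. \<exists>c>0. eventually (\<lambda>n. \<forall>N\<ge>n.
     bprob {1..N} (prb M) (\<lambda>S. real (card (reps {1..h} n S)) \<le> c * F n) \<le> 1 / real n ^ 3)
         sequentially"
proof -
  obtain R c n0 where R: "R \<ge> 1" and c: "c > 0"
    and n0: "\<And>n. n \<ge> n0 \<Longrightarrow> c * real n ^ (h - 1) \<le> real (card {k \<in> sol {1..h} b (upper_range R n) n.
        inj_on k {1..h}})"
    using many_injective_solutions[of "{1..h}" b] h2 bpos bgcd by auto
  define a where "a = 1 / real h"
  have a: "0 < a" "a \<le> 1" using h2 by (auto simp: a_def)
  \<comment> \<open>For \<open>v \<ge> n / R\<close>, at most \<open>R\<close> doublings lead from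
    \<open>v\<close> past \<open>n\<close>, whence \<open>F v \<ge> F n / D ^ R\<close>.\<close>
  define c1 where "c1 = (1 / D ^ R) powr a"
  have c1: "0 < c1" "c1 \<le> 1" using D1 a by (auto simp: c1_def powr_le1)
  define c2 where "c2 = real R"
  define \<alpha> where "\<alpha> = c * c1 ^ h / (8 * (2 * real h * c2) ^ h)"
  have \<alpha>: "\<alpha> > 0" using c c1 R h2 by (simp add: \<alpha>_def c2_def)
  \<comment> \<open>No circularity arises: \<open>c\<close>, \<open>c1\<close>, \<open>c2\<close>
    and hence \<open>\<alpha>\<close> do not depend on \<open>M\<close>. The choice makes
    \<open>\<alpha> * M ^ h * F n\<close> at least \<open>3 * ln n\<close>.\<close>
  define M where "M = max 1 (3 / (\<alpha> * cL))"
  have M1: "M \<ge> 1" by (simp add: M_def)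
  \<comment> \<open>Division by \<open>CU\<close> covers the case where the probabilities are capped
    at 1: then \<open>Y = n ^ (h - 1)\<close>, which is at least \<open>F n / CU\<close>.\<close>
  define c' where "c' = c * c1 ^ h / 2 / CU"
  have c': "c' > 0" using c c1 CU by (simp add: c'_def)
  have "eventually (\<lambda>n. \<forall>N\<ge>n. bprob {1..N} (prb M) (\<lambda>S. real (card (reps {1..h} n S)) \<le> c' * F n)
      \<le> 1 / real n ^ 3) sequentially"
    using eventually_ge_at_top[of n0] eventually_ge_at_top[of 1] eventually_F_ge[of 1]
      eventually_polylog_le[OF a(1), of "3 / \<alpha>" 1]
  proof eventually_elim
    case (elim n)
    have n1: "n \<ge> 1" and Fn: "F n \<ge> 1" by (use elim in auto)
    have lnn: "3 * ln (real n) \<le> \<alpha> * real n powr a" using elim \<alpha> by (simp add: field_simps)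
    let ?q = "Q M n"
    have q1: "?q \<ge> 1" using M1 Fn by (rule Q_ge_1)
    define x where "x = ?q * real n powr (a - 1)"
    have x0: "x > 0" using q1 n1 by (simp add: x_def)
    define P where "P = min 1 x"
    have P: "0 < P" "P \<le> 1" using x0 by (auto simp: P_def)
    have nx: "real n * x = ?q * real n powr a"
      using n1 by (simp add: x_def powr_diff)
    have na: "real n powr a \<le> real n"
      using powr_mono[OF a(2), of "real n"] n1 by simp
    have na1: "1 \<le> real n powr a" using n1 a by (intro ge_one_powr_ge_zero) auto
    have nP: "real n powr a \<le> real n * P"
    proof (cases "x \<le> 1")
      case True
      then have "real n * P = ?q * real n powr a" using nx by (simp add: P_def)
      then show ?thesis using q1 mult_right_mono[of 1 ?q "real n powr a"] by simp
    next
      case False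
      then show ?thesis using na by (simp add: P_def)
    qed
    define Y where "Y = real n ^ (h - 1) * P ^ h"
    have xh: "real n ^ (h - 1) * x ^ h = M ^ h * F n"
    proof -
      have "(real n powr (a - 1)) ^ h = real n powr ((a - 1) * real h)"
        using n1 by (simp add: powr_realpow[symmetric] powr_powr)
      also have "(a - 1) * real h = - real (h - 1)" using h2 by (simp add: a_def of_nat_diff
          algebra_simps)
      also have "real n powr - real (h - 1) = 1 / real n ^ (h - 1)"
        using n1 by (simp add: powr_minus_divide powr_realpow)
      finally show ?thesis using Q_power[OF n1, of M] n1 by (simp add: x_def power_mult_distrib)
    qed
    have Y: "Y \<ge> min (real n ^ (h - 1)) (M ^ h * F n)"
      by (cases "x \<le> 1") (use xh in \<open>auto simp: Y_def P_def\<close>)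
    have MhM: "M \<le> M ^ h" using M1 h2 by (simp add: self_le_power)
    have YF: "F n / CU \<le> Y"
    proof -
      have "F n / CU \<le> real n ^ (h - 1)" using Fup[of "real n"] n1 CU by (simp add: field_simps)
      moreover have "F n / CU \<le> M ^ h * F n"
      proof -
        have "F n / CU \<le> F n / 1" using CU Fn by (intro divide_left_mono) auto
        also have "\<dots> \<le> M ^ h * F n" using MhM M1 Fn by (simp add: mult_le_cancel_right1)
        finally show ?thesis .
      qed
      ultimately show ?thesis using Y by linarith
    qed
    define G where "G = min (real n * P) (real n ^ (h - 1) * P ^ h)"
    have G: "3 * ln (real n) \<le> \<alpha> * G"
    proof -
      have "3 * ln (real n) \<le> \<alpha> * (real n * P)"
        using lnn mult_left_mono[OF nP, of \<alpha>] \<alpha> by linarith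
      moreover have "3 * ln (real n) \<le> \<alpha> * Y"
      proof -
        have "real n \<le> real n ^ (h - 1)" using n1 h2 by (intro self_le_power) auto
        then have "real n powr a \<le> real n ^ (h - 1)" using na by linarith
        then have 1: "3 * ln (real n) \<le> \<alpha> * real n ^ (h - 1)"
          using lnn mult_left_mono[of "real n powr a" "real n ^ (h - 1)" \<alpha>] \<alpha> by linarith
        have "3 / (\<alpha> * cL) \<le> M ^ h" using MhM by (simp add: M_def)
        then have "3 \<le> \<alpha> * M ^ h * cL" using \<alpha> cL by (simp add: field_simps)
        then have "3 * ln (real n) \<le> \<alpha> * M ^ h * cL * ln (real n)"
          using n1 by (intro mult_right_mono) auto
        also have "\<dots> = \<alpha> * M ^ h * (cL * ln (real n))" by simp
        also have "\<dots> \<le> \<alpha> * M ^ h * F n"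
          using Flow[of "real n"] n1 \<alpha> M1 by (intro mult_left_mono) auto
        finally have 2: "3 * ln (real n) \<le> \<alpha> * (M ^ h * F n)" by simp
        have "3 * ln (real n) \<le> \<alpha> * min (real n ^ (h - 1)) (M ^ h * F n)"
          using 1 2 by (auto simp: min_def)
        also have "\<dots> \<le> \<alpha> * Y" using Y \<alpha> by (intro mult_left_mono) auto
        finally show ?thesis .
      qed
      ultimately show ?thesis by (auto simp: G_def Y_def min_def)
    qed
    show ?case
    proof (intro allI impI)
      fix N assume N: "N \<ge> n"
      let ?U = "upper_range R n"
      have U1: "?U \<subseteq> {1..n}" using n1 by (rule upper_range_subset)
      have pr: "\<And>v. v \<in> {1..N} \<Longrightarrow> 0 \<le> prb M v \<and> prb M v \<le> 1" using M1 by (intro prb_range) auto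
      have pP: "c1 * P \<le> prb M v \<and> prb M v \<le> c2 * P" if v: "v \<in> ?U" for v
      proof
        have v1: "1 \<le> v" "v \<le> n" using U1 v by auto
        have nRv: "real n \<le> real R * real v" using v by (simp add: upper_range_def flip:
            of_nat_mult)
        have "real R \<le> 2 ^ R" using of_nat_less_two_power[of R, where 'a = real] by simp
        then have "real n \<le> 2 ^ R * real v" using nRv mult_right_mono[of "real R" "2 ^ R" "real v"]
            by linarith
        then have "F n \<le> F (2 ^ R * real v)" using n1 by (intro Fmono) auto
        also have "\<dots> \<le> D ^ R * F v" using v1 by (intro F_doubling_power) auto
        finally have "(1 / D ^ R) * F n \<le> F v" using D1 by (simp add: field_simps)
        then have "((1 / D ^ R) * F n) powr a \<le> F v powr a"
          using Fn D1 a by (intro powr_mono2) auto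
        then have "c1 * F n powr a \<le> F v powr a"
          using D1 Fn by (simp add: c1_def powr_mult powr_divide)
        moreover have "real n powr (a - 1) \<le> real v powr (a - 1)"
          using v1 a by (intro powr_mono2') auto
        ultimately have "c1 * F n powr a * real n powr (a - 1) \<le> F v powr a * real v powr (a - 1)"
          using c1 by (intro mult_mono) auto
        then have "M * (c1 * F n powr a * real n powr (a - 1)) \<le> M * (F v powr a * real v powr (a -
            1))"
          using M1 by (intro mult_left_mono) auto
        then have "c1 * x \<le> M * F v powr a * real v powr (a - 1)"
          by (simp add: x_def Q_def a_def mult_ac)
        moreover have "c1 * P \<le> c1 * x" "c1 * P \<le> 1"
          using c1 P mult_mono[of c1 1 P 1] by (auto simp: P_def)
        ultimately show "c1 * P \<le> prb M v" by (simp add: prb_def a_def)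
        have "prb M v \<le> ?q * real v powr (a - 1)" unfolding a_def using M1 v1 by (intro prb_le_Q)
            auto
        also have "\<dots> \<le> ?q * (real R * real n powr (a - 1))"
        proof (intro mult_left_mono)
          have "real v powr (a - 1) \<le> (real n / real R) powr (a - 1)"
            using nRv n1 R a by (intro powr_mono2') (auto simp: field_simps)
          also have "\<dots> = real R powr (1 - a) * real n powr (a - 1)"
            using powr_minus_divide[of "real R" "a - 1"] by (simp only: minus_diff_eq) (simp add:
                powr_divide)
          also have "real R powr (1 - a) \<le> real R powr 1" using R a by (intro powr_mono) auto
          finally show "real v powr (a - 1) \<le> real R * real n powr (a - 1)" using R by (simp add:
              mult_right_mono)
        qed (use q1 in auto)
        also have "\<dots> = c2 * x" by (simp add: c2_def x_def)
        finally have "prb M v \<le> c2 * x" .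
        moreover have "prb M v \<le> c2" using prb_range[of M v] M1 R unfolding c2_def by linarith
        ultimately show "prb M v \<le> c2 * P" by (auto simp: P_def min_def)
      qed
      let ?K = "{k \<in> sol {1..h} b ?U n. inj_on k {1..h}}"
      have tail: "bprob {1..N} (prb M) (\<lambda>S. real (card (hits ?K (\<lambda>k. k ` {1..h}) S))
        \<le> c * c1 ^ h / 2 * (real n ^ (h - 1) * P ^ h)) \<le> exp (- (c * c1 ^ h / (8 * ((2 * real h *
            c2) ^ h)) * G))"
      proof (rule solution_lower_tail)
        show "1 \<le> real n * P" using nP na1 by linarith
        show "c * real n ^ (h - 1) \<le> real (card ?K)" using n0 elim by simp
        show "?U \<subseteq> {1..N}" using U1 N by auto
      qed (use bpos pP P c c1 n1 R G_def h2 pr in \<open>auto simp: c2_def\<close>)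
      have "bprob {1..N} (prb M) (\<lambda>S. real (card (reps {1..h} n S)) \<le> c' * F n)
        \<le> bprob {1..N} (prb M) (\<lambda>S. real (card (hits ?K (\<lambda>k. k ` {1..h}) S)) \<le> c * c1 ^ h / 2 *
            (real n ^ (h - 1) * P ^ h))"
      proof (rule bprob_mono[OF _ pr])
        fix S assume le: "real (card (reps {1..h} n S)) \<le> c' * F n"
        have "card (hits ?K (\<lambda>k. k ` {1..h}) S) \<le> card (reps {1..h} n S)"
        proof (rule card_mono)
          show "hits ?K (\<lambda>k. k ` {1..h}) S \<subseteq> reps {1..h} n S"
            using U1 by (auto simp: hits_def reps_def sol_def PiE_iff)
        qed (simp add: reps_def)
        then have "real (card (hits ?K (\<lambda>k. k ` {1..h}) S)) \<le> c' * F n" using le by linarith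
        also have "\<dots> = c * c1 ^ h / 2 * (F n / CU)" by (simp add: c'_def)
        also have "\<dots> \<le> c * c1 ^ h / 2 * Y" using YF c c1 by (intro mult_left_mono) auto
        finally show "real (card (hits ?K (\<lambda>k. k ` {1..h}) S)) \<le> c * c1 ^ h / 2 * (real n ^ (h - 1)
            * P ^ h)"
          by (simp add: Y_def)
      qed auto
      also note tail
      also have "exp (- (c * c1 ^ h / (8 * ((2 * real h * c2) ^ h)) * G)) \<le> exp (- (3 * ln (real
          n)))"
        using G by (simp add: \<alpha>_def)
      also have "exp (- (3 * ln (real n))) = 1 / real n ^ 3"
        using n1 exp_of_nat_mult[of 3 "ln (real n)"] by (simp add: exp_minus inverse_eq_divide)
      finally show "bprob {1..N} (prb M) (\<lambda>S. real (card (reps {1..h} n S)) \<le> c' * F n) \<le> 1 / real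
          n ^ 3" .
    qed
  qed
  then show ?thesis using M1 c' by blast
qed

end

section \<open>Upper tails\<close>

context growth
begin

definition moment_order :: "nat \<Rightarrow> nat" where "moment_order n = nat \<lceil>4 * ln (real n)\<rceil>"

text \<open>At rich \<open>n\<close> the moment method of order \<open>moment_order n\<close>, about \<open>4 ln n\<close>, applies directly; at the other
  \<open>n\<close> the value \<open>F n\<close> is at most a power of \<open>ln n\<close>.\<close>

definition rich :: "real \<Rightarrow> nat \<Rightarrow> bool" where
  "rich M n \<longleftrightarrow> real (h * moment_order n) ^ h \<le> Q M n"

definition thr_exp :: real where "thr_exp = (1 / (4 * real h)) ^ (h + 1)"

text \<open>The thresholds satisfy \<open>thr n (Suc j) = thr n j ^ (4 * h)\<close> and \<open>thr n (h + 1) \<le> n\<close>. The exponent is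
  large enough for the window of length \<open>B * thr n j\<close> to contain, on average, very few values of partial
  sums with all entries above \<open>thr n (Suc j)\<close>.\<close>

definition \<tau> :: "nat \<Rightarrow> nat" where "\<tau> n = nat \<lfloor>real n powr thr_exp\<rfloor>"

definition thr :: "nat \<Rightarrow> nat \<Rightarrow> nat" where "thr n j = \<tau> n ^ ((4 * h) ^ j)"

text \<open>Chosen so that \<open>(n powr (thr_exp / 2)) ^ window_disj = n ^ 5\<close>, which
  survives a union bound over about \<open>n\<close> targets.\<close>

definition window_disj :: nat where "window_disj = 10 * (4 * h) ^ (h + 1)"

text \<open>At least twice the sum of the bound for the mean and \<open>4 * ln n\<close>. Since
  \<open>2 ^ d \<ge> exp (d / 2)\<close>, the tail bound \<open>exp \<Lambda> / 2 ^ d\<close> is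
  then at most \<open>1 / n ^ 4\<close>.\<close>

definition full_disj :: "real \<Rightarrow> nat \<Rightarrow> nat" where
  "full_disj M n = nat \<lceil>2 * (sconst h B * Q M n ^ h) + 8 * ln (real n)\<rceil>"

lemma exp_neg_4_ln: "n \<ge> 1 \<Longrightarrow> exp (- (4 * ln (real n))) = 1 / real n ^ 4"
  using exp_of_nat_mult[of 4 "ln (real n)"] by (simp add: exp_minus inverse_eq_divide)

lemma subset_card_le: "I \<subseteq> {1..h} \<Longrightarrow> card I \<le> h"
  using card_mono[of "{1..h}" I] by simp

lemma card_sub: "real (card (Pow {1..h} - X)) \<le> 2 ^ h"
proof -
  have "card (Pow {1..h} - X) \<le> card (Pow {1..h})" by (intro card_mono) auto
  also have "\<dots> = 2 ^ h" by (simp add: card_Pow)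
  finally show ?thesis by (metis of_nat_le_iff of_nat_numeral of_nat_power)
qed

text \<open>Richness is exactly the condition \<open>N ^ h \<le> q\<close> of
  \<open>sum_relative_weights_le\<close> with \<open>N = h * moment_order n\<close> exposed
  elements. An order of at least \<open>4 * ln n\<close> gives failure probability
  \<open>1 / n ^ 4\<close> for each set of unknowns.\<close>

lemma rich_tail:
  assumes M: "M \<ge> 1"
  shows "eventually (\<lambda>n. rich M n \<longrightarrow> (\<forall>N\<ge>n. bprob {1..N} (prb M)
     (\<lambda>S. \<exists>I\<in>Pow {1..h} - {{}}. exp 1 * (sconst h B * Q M n ^ h) \<le> real (card (reps I n S))) \<le> 2 ^
         h / real n ^ 4)) sequentially"
  using eventually_ge_at_top[of 2] eventually_F_ge[of 1]
proof eventually_elim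
  case (elim n)
  show ?case
  proof (intro impI allI)
    fix N assume rich: "rich M n" and N: "N \<ge> n"
    have n1: "n \<ge> 1" "n \<ge> 2" using elim by auto
    have q1: "Q M n \<ge> 1" using M elim by (intro Q_ge_1) auto
    let ?L = "sconst h B * Q M n ^ h"
    have L0: "?L > 0" using sconst1 q1 by simp
    have ln0: "ln (real n) > 0" using n1 by simp
    have pr: "\<And>v. v \<in> {1..N} \<Longrightarrow> 0 \<le> prb M v \<and> prb M v \<le> 1" using M by (intro prb_range) auto
    have o1: "moment_order n \<ge> 1" using ln0 by (simp add: moment_order_def Suc_le_eq)
    have one: "bprob {1..N} (prb M) (\<lambda>S. exp 1 * ?L \<le> real (card (reps I n S))) \<le> 1 / real n ^ 4"
      if I: "I \<in> Pow {1..h} - {{}}" for I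
    proof -
      have fI: "finite I" "I \<subseteq> {1..h}" "I \<noteq> {}" using I finite_subset by auto
      have "bprob {1..N} (prb M) (\<lambda>S. real (card (hits (sol I b {1..n} n) (\<lambda>k. k ` I) S)) \<ge> exp 1 *
          ?L)
        \<le> exp (- real (moment_order n))"
      proof (rule moment_upper_tail[where h = h])
        show "k ` I \<subseteq> {1..N}" if "k \<in> sol I b {1..n} n" for k using sol_image[OF that] N by auto
        show "card (k ` I) \<le> h" for k using card_image_le[OF fI(1), of k] subset_card_le[OF fI(2)]
            by simp
        fix U assume U: "U \<subseteq> {1..N}" "card U \<le> h * moment_order n"
        show "(\<Sum>k\<in>sol I b {1..n} n. \<Prod>v\<in>k ` I - U. prb M v) \<le> ?L"
        proof (rule sum_relative_weights_le)
          show "real (h * moment_order n) ^ h \<le> Q M n" using rich by (simp add: rich_def)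
          show "1 \<le> b i" if "i \<in> I" for i using bpos fI that by auto
          show "0 \<le> prb M v \<and> prb M v \<le> Q M n * real v powr (1 / real h - 1)" if "v \<in> {1..n}" for v
            using M that by (intro prb_weight) auto
          show "finite U" using U finite_subset by blast
        qed (use fI U subset_card_le sum_le_B q1 o1 h2 B1 in auto)
      qed (use pr fI L0 in auto)
      also have "\<dots> \<le> exp (- (4 * ln (real n)))" using ln0 by (simp add: moment_order_def)
      finally show ?thesis using exp_neg_4_ln[OF n1(1)] by (simp add: reps_def)
    qed
    have "bprob {1..N} (prb M) (\<lambda>S. \<exists>I\<in>Pow {1..h} - {{}}. exp 1 * ?L \<le> real (card (reps I n S)))
      \<le> 2 ^ h * (1 / real n ^ 4)"
      by (rule bprob_union_bound_uniform[OF _ pr _ one _ card_sub]) auto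
    then show "bprob {1..N} (prb M) (\<lambda>S. \<exists>I\<in>Pow {1..h} - {{}}. exp 1 * ?L \<le> real (card (reps I n
        S)))
      \<le> 2 ^ h / real n ^ 4" by simp
  qed
qed

text \<open>The disjoint tail bound with \<open>t = 1\<close>. It controls disjoint families of
  exact solutions for every set of unknowns, including the full set \<open>{1..h}\<close>, where the
  weights do not decay.\<close>

lemma disjoint_tail:
  assumes M: "M \<ge> 1"
  shows "eventually (\<lambda>n. \<forall>N\<ge>n. bprob {1..N} (prb M)
     (\<lambda>S. \<exists>I\<in>Pow {1..h} - {{}}. \<exists>L. disj_hits (sol I b {1..n} n) (\<lambda>k. k ` I) S L \<and> card L =
         full_disj M n)
       \<le> 2 ^ h / real n ^ 4) sequentially"
  using eventually_ge_at_top[of 1] eventually_F_ge[of 1]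
proof eventually_elim
  case (elim n)
  show ?case
  proof (intro impI allI)
    fix N assume N: "N \<ge> n"
    have q1: "Q M n \<ge> 1" using M elim by (intro Q_ge_1) auto
    let ?L = "sconst h B * Q M n ^ h"
    have L0: "?L > 0" using sconst1 q1 by simp
    have ln0: "ln (real n) \<ge> 0" using elim by simp
    have pr: "\<And>v. v \<in> {1..N} \<Longrightarrow> 0 \<le> prb M v \<and> prb M v \<le> 1" using M by (intro prb_range) auto
    let ?E = "\<lambda>I S. \<exists>L. disj_hits (sol I b {1..n} n) (\<lambda>k. k ` I) S L \<and> card L = full_disj M n"
    have one: "bprob {1..N} (prb M) (?E I) \<le> 1 / real n ^ 4"
      if I: "I \<in> Pow {1..h} - {{}}" for I
    proof -
      have fI: "finite I" "I \<subseteq> {1..h}" "I \<noteq> {}" using I finite_subset by auto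
      have "bprob {1..N} (prb M) (?E I) \<le> exp (1 * ?L) / (1 + 1) ^ full_disj M n"
      proof (rule disjoint_upper_tail)
        show "k ` I \<subseteq> {1..N}" if "k \<in> sol I b {1..n} n" for k using sol_image[OF that] N by auto
        have "(\<Sum>k\<in>sol I b {1..n} n. \<Prod>v\<in>k ` I. prb M v) \<le> sconst h B * Q M n ^ h * real n powr (real
            h / real h - 1)"
        proof (rule sum_weights_le)
          show "1 \<le> b i" if "i \<in> I" for i using bpos fI that by auto
          show "0 \<le> prb M v \<and> prb M v \<le> Q M n * real v powr (1 / real h - 1)" if "v \<in> {1..n}" for v
            using M that by (intro prb_weight) auto
        qed (use fI subset_card_le sum_le_B q1 h2 B1 elim in auto)
        also have "\<dots> = ?L" using h2 elim by simp
        finally show "(\<Sum>k\<in>sol I b {1..n} n. \<Prod>v\<in>k ` I. prb M v) \<le> ?L" .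
      qed (use pr fI in auto)
      also have "\<dots> \<le> exp ?L / exp (?L + 4 * ln (real n))"
        unfolding mult_1_left
      proof (rule divide_left_mono)
        have "?L + 4 * ln (real n) \<le> real (full_disj M n) * (1 / 2)"
          unfolding full_disj_def using L0 ln0 by linarith
        also have "\<dots> \<le> real (full_disj M n) * ln 2" using ln2_ge_two_thirds by (intro
            mult_left_mono) auto
        finally have "exp (?L + 4 * ln (real n)) \<le> exp (real (full_disj M n) * ln 2)" by simp
        also have "\<dots> = (1 + 1) ^ full_disj M n" by (simp add: exp_of_nat_mult)
        finally show "exp (?L + 4 * ln (real n)) \<le> (1 + 1) ^ full_disj M n" .
      qed auto
      also have "\<dots> = 1 / real n ^ 4" using exp_neg_4_ln[of n] elim by (simp add: exp_add exp_minus
          inverse_eq_divide)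
      finally show ?thesis by simp
    qed
    have "bprob {1..N} (prb M) (\<lambda>S. \<exists>I\<in>Pow {1..h} - {{}}. ?E I S) \<le> 2 ^ h * (1 / real n ^ 4)"
      by (rule bprob_union_bound_uniform[OF _ pr _ one _ card_sub]) auto
    then show "bprob {1..N} (prb M) (\<lambda>S. \<exists>I\<in>Pow {1..h} - {{}}. ?E I S) \<le> 2 ^ h / real n ^ 4" by simp
  qed
qed

lemma thr_exp_pos: "thr_exp > 0"
  using h2 by (simp add: thr_exp_def)

text \<open>Halving the exponent absorbs the rounding in \<open>\<tau>\<close>.\<close>

lemma eventually_tau_ge: "eventually (\<lambda>n. real n powr (thr_exp / 2) \<le> real (\<tau> n) \<and> \<tau> n \<ge> 1)
    sequentially"
proof -
  have "eventually (\<lambda>n::nat. 2 * ln (real n) ^ 0 \<le> real n powr (thr_exp / 2)) sequentially"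
    by (rule eventually_polylog_le) (use thr_exp_pos in simp)
  then show ?thesis
  proof eventually_elim
    case (elim n)
    define x where "x = real n powr (thr_exp / 2)"
    have x2: "x \<ge> 2" using elim by (simp add: x_def)
    have "real n powr thr_exp = x * x" by (simp add: x_def flip: powr_add)
    moreover have "real (\<tau> n) \<ge> real n powr thr_exp - 1" unfolding \<tau>_def by linarith
    moreover have "x * x \<ge> 2 * x" using x2 by (intro mult_right_mono) auto
    ultimately have "real (\<tau> n) \<ge> x" using x2 by linarith
    moreover then have "real (\<tau> n) \<ge> 1" using x2 by linarith
    ultimately show ?case by (simp add: x_def)
  qed
qed

lemma eventually_tau_polylog:
  "eventually (\<lambda>n. C * real (h * moment_order n) ^ k \<le> real (\<tau> n)) sequentially"
proof -
  have "eventually (\<lambda>n::nat. (\<bar>C\<bar> * (5 * real h) ^ k) * ln (real n) ^ k \<le> real n powr (thr_exp /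
      2)) sequentially"
    by (rule eventually_polylog_le) (use thr_exp_pos in simp)
  then show ?thesis using eventually_ge_at_top[of 3] eventually_tau_ge
  proof eventually_elim
    case (elim n)
    have "exp 1 \<le> real n" using exp_le elim by linarith
    then have ln1: "1 \<le> ln (real n)" using elim by (subst ln_ge_iff) auto
    have "real (moment_order n) \<le> 5 * ln (real n)" unfolding moment_order_def using ln1 by linarith
    then have "real (h * moment_order n) \<le> 5 * real h * ln (real n)"
      using mult_left_mono[of "real (moment_order n)" "5 * ln (real n)" "real h"] by simp
    then have "real (h * moment_order n) ^ k \<le> (5 * real h * ln (real n)) ^ k" by (intro
        power_mono) auto
    then have "\<bar>C\<bar> * real (h * moment_order n) ^ k \<le> \<bar>C\<bar> * (5 * real h * ln (real n)) ^ k"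
      by (intro mult_left_mono) auto
    also have "\<dots> = (\<bar>C\<bar> * (5 * real h) ^ k) * ln (real n) ^ k" by (simp only: power_mult_distrib
        mult.assoc)
    also have "\<dots> \<le> real (\<tau> n)" using elim by linarith
    finally have "\<bar>C\<bar> * real (h * moment_order n) ^ k \<le> real (\<tau> n)" .
    moreover have "C * real (h * moment_order n) ^ k \<le> \<bar>C\<bar> * real (h * moment_order n) ^ k"
      by (intro mult_right_mono) auto
    ultimately show ?case by linarith
  qed
qed

text \<open>At poor \<open>n\<close> the factor \<open>Q M n ^ h\<close> is at most a power of
  \<open>ln n\<close>, hence below \<open>\<tau> n\<close>. With T the threshold
  \<open>thr n j\<close>, the expected number of window solutions is then at most
  \<open>\<tau> n / T ^ 3 \<le> 1 / \<tau> n\<close>, and the disjoint tail bound is applied with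
  \<open>t = \<tau> n\<close>. The full set of unknowns is excluded since the decay needs fewer than
  \<open>h\<close> of them.\<close>

lemma window_tail:
  assumes M: "M \<ge> 1"
  shows "eventually (\<lambda>n. \<not> rich M n \<longrightarrow> (\<forall>N\<ge>n. bprob {1..N} (prb M)
     (\<lambda>S. \<exists>(j, I, m)\<in>{..h} \<times> (Pow {1..h} - {{}, {1..h}}) \<times> {..n}.
        \<exists>L. disj_hits (win I b {thr n (Suc j)<..n} (B * thr n j) m) (\<lambda>k. k ` I) S L \<and> card L =
            window_disj)
       \<le> real (h + 1) * 2 ^ h * real (n + 1) * (3 / real n ^ 5))) sequentially"
  using eventually_ge_at_top[of 1] eventually_F_ge[of 1] eventually_tau_ge
    eventually_tau_polylog[of "2 * real B * sconst h B" "h * h"]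
proof eventually_elim
  case (elim n)
  show ?case
  proof (intro impI allI)
    fix N assume poor: "\<not> rich M n" and N: "N \<ge> n"
    have q1: "Q M n \<ge> 1" using M elim by (intro Q_ge_1) auto
    have t1: "real (\<tau> n) \<ge> 1" using elim by simp
    have pr: "\<And>v. v \<in> {1..N} \<Longrightarrow> 0 \<le> prb M v \<and> prb M v \<le> 1" using M by (intro prb_range) auto
    have Qh: "2 * real B * sconst h B * Q M n ^ h \<le> real (\<tau> n)"
    proof -
      have "Q M n ^ h \<le> (real (h * moment_order n) ^ h) ^ h"
        using poor q1 by (intro power_mono) (auto simp: rich_def)
      then have "2 * real B * sconst h B * Q M n ^ h \<le> 2 * real B * sconst h B * (real (h *
          moment_order n) ^ h) ^ h"
        using sconst1 by (intro mult_left_mono) auto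
      then show ?thesis using elim by (simp add: power_mult)
    qed
    let ?X = "{..h} \<times> (Pow {1..h} - {{}, {1..h}}) \<times> {..n}"
    let ?W = "\<lambda>j I m. win I b {thr n (Suc j)<..n} (B * thr n j) m"
    let ?E = "\<lambda>(j, I, m) S. \<exists>L. disj_hits (?W j I m) (\<lambda>k. k ` I) S L \<and> card L = window_disj"
    have one: "bprob {1..N} (prb M) (?E x) \<le> 3 / real n ^ 5" if x: "x \<in> ?X" for x
    proof -
      obtain j I m where xe: "x = (j, I, m)" and I: "I \<in> Pow {1..h} - {{}, {1..h}}" using x by auto
      have fI: "finite I" "I \<subseteq> {1..h}" "I \<noteq> {}" using I finite_subset by auto
      have cI: "card I < h" using I psubset_card_mono[of "{1..h}" I] by auto
      define T where "T = real (thr n j)"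
      have e1: "(4 * h) ^ j \<ge> 1" using h2 by (simp add: Suc_le_eq)
      have T\<tau>: "T \<ge> real (\<tau> n)"
        unfolding T_def thr_def using elim e1 h2 by (simp add: self_le_power)
      have T1: "T \<ge> 1" using T\<tau> t1 by linarith
      have thr1: "thr n (Suc j) \<ge> 1" using elim by (simp add: thr_def)
      \<comment> \<open>This is the purpose of the exponent \<open>4 * h\<close> between consecutive
        thresholds: the decay \<open>1 / T ^ 4\<close> beats the window length, which is of order
        \<open>T\<close>, with room for \<open>Q M n ^ h\<close>.\<close>
      have TS: "real (thr n (Suc j)) powr (- 1 / real h) = 1 / T ^ 4"
      proof -
        have "real (thr n (Suc j)) = T ^ (4 * h)"
          by (simp add: T_def thr_def power_mult[symmetric] mult.commute)
        also have "\<dots> = T powr (4 * real h)"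
          using T1 powr_realpow[of T "4 * h"] by simp
        finally have "real (thr n (Suc j)) powr (- 1 / real h) = T powr (- 4)"
          using h2 by (simp add: powr_powr)
        also have "\<dots> = 1 / T ^ 4" using T1 by (simp add: powr_minus_divide)
        finally show ?thesis .
      qed
      let ?\<Lambda> = "1 / real (\<tau> n)"
      have "bprob {1..N} (prb M) (?E x) \<le> exp (real (\<tau> n) * ?\<Lambda>) / (1 + real (\<tau> n)) ^ window_disj"
        unfolding xe prod.case
      proof (rule disjoint_upper_tail)
        show "k ` I \<subseteq> {1..N}" if "k \<in> ?W j I m" for k
          using win_image[OF that] N by (auto simp: subset_iff)
        have "(\<Sum>k\<in>?W j I m. \<Prod>v\<in>k ` I. prb M v)
           \<le> real (B * thr n j + 1) * (sconst h B * Q M n ^ h * real (thr n (Suc j)) powr (- 1 /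
               real h))"
        proof (rule sum_window_weights_le)
          show "1 \<le> b i" if "i \<in> I" for i using bpos fI that by auto
          show "0 \<le> prb M v \<and> prb M v \<le> Q M n * real v powr (1 / real h - 1)" if "v \<in> {thr n (Suc
              j)<..n}" for v
            using M that by (intro prb_weight) auto
        qed (use fI cI sum_le_B q1 h2 B1 thr1 in auto)
        also have "\<dots> \<le> (2 * real B * T) * (sconst h B * Q M n ^ h * (1 / T ^ 4))"
          unfolding TS
        proof (rule mult_right_mono)
          have "1 \<le> real B * T" using B1 T1 by (intro mult_ge1_I) auto
          then show "real (B * thr n j + 1) \<le> 2 * real B * T" by (simp add: T_def)
        qed (use sconst1 q1 T1 in auto)
        also have "\<dots> = (2 * real B * sconst h B * Q M n ^ h) / T ^ 3"
          using T1 by (simp add: field_simps power_numeral_reduce)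
        also have "\<dots> \<le> real (\<tau> n) / T ^ 3" using Qh T1 by (intro divide_right_mono) auto
        also have "\<dots> \<le> real (\<tau> n) / real (\<tau> n) ^ 3" using T\<tau> t1 T1 by (intro divide_left_mono
            power_mono) auto
        also have "\<dots> = 1 / real (\<tau> n) ^ 2" using t1 by (simp add: field_simps power_numeral_reduce)
        also have "\<dots> \<le> 1 / real (\<tau> n)" using t1 by (intro divide_left_mono self_le_power) auto
        finally show "(\<Sum>k\<in>?W j I m. \<Prod>v\<in>k ` I. prb M v) \<le> ?\<Lambda>" .
      qed (use pr fI in auto)
      also have "\<dots> \<le> 3 / real n ^ 5"
      proof (rule frac_le)
        show "exp (real (\<tau> n) * ?\<Lambda>) \<le> 3" using t1 exp_le by simp
        have e: "thr_exp / 2 * real window_disj = 5" using h2 by (simp add: thr_exp_def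
            window_disj_def power_divide)
        have "(real n powr (thr_exp / 2)) ^ window_disj = real n powr (thr_exp / 2 * real
            window_disj)"
          using elim(1) by (simp only: powr_powr[symmetric]) (simp add: powr_realpow)
        also have "\<dots> = real n ^ 5" unfolding e using elim(1) by simp
        finally have "real n ^ 5 = (real n powr (thr_exp / 2)) ^ window_disj" by (rule sym)
        also have "\<dots> \<le> real (\<tau> n) ^ window_disj" using elim by (intro power_mono) auto
        also have "\<dots> \<le> (1 + real (\<tau> n)) ^ window_disj" by (intro power_mono) auto
        finally show "real n ^ 5 \<le> (1 + real (\<tau> n)) ^ window_disj" .
      qed (use elim in auto)
      finally show ?thesis .
    qed
    have "real (card ?X) = real (h + 1) * real (card (Pow {1..h} - {{}, {1..h}})) * real (n + 1)"
      by (simp only: card_cartesian_product of_nat_mult card_atMost Suc_eq_plus1 mult.assoc)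
    also have "\<dots> \<le> real (h + 1) * 2 ^ h * real (n + 1)"
      by (intro mult_right_mono mult_left_mono card_sub) auto
    finally have "bprob {1..N} (prb M) (\<lambda>S. \<exists>x\<in>?X. ?E x S)
        \<le> real (h + 1) * 2 ^ h * real (n + 1) * (3 / real n ^ 5)"
      by (intro bprob_union_bound_uniform[OF _ pr _ one]) auto
    then show "bprob {1..N} (prb M) (\<lambda>S. \<exists>(j, I, m)\<in>?X.
        \<exists>L. disj_hits (?W j I m) (\<lambda>k. k ` I) S L \<and> card L = window_disj)
       \<le> real (h + 1) * 2 ^ h * real (n + 1) * (3 / real n ^ 5)"
      by (simp add: case_prod_unfold)
  qed
qed

end

section \<open>Deterministic upper bound for good sets\<close>

text \<open>The \<open>h + 1\<close> intervals between consecutive thresholds cannot all be hit by \<open>h\<close> entries. An empty one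
  separates the small entries of a representation from the large ones.\<close>

lemma exists_gap:
  fixes T :: "nat \<Rightarrow> 'b :: linorder"
  assumes I: "finite I" "card I \<le> h" and T: "mono T"
  shows "\<exists>j\<le>h. \<forall>i\<in>I. k i \<le> T j \<or> T (Suc j) < k i"
proof (rule ccontr)
  assume "\<not> ?thesis"
  then have "\<forall>j\<in>{..h}. \<exists>i\<in>I. T j < k i \<and> k i \<le> T (Suc j)" by (metis atMost_iff not_le)
  then obtain f where f: "\<And>j. j \<le> h \<Longrightarrow> f j \<in> I \<and> T j < k (f j) \<and> k (f j) \<le> T (Suc j)"
    by (metis atMost_iff)
  have ne: "f x \<noteq> f y" if xy: "x < y" "y \<le> h" for x y
  proof
    assume eq: "f x = f y"
    have "k (f x) \<le> T (Suc x)" using f[of x] xy by simp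
    also have "\<dots> \<le> T y" using xy by (intro monoD[OF T]) auto
    also have "\<dots> < k (f y)" using f[of y] xy by simp
    finally show False by (simp add: eq)
  qed
  have "inj_on f {..h}"
    by (rule linorder_inj_onI) (use ne in auto)
  then have "card {..h} \<le> card I" using I f by (intro card_inj_on_le[of f]) auto
  then show False using I by simp
qed

lemma sol_range:
  assumes "finite I" "\<And>i. i \<in> I \<Longrightarrow> c i \<ge> 1"
  shows "sol I c {1..n} m \<subseteq> sol I c {1..m} m"
proof
  fix k assume k: "k \<in> sol I c {1..n} m"
  then have "k i \<le> m" if "i \<in> I" for i using sol_le[OF k assms(1) that] assms(2) that by auto
  then show "k \<in> sol I c {1..m} m" using k by (auto simp: sol_def PiE_iff)
qed

lemma disj_hits_mono: "disj_hits K R S L \<Longrightarrow> K \<subseteq> K' \<Longrightarrow> disj_hits K' R S L"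
  by (auto simp: disj_hits_def hits_def)

context growth
begin

text \<open>What the deterministic argument needs at a single \<open>n\<close>: the negations of the
  events of the three tail estimates, two of them applying only at rich or only at poor
  \<open>n\<close>.\<close>

definition good :: "real \<Rightarrow> nat \<Rightarrow> nat set \<Rightarrow> bool" where
  "good M n A \<longleftrightarrow>
    (rich M n \<longrightarrow> \<not> (\<exists>I\<in>Pow {1..h} - {{}}. exp 1 * (sconst h B * Q M n ^ h) \<le> real (card (reps I n
        A)))) \<and>
    (\<not> rich M n \<longrightarrow> \<not> (\<exists>(j, I, m)\<in>{..h} \<times> (Pow {1..h} - {{}, {1..h}}) \<times> {..n}.
        \<exists>L. disj_hits (win I b {thr n (Suc j)<..n} (B * thr n j) m) (\<lambda>k. k ` I) A L \<and> card L =
            window_disj)) \<and>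
    \<not> (\<exists>I\<in>Pow {1..h} - {{}}. \<exists>L. disj_hits (sol I b {1..n} n) (\<lambda>k. k ` I) A L \<and> card L = full_disj
        M n)"

lemma finite_reps: "I \<subseteq> {1..h} \<Longrightarrow> finite (reps I n A)"
  unfolding reps_def using finite_subset by (intro finite_hits finite_sol) auto

lemma card_reps_le:
  assumes "I \<subseteq> {1..h}" "I \<noteq> {}"
  shows "card (reps I n A) \<le> n ^ (card I - 1)"
proof -
  have fI: "finite I" using assms finite_subset by auto
  have "card (reps I n A) \<le> card (sol I b {1..n} n)"
    using fI by (intro card_mono) (auto simp: reps_def hits_def)
  also have "\<dots> \<le> card {1..n} ^ (card I - 1)" using assms fI bpos by (intro card_sol_le) auto
  finally show ?thesis by simp
qed

text \<open>The entries indexed by \<open>S\<close> contribute at most \<open>B * t\<close>, so the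
  others form a window solution. Given these, the entries in \<open>S\<close> represent the
  remaining target exactly, which is where the bound for fewer unknowns enters.\<close>

lemma card_mixed_reps_le:
  assumes I: "I \<subseteq> {1..h}" "S \<subseteq> I"
  shows "card {k \<in> reps I n A. (\<forall>i\<in>S. k i \<le> t) \<and> (\<forall>i\<in>I - S. t' < k i)}
    \<le> (\<Sum>u\<in>hits (win (I - S) b {t'<..n} (B * t) n) (\<lambda>k. k ` (I - S)) A.
         card (reps S (n - (\<Sum>i\<in>I - S. b i * u i)) A))"
proof -
  let ?X = "{k \<in> reps I n A. (\<forall>i\<in>S. k i \<le> t) \<and> (\<forall>i\<in>I - S. t' < k i)}"
  let ?H = "hits (win (I - S) b {t'<..n} (B * t) n) (\<lambda>k. k ` (I - S)) A"
  let ?R = "\<lambda>u. reps S (n - (\<Sum>i\<in>I - S. b i * u i)) A"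
  have fin: "finite I" "finite S" "finite (I - S)" using I finite_subset by (auto intro:
      finite_subset)
  have SI: "S \<subseteq> {1..h}" using I by auto
  have "card ?X \<le> card (Sigma ?H ?R)"
  proof (rule card_inj_on_le[where f = "\<lambda>k. (restrict k (I - S), restrict k S)"])
    show "inj_on (\<lambda>k. (restrict k (I - S), restrict k S)) ?X"
    proof (rule inj_onI)
      fix k l assume k: "k \<in> ?X" and l: "l \<in> ?X"
        and eq: "(restrict k (I - S), restrict k S) = (restrict l (I - S), restrict l S)"
      have e1: "restrict k (I - S) = restrict l (I - S)" and e2: "restrict k S = restrict l S"
        using eq by auto
      have "k i = l i" if "i \<in> I" for i
        using fun_cong[OF e1, of i] fun_cong[OF e2, of i] that by (cases "i \<in> S") auto
      then show "k = l" using k l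
        by (intro PiE_ext[of k I "\<lambda>_. {1..n}" l]) (auto simp: reps_def hits_def sol_def)
    qed
    show "(\<lambda>k. (restrict k (I - S), restrict k S)) ` ?X \<subseteq> Sigma ?H ?R"
    proof (rule image_subsetI)
      fix k assume k: "k \<in> ?X"
      then have ks: "k \<in> sol I b {1..n} n" and kA: "k ` I \<subseteq> A" by (auto simp: reps_def hits_def)
      have split: "(\<Sum>i\<in>I. b i * k i) = (\<Sum>i\<in>S. b i * k i) + (\<Sum>i\<in>I - S. b i * k i)"
        using fin I by (metis sum.subset_diff add.commute)
      have sn: "(\<Sum>i\<in>I. b i * k i) = n" using ks by (simp add: sol_def)
      have "(\<Sum>i\<in>S. b i * k i) \<le> (\<Sum>i\<in>S. b i * t)" using k by (intro sum_mono) auto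
      also have "\<dots> = sum b S * t" by (simp add: sum_distrib_right)
      also have "\<dots> \<le> B * t" using sum_le_B[OF SI] by (intro mult_right_mono) auto
      finally have small: "(\<Sum>i\<in>S. b i * k i) \<le> B * t" .
      have eq: "(\<Sum>i\<in>I - S. b i * restrict k (I - S) i) = (\<Sum>i\<in>I - S. b i * k i)"
        by (intro sum.cong) auto
      have "k i \<in> {t'<..n}" if "i \<in> I - S" for i
        using k that sol_image[OF ks] by (auto simp: subset_iff)
      then have H: "restrict k (I - S) \<in> ?H"
        using split sn small kA by (auto simp: hits_def win_def eq)
      have "restrict k S \<in> sol S b {1..n} (n - (\<Sum>i\<in>I - S. b i * k i))"
        using sol_restrict[OF ks I(2) fin(1)] .
      then have "restrict k S \<in> sol S b {1..n - (\<Sum>i\<in>I - S. b i * k i)} (n - (\<Sum>i\<in>I - S. b i * k i))"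
        using sol_range[OF fin(2), of b] bpos SI by blast
      then have R: "restrict k S \<in> ?R (restrict k (I - S))"
        using kA I unfolding reps_def hits_def eq by auto
      show "(restrict k (I - S), restrict k S) \<in> Sigma ?H ?R" using H R by auto
    qed
    show "finite (Sigma ?H ?R)" using fin SI by (intro finite_SigmaI finite_hits finite_win
        finite_reps) auto
  qed
  also have "\<dots> = (\<Sum>u\<in>?H. card (?R u))" using fin SI finite_reps by (intro card_SigmaI) auto
  finally show ?thesis .
qed

text \<open>Since \<open>thr n h\<close> is at most \<open>n powr (1 / (4 * h))\<close>, a
  representation of \<open>n\<close> cannot have all its entries below this threshold.\<close>

lemma eventually_thr_less: "eventually (\<lambda>n. B * thr n h < n) sequentially"
proof -
  have "eventually (\<lambda>n::nat. (real B + 1) * ln (real n) ^ 0 \<le> real n powr (1 / 2)) sequentially"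
    by (rule eventually_polylog_le) simp
  then show ?thesis using eventually_ge_at_top[of 1]
  proof eventually_elim
    case (elim n)
    have e: "thr_exp * real ((4 * h) ^ h) = 1 / (4 * real h)"
      using h2 by (simp add: thr_exp_def power_divide)
    have "real (\<tau> n) \<le> real n powr thr_exp" unfolding \<tau>_def by (simp add: of_nat_floor)
    then have "real (thr n h) \<le> (real n powr thr_exp) ^ ((4 * h) ^ h)"
      unfolding thr_def by (simp add: power_mono)
    also have "\<dots> = real n powr (thr_exp * real ((4 * h) ^ h))"
    proof -
      have "real n powr thr_exp > 0" using elim by simp
      then show ?thesis by (simp only: powr_realpow[symmetric] powr_powr)
    qed
    also have "\<dots> = real n powr (1 / (4 * real h))" by (simp only: e)
    also have "\<dots> \<le> real n powr (1 / 2)" using elim h2 by (intro powr_mono) (auto simp: field_simps)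
    finally have t: "real (thr n h) \<le> real n powr (1 / 2)" .
    have "real (B * thr n h) \<le> real B * real n powr (1 / 2)" using t by (simp add: mult_left_mono)
    also have "\<dots> < real n powr (1 / 2) * real n powr (1 / 2)"
      using elim by (intro mult_strict_right_mono) auto
    also have "\<dots> = real n" using elim by (simp flip: powr_add)
    finally show ?case by (simp only: of_nat_less_iff)
  qed
qed

lemma full_disj_le:
  assumes "M \<ge> 1" "n \<ge> 1" "F n \<ge> 1"
  shows "real (full_disj M n) \<le> (2 * (sconst h B * M ^ h) + 8 / cL + 1) * F n"
proof -
  have "ln (real n) \<le> F n / cL" using Flow[of "real n"] cL assms by (simp add: field_simps)
  moreover have "0 \<le> 2 * (sconst h B * Q M n ^ h) + 8 * ln (real n)"
    using sconst1 Q_ge_1[OF assms(1,3)] assms by (intro add_nonneg_nonneg mult_nonneg_nonneg) auto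
  ultimately have "real (full_disj M n) \<le> 2 * (sconst h B * (M ^ h * F n)) + 8 * (F n / cL) + F n"
    unfolding full_disj_def using assms(3) by (simp only: Q_power[OF assms(2), symmetric]) linarith
  then show ?thesis by (simp add: algebra_simps)
qed

lemma thr_mono: "\<tau> n \<ge> 1 \<Longrightarrow> mono (thr n)"
  unfolding thr_def using h2 by (intro monoI power_increasing) auto

text \<open>Every representation has a gap index \<open>j\<close> and a set \<open>S\<close> of
  small positions, at most \<open>(h + 1) * 2 ^ h\<close> pairs in all. The bound \<open>Z\<close>
  for each pair combines the cases of no small entry and of entries of both kinds.\<close>

lemma poor_bound:
  assumes M: "M \<ge> 1" and n: "n \<ge> 1" "F n \<ge> 1" "\<tau> n \<ge> 1" "B * thr n h < n"
    and good: "good M n A" "\<not> rich M n"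
    and I: "I \<subseteq> {1..h}" "I \<noteq> {}" and C: "C \<ge> 0"
    and IH: "\<And>S m. S \<subset> I \<Longrightarrow> S \<noteq> {} \<Longrightarrow> 1 \<le> m \<Longrightarrow> m \<le> n \<Longrightarrow> real (card (reps S m A)) \<le> C * F m"
    and Cb: "Cb = 2 * (sconst h B * M ^ h) + 8 / cL + 1" and K: "K = real ((window_disj * h * h) ^
        h)"
  shows "real (card (reps I n A)) \<le> real (h + 1) * 2 ^ h * (Cb * real h * real h * K + K * C) * F n"
proof -
  have fI: "finite I" "card I \<le> h" using I finite_subset subset_card_le by auto
  have Fn0: "F n > 0" using n by linarith
  have Cb0: "Cb \<ge> 0" using sconst1 M cL by (simp add: Cb)
  have K0: "K \<ge> 0" by (simp add: K)
  have dhh: "window_disj * h * h \<ge> 1" using h2 by (simp add: window_disj_def)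
  have noW: "\<nexists>L. disj_hits (win J b {thr n (Suc j)<..n} (B * thr n j) m) (\<lambda>k. k ` J) A L \<and> card L =
      window_disj"
    if "j \<le> h" "J \<subseteq> {1..h}" "J \<noteq> {}" "J \<noteq> {1..h}" "m \<le> n" for j J m
  proof -
    have "(j, J, m) \<in> {..h} \<times> (Pow {1..h} - {{}, {1..h}}) \<times> {..n}" using that by auto
    then show ?thesis using good unfolding good_def by blast
  qed
  have noD: "\<nexists>L. disj_hits (sol I b {1..n} n) (\<lambda>k. k ` I) A L \<and> card L = full_disj M n"
    using good(1) I unfolding good_def by blast
  have HK: "card (hits (win J b {thr n (Suc j)<..n} (B * thr n j) m) (\<lambda>k. k ` J) A) \<le> (window_disj
      * h * h) ^ h"
    if j: "j \<le> h" and J: "J \<subset> I" and m: "m \<le> n" for j J m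
  proof -
    have fJ: "finite J" using J fI(1) by (meson finite_subset psubset_imp_subset)
    have cJ: "card J \<le> h" using J I by (intro subset_card_le) auto
    have "card (hits (win J b {thr n (Suc j)<..n} (B * thr n j) m) (\<lambda>k. k ` J) A) \<le> (window_disj *
        h * h) ^ card J"
    proof (rule card_hits_window_le)
      fix J' m' assume "J' \<subseteq> J" "J' \<noteq> {}" "m' \<le> m"
      then show "\<nexists>L. disj_hits (win J' b {thr n (Suc j)<..n} (B * thr n j) m') (\<lambda>k. k ` J') A L \<and>
          card L = window_disj"
        using J I m j by (intro noW) auto
    qed (use fJ cJ in auto)
    also have "\<dots> \<le> (window_disj * h * h) ^ h" using cJ dhh by (intro power_increasing) auto
    finally show ?thesis .
  qed
  define X where "X j S = {k \<in> reps I n A. (\<forall>i\<in>S. k i \<le> thr n j) \<and> (\<forall>i\<in>I - S. thr n (Suc j) < k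
      i)}" for j S
  define Z where "Z = (Cb * real h * real h * K + K * C) * F n"
  have finX: "finite (X j S)" for j S using finite_reps[OF I(1)] by (simp add: X_def)
  have Xb: "real (card (X j S)) \<le> Z" if j: "j \<le> h" and S: "S \<subseteq> I" for j S
  proof -
    consider "S = {}" | "S = I" | "S \<noteq> {}" "S \<noteq> I" by auto
    then show ?thesis
    proof cases
      \<comment> \<open>All entries are large. \<open>full_disj\<close> is of order
        \<open>F n\<close> and bounds disjoint families; fixing one entry leaves an exact equation
        in fewer unknowns, covered by the window bound because slack 0 is allowed there.\<close>
      case 1
      let ?V = "{thr n (Suc j)<..n}"
      have "X j S \<subseteq> hits (win I b ?V 0 n) (\<lambda>k. k ` I) A"
        using 1 by (auto simp: X_def reps_def hits_def win_zero sol_def PiE_iff)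
      then have "card (X j S) \<le> card (hits (win I b ?V 0 n) (\<lambda>k. k ` I) A)"
        using fI by (intro card_mono) auto
      also have "\<dots> \<le> full_disj M n * h * h * (window_disj * h * h) ^ h"
      proof (rule card_hits_step)
        show "\<nexists>L. disj_hits (win I b ?V 0 n) (\<lambda>k. k ` I) A L \<and> card L = full_disj M n"
        proof
          assume "\<exists>L. disj_hits (win I b ?V 0 n) (\<lambda>k. k ` I) A L \<and> card L = full_disj M n"
          then obtain L where L: "disj_hits (win I b ?V 0 n) (\<lambda>k. k ` I) A L" "card L = full_disj M
              n" by auto
          have "win I b ?V 0 n \<subseteq> sol I b {1..n} n" by (auto simp: win_zero sol_def PiE_iff)
          then show False using disj_hits_mono[OF L(1)] L(2) noD by blast
        qed
        fix i v assume i: "i \<in> I"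
        have "card (hits (win (I - {i}) b ?V 0 (n - b i * v)) (\<lambda>k. k ` (I - {i})) A)
           \<le> card (hits (win (I - {i}) b ?V (B * thr n j) (n - b i * v)) (\<lambda>k. k ` (I - {i})) A)"
          using fI win_mono[of ?V ?V 0 "B * thr n j" "I - {i}" b "n - b i * v"]
          by (intro card_mono) (auto simp: hits_def)
        also have "\<dots> \<le> (window_disj * h * h) ^ h" using i j by (intro HK) auto
        finally show "card (hits (win (I - {i}) b ?V 0 (n - b i * v)) (\<lambda>k. k ` (I - {i})) A) \<le>
            (window_disj * h * h) ^ h" .
      qed (use fI I in auto)
      finally have "real (card (X j S)) \<le> real (full_disj M n * h * h * (window_disj * h * h) ^ h)"
          by (simp only: of_nat_le_iff)
      also have "\<dots> = real (full_disj M n) * (real h * real h * K)" by (simp add: K)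
      also have "\<dots> \<le> Cb * F n * (real h * real h * K)"
        using full_disj_le[OF M n(1,2)] K0 by (intro mult_right_mono) (auto simp: Cb)
      also have "\<dots> \<le> Z" using K0 C Fn0 by (simp add: Z_def algebra_simps)
      finally show ?thesis .
    next
      case 2
      have "X j S = {}"
      proof (rule ccontr)
        assume "X j S \<noteq> {}"
        then obtain k where k: "k \<in> X j S" by auto
        have ks: "(\<Sum>i\<in>I. b i * k i) = n" using k by (auto simp: X_def reps_def hits_def sol_def)
        have "(\<Sum>i\<in>I. b i * k i) \<le> (\<Sum>i\<in>I. b i * thr n h)"
        proof (intro sum_mono mult_left_mono)
          fix i assume "i \<in> I"
          then have "k i \<le> thr n j" using k 2 by (auto simp: X_def)
          also have "\<dots> \<le> thr n h" using monoD[OF thr_mono[OF n(3)] j] .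
          finally show "k i \<le> thr n h" .
        qed auto
        also have "\<dots> = sum b I * thr n h" by (simp add: sum_distrib_right)
        also have "\<dots> \<le> B * thr n h" using sum_le_B[OF I(1)] by (intro mult_right_mono) auto
        finally show False using ks n by simp
      qed
      then show ?thesis using Cb0 K0 C Fn0 by (simp add: Z_def)
    next
      \<comment> \<open>Boundedly many large parts, each with at most \<open>C * F n\<close>
        completions. The remaining target can be any number up to \<open>n\<close>, hence the
        induction hypothesis for all \<open>m \<le> n\<close>.\<close>
      case 3
      let ?H = "hits (win (I - S) b {thr n (Suc j)<..n} (B * thr n j) n) (\<lambda>k. k ` (I - S)) A"
      have "card (X j S) \<le> (\<Sum>u\<in>?H. card (reps S (n - (\<Sum>i\<in>I - S. b i * u i)) A))"
        unfolding X_def by (rule card_mixed_reps_le[OF I(1) S])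
      then have "real (card (X j S)) \<le> (\<Sum>u\<in>?H. real (card (reps S (n - (\<Sum>i\<in>I - S. b i * u i)) A)))"
        by (simp flip: of_nat_sum)
      also have "\<dots> \<le> (\<Sum>u\<in>?H. C * F n)"
      proof (rule sum_mono)
        fix u
        let ?m = "n - (\<Sum>i\<in>I - S. b i * u i)"
        show "real (card (reps S ?m A)) \<le> C * F n"
        proof (cases "?m = 0")
          case True
          have "sol S b {1..?m} 0 = {}" 
            using 3 S I bpos finite_subset[OF S fI(1)] by (intro sol_zero) auto
          then have "reps S ?m A = {}" using True by (simp add: reps_def hits_def)
          then show ?thesis using C Fn0 by simp
        next
          case False
          then have m: "real 1 \<le> real ?m" "real ?m \<le> real n" by (simp_all only: of_nat_le_iff)
          have "real (card (reps S ?m A)) \<le> C * F ?m" using 3 S False by (intro IH) auto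
          also have "\<dots> \<le> C * F n" using C m by (intro mult_left_mono Fmono) (simp_all only:
              of_nat_1)
          finally show ?thesis .
        qed
      qed
      also have "\<dots> = real (card ?H) * (C * F n)" by simp
      also have "\<dots> \<le> K * (C * F n)"
      proof (rule mult_right_mono)
        have "card ?H \<le> (window_disj * h * h) ^ h" using 3 S j by (intro HK) auto
        then show "real (card ?H) \<le> K" unfolding K by (simp only: of_nat_le_iff)
      qed (use C Fn0 in auto)
      also have "\<dots> \<le> Z" using K0 Cb0 Fn0 by (simp add: Z_def algebra_simps)
      finally show ?thesis .
    qed
  qed
  have "reps I n A \<subseteq> (\<Union>(j, S)\<in>{..h} \<times> Pow I. X j S)"
  proof
    fix k assume k: "k \<in> reps I n A"
    obtain j where j: "j \<le> h" "\<forall>i\<in>I. k i \<le> thr n j \<or> thr n (Suc j) < k i"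
      using exists_gap[OF fI thr_mono[OF n(3)]] by blast
    let ?S = "{i\<in>I. k i \<le> thr n j}"
    have "k \<in> X j ?S" using k j by (auto simp: X_def)
    then show "k \<in> (\<Union>(j, S)\<in>{..h} \<times> Pow I. X j S)" using j by (intro UN_I[of "(j, ?S)"]) auto
  qed
  then have "card (reps I n A) \<le> card (\<Union>(j, S)\<in>{..h} \<times> Pow I. X j S)"
    using fI finX by (intro card_mono) auto
  also have "\<dots> \<le> (\<Sum>(j, S)\<in>{..h} \<times> Pow I. card (X j S))"
    using fI by (intro order_trans[OF card_UN_le]) (auto simp: case_prod_unfold)
  finally have "real (card (reps I n A)) \<le> (\<Sum>(j, S)\<in>{..h} \<times> Pow I. real (card (X j S)))"
    by (simp add: case_prod_unfold flip: of_nat_sum)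
  also have "\<dots> \<le> (\<Sum>(j, S)\<in>{..h} \<times> Pow I. Z)" by (intro sum_mono) (use Xb in auto)
  also have "\<dots> = real (h + 1) * 2 ^ card I * Z"
    using fI by (simp only: case_prod_unfold sum_constant card_cartesian_product card_atMost
        card_Pow of_nat_mult of_nat_power of_nat_numeral Suc_eq_plus1)
  also have "\<dots> \<le> real (h + 1) * 2 ^ h * Z"
    using fI Cb0 K0 C Fn0 by (intro mult_right_mono mult_left_mono power_increasing) (auto simp:
        Z_def)
  finally show ?thesis by (simp add: Z_def mult_ac)
qed

text \<open>Induction on the number of unknowns. The constant precedes \<open>N\<close> and
  \<open>A\<close> in the quantifiers, as the later passage to the limit needs uniformity; targets
  below \<open>n1\<close> are included because small parts of a representation can have any
  target.\<close>

lemma upper_bound: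
  assumes M: "M \<ge> 1" and n1: "\<And>n. n \<ge> n1 \<Longrightarrow> 1 \<le> n \<and> F n \<ge> 1 \<and> \<tau> n \<ge> 1 \<and> B * thr n h < n"
  shows "\<exists>C\<ge>0. \<forall>N A. (\<forall>n\<in>{n1..N}. good M n A) \<longrightarrow>
     (\<forall>n\<in>{1..N}. \<forall>I. I \<subseteq> {1..h} \<longrightarrow> I \<noteq> {} \<longrightarrow> card I \<le> l \<longrightarrow> real (card (reps I n A)) \<le> C * F n)"
proof (induction l)
  case 0
  have "\<not> card I \<le> 0" if "I \<subseteq> {1..h}" "I \<noteq> {}" for I :: "nat set"
    using that finite_subset[of I "{1..h}"] by auto
  then show ?case by (intro exI[of _ 0] conjI allI impI ballI order_refl) blast
next
  case (Suc l)
  then obtain C where C: "C \<ge> 0" and IH: "\<forall>N A. (\<forall>n\<in>{n1..N}. good M n A) \<longrightarrow>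
     (\<forall>n\<in>{1..N}. \<forall>I. I \<subseteq> {1..h} \<longrightarrow> I \<noteq> {} \<longrightarrow> card I \<le> l \<longrightarrow> real (card (reps I n A)) \<le> C * F n)"
    by (elim exE conjE)
  define Cb where "Cb = 2 * (sconst h B * M ^ h) + 8 / cL + 1"
  define K where "K = real ((window_disj * h * h) ^ h)"
  \<comment> \<open>Below \<open>n1\<close> the trivial count is at most \<open>n1 ^ h\<close>, and
    \<open>F n \<ge> F 1\<close>.\<close>
  define C1 where "C1 = real n1 ^ h / F 1"
  define C2 where "C2 = exp 1 * (sconst h B * M ^ h)"
  define C3 where "C3 = real (h + 1) * 2 ^ h * (Cb * real h * real h * K + K * C)"
  have pos: "C1 \<ge> 0" "C2 \<ge> 0" "C3 \<ge> 0"
    using Fpos[of 1] sconst1 M C cL by (auto simp: C1_def C2_def C3_def Cb_def K_def)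
  have "real (card (reps I n A)) \<le> (C1 + C2 + C3) * F n"
    if good: "\<forall>n\<in>{n1..N}. good M n A" and n: "n \<in> {1..N}" and I: "I \<subseteq> {1..h}" "I \<noteq> {}" "card I \<le>
        Suc l" for N A n I
  proof -
    have Fn: "F n > 0" using n by (intro Fpos) auto
    have "real (card (reps I n A)) \<le> C1 * F n \<or> real (card (reps I n A)) \<le> C2 * F n
      \<or> real (card (reps I n A)) \<le> C3 * F n"
    proof (cases "n < n1")
      case True
      have "card (reps I n A) \<le> n ^ (card I - 1)" by (rule card_reps_le[OF I(1,2)])
      also have "\<dots> \<le> n ^ h" using n subset_card_le[OF I(1)] by (intro power_increasing) auto
      also have "\<dots> \<le> n1 ^ h" using True by (intro power_mono) auto
      finally have "real (card (reps I n A)) \<le> real n1 ^ h" by (metis of_nat_le_iff of_nat_power)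
      also have "\<dots> = C1 * F 1" using Fpos[of 1] by (simp add: C1_def)
      also have "\<dots> \<le> C1 * F n" using pos n by (intro mult_left_mono Fmono) auto
      finally show ?thesis by simp
    next
      case False
      then have g: "good M n A" using good n by auto
      have nn: "1 \<le> n" "F n \<ge> 1" "\<tau> n \<ge> 1" "B * thr n h < n" using n1[of n] False by auto
      show ?thesis
      proof (cases "rich M n")
        case True
        then have "\<not> (\<exists>I\<in>Pow {1..h} - {{}}. exp 1 * (sconst h B * Q M n ^ h) \<le> real (card (reps I n
            A)))"
          using g by (simp add: good_def)
        moreover have "I \<in> Pow {1..h} - {{}}" using I by simp
        ultimately have "\<not> exp 1 * (sconst h B * Q M n ^ h) \<le> real (card (reps I n A))" by (meson
            bexI)
        then show ?thesis by (simp add: C2_def Q_power[OF nn(1)] mult_ac)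
      next
        case False
        have "real (card (reps I n A)) \<le> C3 * F n"
          unfolding C3_def
        proof (rule poor_bound[OF M nn g False I(1,2) C _ Cb_def K_def])
          fix S m assume S: "S \<subset> I" "S \<noteq> {}" and m: "1 \<le> m" "m \<le> n"
          have "card S < card I" using finite_subset[OF I(1)] by (intro psubset_card_mono S) auto
          then have cS: "card S \<le> l" using I(3) by linarith
          have Sh: "S \<subseteq> {1..h}" and mN: "m \<in> {1..N}" using S m I(1) n by auto
          show "real (card (reps S m A)) \<le> C * F m"
            by (rule IH[rule_format, OF _ mN Sh S(2) cS]) (use good in blast)
        qed
        then show ?thesis by simp
      qed
    qed
    moreover have "C1 * F n \<le> (C1 + C2 + C3) * F n" "C2 * F n \<le> (C1 + C2 + C3) * F n"
      "C3 * F n \<le> (C1 + C2 + C3) * F n"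
      using pos Fn by (auto intro!: mult_right_mono)
    ultimately show ?thesis by linarith
  qed
  then show ?case using pos by (intro exI[of _ "C1 + C2 + C3"] conjI allI impI ballI) simp_all
qed

end

section \<open>Existence of the set\<close>

text \<open>Koenig's lemma on the binary tree of finite traces, applicable since \<open>P n\<close>
  only depends on the elements up to \<open>n\<close>.\<close>

lemma nat_set_compactness:
  fixes P :: "nat \<Rightarrow> nat set \<Rightarrow> bool"
  assumes local: "\<And>n A A'. A \<inter> {..n} = A' \<inter> {..n} \<Longrightarrow> P n A \<Longrightarrow> P n A'"
    and fin: "\<And>N. \<exists>A. \<forall>n\<le>N. P n A"
  shows "\<exists>A. \<forall>n. P n A"
proof -
  \<comment> \<open>The trace \<open>S\<close> below \<open>N\<close> extends, for every
    \<open>N'\<close>, to a set satisfying all conditions up to \<open>N'\<close>. If both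
    continuations at \<open>N\<close> failed, a set good up to the larger of the two failure bounds
    would give a contradiction.\<close>
  define ok where "ok N S \<longleftrightarrow> (\<forall>N'. \<exists>A. A \<inter> {..<N} = S \<and> (\<forall>n\<le>N'. P n A))" for N S
  have step: "\<exists>S'. ok (Suc N) S' \<and> S' \<inter> {..<N} = S" if okS: "ok N S" for N S
  proof (rule ccontr)
    assume neg: "\<not> ?thesis"
    have SN: "S \<subseteq> {..<N}" using okS unfolding ok_def by blast
    have "\<not> ok (Suc N) S" "\<not> ok (Suc N) (insert N S)" using neg SN by auto
    then obtain N1 N2 where N1: "\<And>A. A \<inter> {..<Suc N} = S \<Longrightarrow> \<exists>n\<le>N1. \<not> P n A"
      and N2: "\<And>A. A \<inter> {..<Suc N} = insert N S \<Longrightarrow> \<exists>n\<le>N2. \<not> P n A"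
      unfolding ok_def by metis
    obtain A where A: "A \<inter> {..<N} = S" "\<forall>n\<le>max N1 N2. P n A" using okS unfolding ok_def by blast
    have "A \<inter> {..<Suc N} = (if N \<in> A then insert N S else S)"
      using A(1) by (auto simp: lessThan_Suc)
    then show False using N1[of A] N2[of A] A(2) by (auto split: if_splits)
  qed
  have "ok 0 {}" unfolding ok_def using fin by auto
  then have "\<exists>f. \<forall>N. ok N (f N) \<and> f (Suc N) \<inter> {..<N} = f N"
    using step by (intro dependent_nat_choice) (auto simp: ok_def)
  then obtain f where ok: "\<And>N. ok N (f N)" and f: "\<And>N. f (Suc N) \<inter> {..<N} = f N" by auto
  define A where "A = (\<Union>N. f N)"
  have sub: "f N \<subseteq> {..<N}" for N using ok[of N] unfolding ok_def by blast
  have ext: "f (N + k) \<inter> {..<N} = f N" for N k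
  proof (induction k)
    case 0
    then show ?case using sub by auto
  next
    case (Suc k)
    have "f (Suc (N + k)) \<inter> {..<N} = f (Suc (N + k)) \<inter> {..<N + k} \<inter> {..<N}" by auto
    then show ?case using f[of "N + k"] Suc by simp
  qed
  have AN: "A \<inter> {..<N} = f N" for N
  proof
    show "f N \<subseteq> A \<inter> {..<N}" using sub[of N] by (auto simp: A_def)
    show "A \<inter> {..<N} \<subseteq> f N"
    proof
      fix x assume x: "x \<in> A \<inter> {..<N}"
      then obtain N' where N': "x \<in> f N'" by (auto simp: A_def)
      show "x \<in> f N"
      proof (cases "N \<le> N'")
        case True
        then show ?thesis using ext[of N "N' - N"] N' x by auto
      next
        case False
        then show ?thesis using ext[of N' "N - N'"] N' by auto
      qed
    qed
  qed
  have "P n A" for n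
  proof -
    obtain A' where A': "A' \<inter> {..<Suc n} = f (Suc n)" "\<forall>m\<le>n. P m A'"
      using ok[of "Suc n"] unfolding ok_def by blast
    have "A' \<inter> {..n} = A \<inter> {..n}" using A'(1) AN[of "Suc n"] by (simp add: lessThan_Suc_atMost)
    then show ?thesis using local A'(2) by blast
  qed
  then show ?thesis by blast
qed

lemma sum_inverse_squares_le:
  assumes "n1 \<ge> 2"
  shows "(\<Sum>n\<in>{n1..N}. 1 / real n ^ 2) \<le> 1 / (real n1 - 1)"
proof (cases "n1 \<le> N")
  case True
  then obtain k where N: "N = n1 + k" using le_Suc_ex by blast
  have "(\<Sum>n\<in>{n1..n1 + k}. 1 / real n ^ 2) \<le> 1 / (real n1 - 1) - 1 / real (n1 + k)" for k
  proof (induction k)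
    case 0
    show ?case using assms by (simp add: field_simps power2_eq_square)
  next
    case (Suc k)
    define x where "x = real (n1 + k)"
    have x: "x > 0" using assms by (simp add: x_def)
    have "1 / (x + 1) ^ 2 \<le> 1 / x - 1 / (x + 1)"
    proof -
      have "1 / x - 1 / (x + 1) = 1 / (x * (x + 1))" using x by (simp add: field_simps)
      moreover have "1 / (x + 1) ^ 2 \<le> 1 / (x * (x + 1))"
        using x by (intro divide_left_mono) (auto simp: power2_eq_square)
      ultimately show ?thesis by simp
    qed
    then show ?case using Suc by (simp add: x_def algebra_simps)
  qed
  from this[of k] have "(\<Sum>n\<in>{n1..N}. 1 / real n ^ 2) \<le> 1 / (real n1 - 1) - 1 / real N" by (simp
      only: N)
  also have "\<dots> \<le> 1 / (real n1 - 1)" by simp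
  finally show ?thesis .
next
  case False
  then show ?thesis using assms by simp
qed

lemma bprob_or:
  assumes "finite V" "\<And>v. v \<in> V \<Longrightarrow> 0 \<le> p v \<and> p v \<le> 1"
  shows "bprob V p (\<lambda>S. E S \<or> E' S) \<le> bprob V p E + bprob V p E'"
  unfolding bprob_def bexp_add[symmetric] using assms by (intro bexp_mono) auto

lemma bprob_and_const:
  assumes "a \<Longrightarrow> bprob V p E \<le> e" "e \<ge> 0"
  shows "bprob V p (\<lambda>S. a \<and> E S) \<le> e"
  using assms by (cases a) (auto simp: bprob_def bexp_def)

context growth
begin

lemma reps_local:
  assumes "A \<inter> {1..n} = A' \<inter> {1..n}"
  shows "reps I n A = reps I n A'"
proof -
  have "k ` I \<subseteq> A \<longleftrightarrow> k ` I \<subseteq> A'" if "k \<in> sol I b {1..n} n" for k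
    using sol_image[OF that] assms by blast
  then show ?thesis unfolding reps_def hits_def by auto
qed

text \<open>The constants and \<open>n1\<close> come before \<open>N\<close>. The failure
  probabilities at single \<open>n\<close> are summable, and starting at a large \<open>n1\<close>
  makes their sum less than 1.\<close>

lemma finite_construction:
  "\<exists>c>0. \<exists>C\<ge>0. \<exists>n1. \<forall>N. \<exists>A. \<forall>n\<in>{n1..N}.
     c * F n \<le> real (card (reps {1..h} n A)) \<and> real (card (reps {1..h} n A)) \<le> C * F n"
proof -
  obtain M c where M: "M \<ge> 1" and c: "c > 0"
    and low: "eventually (\<lambda>n. \<forall>N\<ge>n. bprob {1..N} (prb M) (\<lambda>S. real (card (reps {1..h} n S)) \<le> c * F
        n) \<le> 1 / real n ^ 3) sequentially"
    using lower_tail by blast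
  \<comment> \<open>Collects the numerators of the four failure probabilities over
    \<open>n ^ 3\<close>; for \<open>n \<ge> K\<close> their sum is at most
    \<open>1 / n ^ 2\<close>.\<close>
  define K where "K = 1 + 2 * 2 ^ h + 6 * (real h + 1) * 2 ^ h"
  define bad where "bad n S \<longleftrightarrow> real (card (reps {1..h} n S)) \<le> c * F n \<or> \<not> good M n S" for n S
  have "eventually (\<lambda>n. (1 \<le> n \<and> F n \<ge> 1 \<and> \<tau> n \<ge> 1 \<and> B * thr n h < n) \<and>
     (\<forall>N\<ge>n. bprob {1..N} (prb M) (bad n) \<le> 1 / real n ^ 2)) sequentially"
    using low rich_tail[OF M] window_tail[OF M] disjoint_tail[OF M] eventually_tau_ge
        eventually_thr_less
      eventually_F_ge[of 1] eventually_ge_at_top[of 1] eventually_ge_at_top[of "nat \<lceil>K\<rceil>"]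
  proof eventually_elim
    case (elim n)
    have n0: "real n \<ge> 1" using elim by simp
    have "bprob {1..N} (prb M) (bad n) \<le> 1 / real n ^ 2" if N: "N \<ge> n" for N
    proof -
      let ?P = "bprob {1..N} (prb M)"
      let ?E1 = "\<lambda>S. real (card (reps {1..h} n S)) \<le> c * F n"
      let ?E2 = "\<lambda>S. \<exists>I\<in>Pow {1..h} - {{}}. exp 1 * (sconst h B * Q M n ^ h) \<le> real (card (reps I n
          S))"
      let ?E3 = "\<lambda>S. \<exists>(j, I, m)\<in>{..h} \<times> (Pow {1..h} - {{}, {1..h}}) \<times> {..n}.
        \<exists>L. disj_hits (win I b {thr n (Suc j)<..n} (B * thr n j) m) (\<lambda>k. k ` I) S L \<and> card L =
            window_disj"
      let ?E4 = "\<lambda>S. \<exists>I\<in>Pow {1..h} - {{}}. \<exists>L. disj_hits (sol I b {1..n} n) (\<lambda>k. k ` I) S L \<and> card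
          L = full_disj M n"
      have pr: "\<And>v. v \<in> {1..N} \<Longrightarrow> 0 \<le> prb M v \<and> prb M v \<le> 1" using M by (intro prb_range) auto
      have f: "finite {1..N}" by simp
      have "?P (bad n) \<le> ?P (\<lambda>S. ?E1 S \<or> ((rich M n \<and> ?E2 S) \<or> ((\<not> rich M n \<and> ?E3 S) \<or> ?E4 S)))"
      proof (rule bprob_mono[OF f pr])
        fix S assume "bad n S"
        then show "?E1 S \<or> ((rich M n \<and> ?E2 S) \<or> ((\<not> rich M n \<and> ?E3 S) \<or> ?E4 S))"
          unfolding bad_def good_def by argo
      qed
      also have "\<dots> \<le> ?P ?E1 + ?P (\<lambda>S. (rich M n \<and> ?E2 S) \<or> ((\<not> rich M n \<and> ?E3 S) \<or> ?E4 S))"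
        by (rule bprob_or[OF f pr])
      also have "?P (\<lambda>S. (rich M n \<and> ?E2 S) \<or> ((\<not> rich M n \<and> ?E3 S) \<or> ?E4 S))
         \<le> ?P (\<lambda>S. rich M n \<and> ?E2 S) + ?P (\<lambda>S. (\<not> rich M n \<and> ?E3 S) \<or> ?E4 S)"
        by (rule bprob_or[OF f pr])
      also have "?P (\<lambda>S. (\<not> rich M n \<and> ?E3 S) \<or> ?E4 S) \<le> ?P (\<lambda>S. \<not> rich M n \<and> ?E3 S) + ?P ?E4"
        by (rule bprob_or[OF f pr])
      finally have *: "?P (bad n) \<le> ?P ?E1 + (?P (\<lambda>S. rich M n \<and> ?E2 S) + (?P (\<lambda>S. \<not> rich M n \<and> ?E3
          S) + ?P ?E4))"
        by simp
      have p1: "?P ?E1 \<le> 1 / real n ^ 3" using elim N by blast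
      have p2: "?P (\<lambda>S. rich M n \<and> ?E2 S) \<le> 2 ^ h / real n ^ 4"
        by (rule bprob_and_const) (use elim(2) N in \<open>simp_all\<close>)
      have p3: "?P (\<lambda>S. \<not> rich M n \<and> ?E3 S) \<le> real (h + 1) * 2 ^ h * real (n + 1) * (3 / real n ^
          5)"
        by (rule bprob_and_const) (use elim(3) N in \<open>simp_all\<close>)
      have p4: "?P ?E4 \<le> 2 ^ h / real n ^ 4" using elim(4) N by blast
      have n43: "2 ^ h / real n ^ 4 \<le> 2 ^ h / real n ^ 3"
        using n0 by (intro divide_left_mono power_increasing) auto
      have "real (h + 1) * 2 ^ h * real (n + 1) * (3 / real n ^ 5) \<le> real (h + 1) * 2 ^ h * (2 *
          real n) * (3 / real n ^ 5)"
        using n0 by (intro mult_right_mono mult_left_mono) auto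
      also have "\<dots> = 6 * (real h + 1) * 2 ^ h / real n ^ 4"
        using n0 by (simp add: field_simps power_numeral_reduce)
      also have "\<dots> \<le> 6 * (real h + 1) * 2 ^ h / real n ^ 3"
        using n0 by (intro divide_left_mono power_increasing) auto
      finally have "?P (bad n) \<le> 1 / real n ^ 3 + (2 ^ h / real n ^ 3 + (6 * (real h + 1) * 2 ^ h /
          real n ^ 3 + 2 ^ h / real n ^ 3))"
        using * p1 p2 p3 p4 n43 by linarith
      also have "\<dots> = K / real n ^ 3" by (simp add: K_def add_divide_distrib)
      also have "\<dots> \<le> real n / real n ^ 3" 
      proof (rule divide_right_mono)
        show "K \<le> real n" using elim(9) by linarith
      qed simp
      also have "\<dots> = 1 / real n ^ 2" using n0 by (simp add: field_simps power_numeral_reduce)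
      finally show ?thesis .
    qed
    then show ?case using elim(5-8) by blast
  qed
  then obtain n2 where n2: "\<And>n. n \<ge> n2 \<Longrightarrow> 1 \<le> n \<and> F n \<ge> 1 \<and> \<tau> n \<ge> 1 \<and> B * thr n h < n"
    and pb: "\<And>n N. n \<ge> n2 \<Longrightarrow> N \<ge> n \<Longrightarrow> bprob {1..N} (prb M) (bad n) \<le> 1 / real n ^ 2"
    unfolding eventually_sequentially by blast
  \<comment> \<open>With \<open>n1 \<ge> 3\<close> the bound \<open>1 / (n1 - 1)\<close> for the sum
    of inverse squares is at most 1/2.\<close>
  define n1 where "n1 = max n2 3"
  have n1': "\<And>n. n \<ge> n1 \<Longrightarrow> 1 \<le> n \<and> F n \<ge> 1 \<and> \<tau> n \<ge> 1 \<and> B * thr n h < n"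
    using n2 by (simp add: n1_def)
  obtain C where C: "C \<ge> 0" and up: "\<forall>N A. (\<forall>n\<in>{n1..N}. good M n A) \<longrightarrow>
     (\<forall>n\<in>{1..N}. \<forall>I. I \<subseteq> {1..h} \<longrightarrow> I \<noteq> {} \<longrightarrow> card I \<le> h \<longrightarrow> real (card (reps I n A)) \<le> C * F n)"
  proof -
    have "\<exists>C\<ge>0. \<forall>N A. (\<forall>n\<in>{n1..N}. good M n A) \<longrightarrow>
     (\<forall>n\<in>{1..N}. \<forall>I. I \<subseteq> {1..h} \<longrightarrow> I \<noteq> {} \<longrightarrow> card I \<le> h \<longrightarrow> real (card (reps I n A)) \<le> C * F n)"
      by (rule upper_bound[OF M]) (rule n1')
    then show thesis using that by (elim exE conjE)
  qed
  have "\<exists>A. \<forall>n\<in>{n1..N}. c * F n \<le> real (card (reps {1..h} n A)) \<and> real (card (reps {1..h} n A)) \<le> C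
      * F n" for N
  proof -
    have pr: "\<And>v. v \<in> {1..N} \<Longrightarrow> 0 \<le> prb M v \<and> prb M v \<le> 1" using M by (intro prb_range) auto
    have "bprob {1..N} (prb M) (\<lambda>S. \<exists>n\<in>{n1..N}. bad n S) \<le> (\<Sum>n\<in>{n1..N}. bprob {1..N} (prb M) (bad
        n))"
      by (rule bprob_union_bound) (use pr in auto)
    also have "\<dots> \<le> (\<Sum>n\<in>{n1..N}. 1 / real n ^ 2)" by (intro sum_mono pb) (auto simp: n1_def)
    also have "\<dots> \<le> 1 / (real n1 - 1)" by (rule sum_inverse_squares_le) (simp add: n1_def)
    also have "\<dots> < 1" by (simp add: n1_def)
    finally obtain A where A: "\<not> (\<exists>n\<in>{n1..N}. bad n A)"
      using bprob_less_one_imp_ex[of "{1..N}"] by blast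
    then have g: "\<forall>n\<in>{n1..N}. good M n A" unfolding bad_def by blast
    have "c * F n \<le> real (card (reps {1..h} n A)) \<and> real (card (reps {1..h} n A)) \<le> C * F n"
      if n: "n \<in> {n1..N}" for n
    proof
      show "c * F n \<le> real (card (reps {1..h} n A))" using A n unfolding bad_def by force
      have "n \<in> {1..N}" using n by (auto simp: n1_def)
      from up[THEN spec, THEN spec, THEN mp, OF g, THEN bspec, OF this]
      show "real (card (reps {1..h} n A)) \<le> C * F n" using h2 by simp
    qed
    then show ?thesis by blast
  qed
  then show ?thesis using c C by blast
qed

text \<open>The element 0 may be removed at the end because \<open>reps\<close> only sees entries
  from \<open>{1..n}\<close>; its absence is what identifies \<open>reps\<close> with
  \<open>rep_count\<close>.\<close>

lemma infinite_construction:
  "\<exists>c>0. \<exists>C\<ge>0. \<exists>n1. \<exists>A. 0 \<notin> A \<and> (\<forall>n\<ge>n1.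
     c * F n \<le> real (card (reps {1..h} n A)) \<and> real (card (reps {1..h} n A)) \<le> C * F n)"
proof -
  obtain c C n1 where c: "c > 0" "C \<ge> 0" and fin: "\<And>N. \<exists>A. \<forall>n\<in>{n1..N}.
     c * F n \<le> real (card (reps {1..h} n A)) \<and> real (card (reps {1..h} n A)) \<le> C * F n"
    using finite_construction by blast
  let ?P = "\<lambda>n A. n \<ge> n1 \<longrightarrow> c * F n \<le> real (card (reps {1..h} n A)) \<and> real (card (reps {1..h} n A))
      \<le> C * F n"
  have "\<exists>A. \<forall>n. ?P n A"
  proof (rule nat_set_compactness)
    fix n A A' assume eq: "A \<inter> {..n} = A' \<inter> {..n}" and P: "?P n A"
    have "A \<inter> {1..n} = (A \<inter> {..n}) \<inter> {1..n}" by auto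
    also have "\<dots> = A' \<inter> {1..n}" unfolding eq by auto
    finally have "reps {1..h} n A = reps {1..h} n A'" by (rule reps_local)
    then show "?P n A'" using P by simp
  next
    fix N show "\<exists>A. \<forall>n\<le>N. ?P n A" using fin[of N] by (metis atLeastAtMost_iff)
  qed
  then obtain A where A: "\<And>n. ?P n A" by blast
  have "reps {1..h} n (A - {0}) = reps {1..h} n A" for n by (rule reps_local) auto
  then have "0 \<notin> A - {0} \<and> (\<forall>n\<ge>n1. c * F n \<le> real (card (reps {1..h} n (A - {0})))
     \<and> real (card (reps {1..h} n (A - {0}))) \<le> C * F n)" using A by simp
  then show ?thesis using c by blast
qed

end

section \<open>Counting functions and the theorem\<close>

context growth
begin

lemma rep_count_eq:
  assumes "0 \<notin> A"
  shows "rep_count b A h n = card (reps {1..h} n A)"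
proof -
  let ?K = "{k :: nat \<Rightarrow> nat. (\<forall>i\<in>{1..h}. k i \<in> A) \<and> (\<forall>i. i \<notin> {1..h} \<longrightarrow> k i = 0)
      \<and> (\<Sum>i=1..h. b i * k i) = n}"
  let ?r = "\<lambda>k. restrict k {1..h}"
  have "bij_betw ?r ?K (reps {1..h} n A)"
  proof (rule bij_betw_imageI)
    show "inj_on ?r ?K"
    proof (rule inj_onI)
      fix k l assume k: "k \<in> ?K" and l: "l \<in> ?K" and eq: "?r k = ?r l"
      show "k = l"
      proof
        fix i show "k i = l i" using fun_cong[OF eq, of i] k l by (cases "i \<in> {1..h}") auto
      qed
    qed
    show "?r ` ?K = reps {1..h} n A"
    proof (intro equalityI image_subsetI subsetI)
      fix k assume k: "k \<in> ?K"
      have sum: "(\<Sum>i\<in>{1..h}. b i * ?r k i) = n" using k by simp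
      have "k i \<in> {1..n}" if i: "i \<in> {1..h}" for i
      proof -
        have "k i \<in> A" using k i by auto
        then have "k i \<noteq> 0" using assms by metis
        moreover have "k i \<le> b i * k i" using bpos[OF i] by simp
        moreover have "b i * k i \<le> (\<Sum>i=1..h. b i * k i)" using i by (intro member_le_sum) auto
        moreover have "(\<Sum>i=1..h. b i * k i) = n" using k by simp
        ultimately have "1 \<le> k i" "k i \<le> n" by linarith+
        then show ?thesis by simp
      qed
      then show "?r k \<in> reps {1..h} n A"
        using k sum by (auto simp: reps_def hits_def sol_def)
    next
      fix k assume k: "k \<in> reps {1..h} n A"
      let ?k = "\<lambda>i. if i \<in> {1..h} then k i else 0"
      have kP: "k \<in> {1..h} \<rightarrow>\<^sub>E {1..n}" and kA: "\<And>i. i \<in> {1..h} \<Longrightarrow> k i \<in> A"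
        and ks: "(\<Sum>i\<in>{1..h}. b i * k i) = n" using k by (auto simp: reps_def hits_def sol_def)
      have "k = ?r ?k"
      proof
        fix i show "k i = ?r ?k i" using kP by (cases "i \<in> {1..h}") (auto simp: PiE_def
            extensional_def)
      qed
      moreover have "?k \<in> ?K" using kA ks by auto
      ultimately show "k \<in> ?r ` ?K" by (rule image_eqI)
    qed
  qed
  then show ?thesis unfolding rep_count_def by (rule bij_betw_same_card)
qed

lemma reps_disjoint: "m \<noteq> n \<Longrightarrow> reps I m A \<inter> reps I n A = {}"
  by (auto simp: reps_def hits_def sol_def)

text \<open>Each \<open>h\<close>-tuple from \<open>A\<close> represents exactly one integer, which
  lies between 1 and \<open>B * m\<close>.\<close>

lemma card_power_le_sum_reps:
  assumes "A \<subseteq> {1..m}"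
  shows "card A ^ h \<le> (\<Sum>n\<in>{1..B * m}. card (reps {1..h} n A))"
proof -
  have fA: "finite A" using assms finite_subset by auto
  have "({1..h} \<rightarrow>\<^sub>E A) \<subseteq> (\<Union>n\<in>{1..B * m}. reps {1..h} n A)"
  proof
    fix k assume k: "k \<in> {1..h} \<rightarrow>\<^sub>E A"
    let ?n = "\<Sum>i\<in>{1..h}. b i * k i"
    have km: "1 \<le> k i \<and> k i \<le> m" if "i \<in> {1..h}" for i using PiE_mem[OF k that] assms by auto
    have kn: "k i \<le> ?n" if i: "i \<in> {1..h}" for i
    proof -
      have "k i \<le> b i * k i" using bpos[OF i] by simp
      also have "\<dots> \<le> ?n" using i by (intro member_le_sum) auto
      finally show ?thesis .
    qed
    have "1 \<le> ?n" using kn[of 1] km[of 1] h2 by auto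
    moreover have "?n \<le> (\<Sum>i\<in>{1..h}. b i * m)" using km by (intro sum_mono mult_left_mono) auto
    then have "?n \<le> B * m" by (simp add: B_def sum_distrib_right)
    moreover have "k \<in> reps {1..h} ?n A"
      using k kn km by (auto simp: reps_def hits_def sol_def PiE_iff)
    ultimately show "k \<in> (\<Union>n\<in>{1..B * m}. reps {1..h} n A)" by auto
  qed
  then have "card ({1..h} \<rightarrow>\<^sub>E A) \<le> card (\<Union>n\<in>{1..B * m}. reps {1..h} n A)"
    using finite_reps by (intro card_mono) auto
  also have "\<dots> \<le> (\<Sum>n\<in>{1..B * m}. card (reps {1..h} n A))" by (rule card_UN_le) simp
  finally show ?thesis by (simp add: card_PiE)
qed

text \<open>Representations of distinct integers are distinct tuples, and the entries of a
  representation do not exceed the integer represented.\<close>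

lemma sum_reps_le_card_power:
  "(\<Sum>n\<in>X. card (reps {1..h} n A)) \<le> card (A \<inter> {1..m}) ^ h" if "X \<subseteq> {..m}"
proof -
  have fX: "finite X" using that finite_subset by auto
  have "(\<Sum>n\<in>X. card (reps {1..h} n A)) = card (\<Union>n\<in>X. reps {1..h} n A)"
    using fX finite_reps reps_disjoint by (intro card_UN_disjoint[symmetric]) auto
  also have "\<dots> \<le> card ({1..h} \<rightarrow>\<^sub>E (A \<inter> {1..m}))"
  proof (intro card_mono UN_least)
    fix n assume "n \<in> X"
    then have nm: "n \<le> m" using that by blast
    show "reps {1..h} n A \<subseteq> {1..h} \<rightarrow>\<^sub>E (A \<inter> {1..m})"
    proof
      fix k assume "k \<in> reps {1..h} n A"
      then have kP: "k \<in> {1..h} \<rightarrow>\<^sub>E {1..n}" and kA: "k ` {1..h} \<subseteq> A"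
        unfolding reps_def hits_def sol_def by simp_all
      show "k \<in> {1..h} \<rightarrow>\<^sub>E (A \<inter> {1..m})"
      proof (rule PiE_I)
        fix i assume "i \<in> {1..h}"
        then show "k i \<in> A \<inter> {1..m}" using PiE_mem[OF kP, of i] kA nm by (simp add:
            image_subset_iff)
      qed (rule PiE_arb[OF kP])
    qed
  qed (auto intro!: finite_PiE)
  finally show ?thesis by (simp add: card_PiE)
qed

text \<open>The upper estimate counts tuples by the integers up to \<open>B * m\<close> that they
  represent; the lower one uses the integers in the upper half of \<open>{..m}\<close>. The doubling
  condition makes \<open>F\<close> comparable at all these arguments.\<close>

lemma counting_bounds:
  assumes A: "0 \<notin> A" and c: "c > 0" "C \<ge> 0"
    and r: "\<And>n. n \<ge> n1 \<Longrightarrow> c * F n \<le> real (card (reps {1..h} n A)) \<and> real (card (reps {1..h} n A)) \<le>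
        C * F n"
  shows "\<exists>K>0. \<exists>K'>0. eventually (\<lambda>x. K * (x * F x) \<le> real (count_upto A x) ^ h \<and>
    real (count_upto A x) ^ h \<le> K' * (x * F x)) at_top"
proof -
  \<comment> \<open>Extends the upper bound from \<open>n \<ge> n1\<close> to all
    \<open>n \<ge> 1\<close>.\<close>
  define C' where "C' = C + real n1 ^ h / F 1"
  have F1: "F 1 > 0" by (rule Fpos) simp
  have r': "real (card (reps {1..h} n A)) \<le> C' * F n" if n: "n \<ge> 1" for n
  proof -
    have Fn: "F n > 0" using n by (intro Fpos) auto
    show ?thesis
    proof (cases "n \<ge> n1")
      case True
      then have "real (card (reps {1..h} n A)) \<le> C * F n" using r by simp
      also have "\<dots> \<le> C' * F n" using F1 Fn by (intro mult_right_mono) (auto simp: C'_def)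
      finally show ?thesis .
    next
      case False
      have "card (reps {1..h} n A) \<le> n ^ (card {1..h} - 1)" using h2 by (intro card_reps_le) auto
      also have "\<dots> \<le> n ^ h" using n by (intro power_increasing) auto
      also have "\<dots> \<le> n1 ^ h" using False by (intro power_mono) auto
      finally have "real (card (reps {1..h} n A)) \<le> real n1 ^ h" by (metis of_nat_le_iff
          of_nat_power)
      also have "\<dots> = real n1 ^ h / F 1 * F 1" using F1 by simp
      also have "\<dots> \<le> C' * F n"
        using F1 c n by (intro mult_mono Fmono) (auto simp: C'_def)
      finally show ?thesis .
    qed
  qed
  have C'0: "C' \<ge> 0" using c F1 by (simp add: C'_def)
  \<comment> \<open>One \<open>D\<close> and one 2 come from \<open>x \<le> 2 * m\<close>, the other
    \<open>D\<close> and 2 from passing to \<open>m / 2\<close> and to half of the integers.\<close>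
  define K where "K = c / (4 * D * D)"
  define K' where "K' = real B * C' * D ^ B + 1"
  have K: "K > 0" "K' > 0" using c D1 C'0 by (auto simp: K_def K'_def add_nonneg_pos)
  have "eventually (\<lambda>x. K * (x * F x) \<le> real (count_upto A x) ^ h \<and>
    real (count_upto A x) ^ h \<le> K' * (x * F x)) at_top"
    using eventually_ge_at_top[of "real (2 * n1 + 2)"]
  proof eventually_elim
    case (elim x)
    define m where "m = nat \<lfloor>x\<rfloor>"
    have x2: "x \<ge> 2" using elim by simp
    have mx: "real m \<le> x" "x < real m + 1" using x2 by (auto simp: m_def)
    have m2: "m \<ge> 2 * n1 + 2" using elim unfolding m_def by linarith
    have m1: "real m \<ge> 1" using m2 by simp
    have cnt: "count_upto A x = card (A \<inter> {1..m})"
    proof -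
      have "real a \<le> x \<longleftrightarrow> a \<le> m" for a
      proof
        assume "real a \<le> x"
        then show "a \<le> m" unfolding m_def by (rule le_nat_floor)
      next
        assume "a \<le> m"
        then have "real a \<le> real m" by simp
        then show "real a \<le> x" using mx(1) by (rule order_trans)
      qed
      then have "{a \<in> A. 1 \<le> a \<and> real a \<le> x} = A \<inter> {1..m}"
        by (intro set_eqI) (simp only: mem_Collect_eq Int_iff atLeastAtMost_iff)
      then show ?thesis by (simp add: count_upto_def)
    qed
    have Fm: "F m > 0" "F x > 0" using m1 x2 by (auto intro!: Fpos)
    have up: "real (count_upto A x) ^ h \<le> K' * (x * F x)"
    proof -
      have "real (count_upto A x) ^ h \<le> real (\<Sum>n\<in>{1..B * m}. card (reps {1..h} n (A \<inter> {1..m})))"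
        using card_power_le_sum_reps[of "A \<inter> {1..m}" m] cnt by (metis Int_lower2 of_nat_le_iff
            of_nat_power)
      also have "\<dots> = (\<Sum>n\<in>{1..B * m}. real (card (reps {1..h} n (A \<inter> {1..m}))))" by simp
      also have "\<dots> \<le> (\<Sum>n\<in>{1..B * m}. C' * F (2 ^ B * real m))"
      proof (intro sum_mono)
        fix n assume n: "n \<in> {1..B * m}"
        have "card (reps {1..h} n (A \<inter> {1..m})) \<le> card (reps {1..h} n A)"
          using finite_reps by (intro card_mono) (auto simp: reps_def hits_def)
        then have "real (card (reps {1..h} n (A \<inter> {1..m}))) \<le> C' * F n" using r'[of n] n by auto
        also have "\<dots> \<le> C' * F (2 ^ B * real m)"
        proof (intro mult_left_mono Fmono C'0)
          have "real n \<le> real B * real m" using n by (simp flip: of_nat_mult)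
          also have "\<dots> \<le> 2 ^ B * real m"
            using of_nat_less_two_power[of B, where 'a = real] by (intro mult_right_mono) auto
          finally show "real n \<le> 2 ^ B * real m" .
        qed (use n in auto)
        finally show "real (card (reps {1..h} n (A \<inter> {1..m}))) \<le> C' * F (2 ^ B * real m)" .
      qed
      also have "\<dots> = real B * real m * (C' * F (2 ^ B * real m))" by simp
      also have "\<dots> \<le> real B * real m * (C' * (D ^ B * F m))"
        using m1 C'0 by (intro mult_left_mono F_doubling_power) auto
      also have "\<dots> = real B * C' * D ^ B * (real m * F m)" by simp
      also have "\<dots> \<le> real B * C' * D ^ B * (x * F x)"
        using mx m1 Fm C'0 D1 by (intro mult_left_mono mult_mono Fmono) auto
      also have "\<dots> \<le> K' * (x * F x)"
        using x2 Fm by (intro mult_right_mono) (auto simp: K'_def)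
      finally show ?thesis .
    qed
    have low: "K * (x * F x) \<le> real (count_upto A x) ^ h"
    proof -
      define m' where "m' = m div 2"
      let ?X = "{m - m'..m}"
      have mm': "real m' \<le> real m / 2" "real m / 2 - 1 / 2 \<le> real m'" unfolding m'_def by linarith+
      have Fm2: "F (real m / 2) \<ge> F m / D"
      proof -
        have "F (2 * (real m / 2)) \<le> D * F (real m / 2)" using m2 by (intro Fdoub) auto
        then show ?thesis using D1 by (simp add: field_simps)
      qed
      have "K * (x * F x) \<le> K * ((2 * real m) * (D * F m))"
      proof (intro mult_left_mono mult_mono)
        show "x \<le> 2 * real m" using mx m1 by linarith
        then have "F x \<le> F (2 * real m)" using x2 by (intro Fmono) auto
        also have "\<dots> \<le> D * F m" using m1 by (intro Fdoub) auto
        finally show "F x \<le> D * F m" .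
      qed (use K x2 Fm in auto)
      also have "\<dots> = (real m / 2) * (c * (F m / D))" using D1 by (simp add: K_def field_simps)
      also have "\<dots> \<le> real (card ?X) * (c * F (real m / 2))"
        using mm' c Fm2 Fm D1 by (intro mult_mono) (auto simp: m'_def)
      also have "\<dots> = (\<Sum>n\<in>?X. c * F (real m / 2))" by simp
      also have "\<dots> \<le> (\<Sum>n\<in>?X. real (card (reps {1..h} n A)))"
      proof (rule sum_mono)
        fix n assume n: "n \<in> ?X"
        have nm: "real m / 2 \<le> real n" using n unfolding m'_def by (simp add: field_simps) linarith
        then have "n \<ge> n1" using m2 by linarith
        have "c * F (real m / 2) \<le> c * F n" using c m2 nm by (intro mult_left_mono Fmono) auto
        also have "\<dots> \<le> real (card (reps {1..h} n A))" using r[OF \<open>n \<ge> n1\<close>] by simp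
        finally show "c * F (real m / 2) \<le> real (card (reps {1..h} n A))" .
      qed
      also have "\<dots> = real (\<Sum>n\<in>?X. card (reps {1..h} n A))" by simp
      also have "\<dots> \<le> real (card (A \<inter> {1..m}) ^ h)"
        using sum_reps_le_card_power[of ?X m A] by (simp only: of_nat_le_iff) auto
      finally show ?thesis by (simp add: cnt)
    qed
    show ?case using low up by blast
  qed
  then show ?thesis using K by blast
qed

lemma conclusion:
  "\<exists>A :: nat set.
     (\<lambda>x. real (count_upto A x)) \<in> \<Theta>(\<lambda>x. (x * F x) powr (1 / real h))
   \<and> (\<lambda>n. real (rep_count b A h n)) \<in> \<Theta>(\<lambda>n. F n)"
proof -
  obtain c C n1 A where c: "c > 0" "C \<ge> 0" and A: "0 \<notin> A"
    and r: "\<And>n. n \<ge> n1 \<Longrightarrow> c * F n \<le> real (card (reps {1..h} n A)) \<and> real (card (reps {1..h} n A)) \<le>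
        C * F n"
    using infinite_construction by blast
  obtain K K' where K: "K > 0" "K' > 0"
    and ev: "eventually (\<lambda>x. K * (x * F x) \<le> real (count_upto A x) ^ h \<and> real (count_upto A x) ^ h
        \<le> K' * (x * F x)) at_top"
    using counting_bounds[OF A c r] by blast
  let ?a = "1 / real h"
  have root: "(y ^ h) powr ?a = y" if "y \<ge> 0" for y :: real
    using that h2 by (cases "y = 0") (auto simp: powr_realpow[symmetric] powr_powr)
  have ev': "eventually (\<lambda>x. K powr ?a * (x * F x) powr ?a \<le> real (count_upto A x) \<and>
     real (count_upto A x) \<le> K' powr ?a * (x * F x) powr ?a) at_top"
    using ev eventually_ge_at_top[of 1]
  proof eventually_elim
    case (elim x)
    have xF: "x * F x > 0" using elim Fpos[of x] by simp
    have "(K * (x * F x)) powr ?a \<le> (real (count_upto A x) ^ h) powr ?a"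
      using elim xF K by (intro powr_mono2) auto
    moreover have "(real (count_upto A x) ^ h) powr ?a \<le> (K' * (x * F x)) powr ?a"
      using elim by (intro powr_mono2) auto
    ultimately show ?case using xF K by (simp add: root powr_mult)
  qed
  have "(\<lambda>x. real (count_upto A x)) \<in> \<Theta>(\<lambda>x. (x * F x) powr ?a)"
  proof (rule bigthetaI)
    show "(\<lambda>x. real (count_upto A x)) \<in> O(\<lambda>x. (x * F x) powr ?a)"
      by (rule bigoI[of _ "K' powr ?a"]) (use ev' in eventually_elim, simp)
    show "(\<lambda>x. real (count_upto A x)) \<in> \<Omega>(\<lambda>x. (x * F x) powr ?a)"
      by (rule landau_omega.bigI[of "K powr ?a"]) (use K in simp, use ev' in eventually_elim, simp)
  qed
  moreover have "(\<lambda>n. real (rep_count b A h n)) \<in> \<Theta>(\<lambda>n. F n)"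
  proof (rule bigthetaI)
    show "(\<lambda>n. real (rep_count b A h n)) \<in> O(\<lambda>n. F n)"
    proof (rule bigoI[of _ C])
      show "eventually (\<lambda>n. norm (real (rep_count b A h n)) \<le> C * norm (F n)) at_top"
        using eventually_ge_at_top[of "max 1 n1"]
      proof eventually_elim
        case (elim n)
        then show ?case using r[of n] Fpos[of "real n"] by (simp add: rep_count_eq[OF A])
      qed
    qed
    show "(\<lambda>n. real (rep_count b A h n)) \<in> \<Omega>(\<lambda>n. F n)"
    proof (rule landau_omega.bigI[OF c(1)])
      show "eventually (\<lambda>n. norm (real (rep_count b A h n)) \<ge> c * norm (F n)) at_top"
        using eventually_ge_at_top[of "max 1 n1"]
      proof eventually_elim
        case (elim n)
        then show ?case using r[of n] Fpos[of "real n"] by (simp add: rep_count_eq[OF A])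
      qed
    qed
  qed
  ultimately show ?thesis by blast
qed

end

section \<open>From Landau symbols to inequalities valid for all \<open>x \<ge> 1\<close>\<close>

lemma bigo_uniform_bound:
  fixes f g :: "real \<Rightarrow> real"
  assumes "f \<in> O(g)" and g: "g 1 > 0" "\<And>x. x \<ge> 1 \<Longrightarrow> g 1 \<le> g x"
    and f: "\<And>x y. 1 \<le> x \<Longrightarrow> x \<le> y \<Longrightarrow> f x \<le> f y"
  shows "\<exists>K\<ge>1. \<forall>x\<ge>1. f x \<le> K * g x"
proof -
  obtain c where "eventually (\<lambda>x. norm (f x) \<le> c * norm (g x)) at_top"
    using assms(1) by (rule landau_o.bigE)
  then obtain X where X: "\<And>x. x \<ge> X \<Longrightarrow> norm (f x) \<le> c * norm (g x)"
    unfolding eventually_at_top_linorder by blast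
  define Y where "Y = max X 1"
  \<comment> \<open>On the initial interval \<open>f\<close> is at most
    \<open>\<bar>f Y\<bar>\<close> and \<open>g\<close> at least \<open>g 1\<close>, by monotonicity
    of \<open>f\<close> and the lower bound on \<open>g\<close>.\<close>
  define K where "K = max 1 (max c (\<bar>f Y\<bar> / g 1))"
  have "f x \<le> K * g x" if x: "x \<ge> 1" for x
  proof (cases "x \<ge> Y")
    case True
    have "f x \<le> c * g x" using X[of x] True g x by (force simp: Y_def)
    also have "\<dots> \<le> K * g x" using g x by (intro mult_right_mono) (auto simp: K_def intro:
        order_trans less_imp_le)
    finally show ?thesis .
  next
    case False
    have "f x \<le> \<bar>f Y\<bar>" using f[OF x, of Y] False by linarith
    also have "\<dots> = \<bar>f Y\<bar> / g 1 * g 1" using g by simp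
    also have "\<dots> \<le> K * g x" using g x by (intro mult_mono) (auto simp: K_def)
    finally show ?thesis .
  qed
  then show ?thesis by (intro exI[of _ K]) (auto simp: K_def)
qed

theorem theorem3:
  fixes h :: nat and b :: "nat \<Rightarrow> nat" and F :: "real \<Rightarrow> real"
  assumes h2: "h \<ge> 2"
    and bpos: "\<forall>i\<in>{1..h}. b i > 0"
    and bgcd: "Gcd (b ` {1..h}) = 1"
    and Fpos: "\<forall>x\<ge>1. F x > 0"
    and Fmono: "mono_on {1..} F"
    and Fint: "\<forall>y\<ge>1. F integrable_on {1..y}"
    and Fdoub: "(\<lambda>x. F (2 * x)) \<in> O(F)"
    and Fgrowth: "((\<lambda>x. ln x) \<in> O(F) \<and> F \<in> O(\<lambda>x. x powr (1 / (real h - 1))))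
                 \<or> ((\<lambda>x. (ln x) ^ (2 * h^2)) \<in> O(F) \<and> F \<in> O(\<lambda>x. x powr (real h - 1)))"
  shows "\<exists>A :: nat set.
           (\<lambda>x. real (count_upto A x)) \<in> \<Theta>(\<lambda>x. (x * F x) powr (1 / real h))
         \<and> (\<lambda>n. real (rep_count b A h n)) \<in> \<Theta>(\<lambda>n. F n)"
proof -
  have mono: "F x \<le> F y" if "1 \<le> x" "x \<le> y" for x y
    using mono_onD[OF Fmono, of x y] that by simp
  have F1: "F 1 > 0" using Fpos by simp
  have hr: "real h - 1 \<ge> 1" using h2 by simp
  have pw: "x powr (real h - 1) = x ^ (h - 1)" if "x > 0" for x :: real
    using powr_realpow[OF that, of "h - 1"] h2 by (simp add: of_nat_diff)
  \<comment> \<open>From here on the two alternatives are merged: for \<open>x \<ge> exp 1\<close>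
    the logarithm is at least 1 and thus below its powers, and x^(1/(h-1)) is at most x^(h-1) for
    \<open>x \<ge> 1\<close>.\<close>
  have "ln \<in> O(\<lambda>x::real. (ln x) ^ (2 * h^2))"
  proof (rule bigoI[of _ 1])
    show "eventually (\<lambda>x::real. norm (ln x) \<le> 1 * norm ((ln x) ^ (2 * h^2))) at_top"
      using eventually_ge_at_top[of "exp 1 :: real"]
    proof eventually_elim
      case (elim x)
      have "0 < x" using elim exp_gt_zero[of "1::real"] by linarith
      then have "1 \<le> ln x" using elim by (simp add: ln_ge_iff)
      then show ?case using h2 by (simp add: self_le_power)
    qed
  qed
  then have lnO: "ln \<in> O(F)" using Fgrowth landau_o.big_trans by blast
  have "(\<lambda>x. x powr (1 / (real h - 1))) \<in> O(\<lambda>x. x powr (real h - 1))"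
  proof (rule bigoI[of _ 1])
    show "eventually (\<lambda>x. norm (x powr (1 / (real h - 1))) \<le> 1 * norm (x powr (real h - 1))) at_top"
      using eventually_ge_at_top[of 1]
    proof eventually_elim
      case (elim x)
      have "1 / (real h - 1) \<le> real h - 1" using hr by (simp add: divide_le_eq) (metis hr
          mult_mono' mult_1 zero_le_one order_trans)
      then show ?case using elim by (simp add: powr_mono)
    qed
  qed
  then have "F \<in> O(\<lambda>x. x powr (real h - 1))" using Fgrowth landau_o.big_trans by blast
  also have "(\<lambda>x. x powr (real h - 1)) \<in> \<Theta>(\<lambda>x. x ^ (h - 1))"
    by (intro bigthetaI_cong eventually_mono[OF eventually_gt_at_top[of 0]]) (rule pw)
  finally have upO: "F \<in> O(\<lambda>x. x ^ (h - 1))" .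
  obtain D where D: "D \<ge> 1" "\<forall>x\<ge>1. F (2 * x) \<le> D * F x"
    using bigo_uniform_bound[OF Fdoub F1] mono by auto
  obtain L where L: "L \<ge> 1" "\<forall>x\<ge>1. ln x \<le> L * F x"
    using bigo_uniform_bound[OF lnO F1] mono by auto
  obtain CU where CU: "CU \<ge> 1" "\<forall>x\<ge>1. F x \<le> CU * x ^ (h - 1)"
    using bigo_uniform_bound[OF upO] mono by auto
  interpret growth h b F D "1 / L" CU
  proof
    show "1 \<le> b i" if "i \<in> {1..h}" for i using bpos that by (simp add: Suc_le_eq)
    show "1 / L * ln x \<le> F x" if "x \<ge> 1" for x using L that by (simp add: field_simps)
  qed (use assms mono D CU L in auto)
  show ?thesis by (rule conclusion)
qed

end
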